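(* Let $n\ge2$ be an integer, $R\in(0,\infty)$, $B=B(0,R)\subseteq\mathbb{R}^n$, $p\in(1,\infty)$, $l\in(0,p)$, $\theta\in(0,1]$. Let $\phi:\mathbb{R}\to\mathbb{R}$ be a continuous odd function with $\tau\phi(\tau)>0$ for almost every $\tau$. Let $a\in W^{1,1}_{loc}([0,R))$ with $a>0$ a.e. on $(0,R)$. Let $h=h(\tau,\lambda_0,\lambda_1):(0,R)\times\mathbb{R}^2\to\mathbb{R}$ be a Carathéodory function and let $q:(0,R)\to[0,\infty)$ be in $L^1_{loc}([0,R))$. Let $w\in C^1(B)$ be a radial function such that $w(0)=0$ and $\Phi_p(\nabla w)\in W^{1,1}_{loc}(B,|x|^{-(n-1)}dx)$. Suppose that one of the following two cases holds, and define $v$ accordingly: ($\mathcal{ND}_n$) $v:=\delta_a$, and $w$ is a solution in $\mathcal{D}'(B)$ of $$-a(|x|)\,\mathrm{div}(|\nabla w(x)|^{p-2}\nabla w(x))+h\left(|x|,w(x),\left\langle\nabla w(x),\tfrac{x}{|x|}\right\rangle\right)=\phi(w(x));$$ ($\mathcal{D}_n$) $v:=d_a$, and $w$ is a solution in $\mathcal{D}'(B)$ of $$-\mathrm{div}(a(|x|)|\nabla w(x)|^{p-2}\nabla w(x))+h\left(|x|,w(x),\left\langle\nabla w(x),\tfrac{x}{|x|}\right\rangle\right)=\phi(w(x)).$$ Assume, for this $v$, that $v>0$ a.e. on $(0,R)$, that $v\in L^1_{loc}([0,R))$ and $v^{-1/(p-1)}\in L^1_{loc}([0,R))$, that for a.e.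 $\tau\in(0,R)$ and all $\lambda_0,\lambda_1\in\mathbb{R}$ $$h(\tau,\lambda_0,\lambda_1)\lambda_1\le\theta q(\tau)|\lambda_0|^l|\lambda_1|^{p-l}+(1-\theta)v(\tau)|\lambda_1|^p,$$ and that $K(0,r,q,v)<\infty$ for every $0<r<R$. Then $w\equiv0$. In particular, if $h(\cdot,0,0)\ne0$ on a set of positive measure in $(0,R)$, then such $w$ cannot exist.
   Context: $\Phi_p(\lambda)=|\lambda|^{p-2}\lambda$ for $\lambda\in\mathbb{R}^k\setminus\{0\}$ and $\Phi_p(0)=0$ (same notation for every $k$). $\langle\cdot,\cdot\rangle$ is the standard inner product. A function $w$ is radial if $w(x)=u(|x|)$ for some scalar function $u$. $L^1_{loc}([0,R)):=\bigcap_{0<r<R}L^1((0,r))$ and $W^{1,1}_{loc}([0,R)):=\bigcap_{0<r<R}W^{1,1}((0,r))$. $W^{1,1}_{loc}(B,|x|^{-(n-1)}dx)$ is the weighted local Sobolev space: (vector-valued) functions $F$ with weak first derivatives such that $\int_{B(0,r)}(|F|+|\nabla F|)|x|^{-(n-1)}dx<\infty$ for every $0<r<R$. A Carathéodory function $h(\tau,\lambda_0,\lambda_1)$ is measurable in $\tau$ and continuous in $(\lambda_0,\lambda_1)$. For a.e. $\tau\in(0,R)$: $\delta_a(\tau):=(n-1)\frac{a(\tau)}{\tau}-\left(1-\frac1p\right)a'(\tau)$ and $d_a(\tau):=(n-1)\frac{a(\tau)}{\tau}+\frac1p a'(\tau)$. For $0\le s<r\le R$, measurable $q\ge0$ and $v>0$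 a.e., $$K(s,r,q,v):=\left(\frac{p-l}{p}\right)^{\frac{p-l}{p}}\left[\int_s^r q(t)^{\frac pl}v(t)^{-\frac{p-l}{l}}\left(\int_s^t v(\sigma)^{-\frac1{p-1}}d\sigma\right)^{p-1}dt\right]^{\frac lp}.$$ *)

theory Defs
  imports "HOL-Analysis.Analysis"
begin

section \<open>Gradients and test functions\<close>

text \<open>Only meaningful at points of differentiability, where the gradient is unique.\<close>

definition grad :: "('a::euclidean_space \<Rightarrow> real) \<Rightarrow> 'a \<Rightarrow> 'a" where
  "grad f x = (THE D. GDERIV f x :> D)"

definition C1_on :: "'a::euclidean_space set \<Rightarrow> ('a \<Rightarrow> real) \<Rightarrow> bool" where
  "C1_on U f \<longleftrightarrow> (\<forall>x\<in>U. GDERIV f x :> grad f x) \<and> continuous_on U (grad f)"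

fun C_k :: "nat \<Rightarrow> ('a::euclidean_space \<Rightarrow> real) \<Rightarrow> bool" where
  "C_k 0 f \<longleftrightarrow> continuous_on UNIV f"
| "C_k (Suc k) f \<longleftrightarrow>
     (\<forall>x. GDERIV f x :> grad f x) \<and> (\<forall>b\<in>Basis. C_k k (\<lambda>x. grad f x \<bullet> b))"

definition test_function :: "'a::euclidean_space set \<Rightarrow> ('a \<Rightarrow> real) \<Rightarrow> bool" where
  "test_function U \<eta> \<longleftrightarrow>
     (\<forall>k. C_k k \<eta>) \<and> compact (closure {x. \<eta> x \<noteq> 0}) \<and> closure {x. \<eta> x \<noteq> 0} \<subseteq> U"

section \<open>Weak derivatives and Sobolev spaces\<close>

definition loc_integrable ::
    "'a::euclidean_space set \<Rightarrow> ('a \<Rightarrow> 'b::euclidean_space) \<Rightarrow> bool" where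
  "loc_integrable U f \<longleftrightarrow> (\<forall>K. compact K \<and> K \<subseteq> U \<longrightarrow> f absolutely_integrable_on K)"

definition weak_partial ::
    "'a::euclidean_space set \<Rightarrow> 'a \<Rightarrow> ('a \<Rightarrow> 'b::euclidean_space) \<Rightarrow> ('a \<Rightarrow> 'b) \<Rightarrow> bool" where
  "weak_partial U b F G \<longleftrightarrow> loc_integrable U F \<and> loc_integrable U G \<and>
     (\<forall>\<eta>. test_function U \<eta> \<longrightarrow>
        (LINT x:U|lebesgue. (grad \<eta> x \<bullet> b) *\<^sub>R F x) = - (LINT x:U|lebesgue. \<eta> x *\<^sub>R G x))"

definition weak_div ::
    "'a::euclidean_space set \<Rightarrow> ('a \<Rightarrow> 'a) \<Rightarrow> ('a \<Rightarrow> real) \<Rightarrow> bool" where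
  "weak_div U F g \<longleftrightarrow> loc_integrable U F \<and> loc_integrable U g \<and>
     (\<forall>\<eta>. test_function U \<eta> \<longrightarrow>
        (LINT x:U|lebesgue. F x \<bullet> grad \<eta> x) = - (LINT x:U|lebesgue. g x * \<eta> x))"

definition L1_loc :: "real \<Rightarrow> (real \<Rightarrow> real) \<Rightarrow> bool" where
  "L1_loc R f \<longleftrightarrow> (\<forall>r. 0 < r \<and> r < R \<longrightarrow> f absolutely_integrable_on {0<..<r})"

text \<open>\<open>f\<close> belongs to \<open>W\<^sup>1\<^sup>,\<^sup>1\<close> on every interval \<open>(0,r)\<close> with \<open>0 < r < R\<close>, and \<open>f'\<close> is its
  weak derivative, which is unique up to null sets.\<close>

definition W11_loc :: "real \<Rightarrow> (real \<Rightarrow> real) \<Rightarrow> (real \<Rightarrow> real) \<Rightarrow> bool" where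
  "W11_loc R f f' \<longleftrightarrow> (\<forall>r. 0 < r \<and> r < R \<longrightarrow>
     f absolutely_integrable_on {0<..<r} \<and> f' absolutely_integrable_on {0<..<r} \<and>
     weak_partial {0<..<r} 1 f f')"

text \<open>The weight is \<open>|x|\<^sup>-\<^sup>(\<^sup>n\<^sup>-\<^sup>1\<^sup>)\<close>, where \<open>n\<close> is the dimension; \<open>DF b\<close> is the weak partial
  derivative of \<open>F\<close> in direction \<open>b\<close>, and the size of the full weak gradient is its
  Frobenius norm.\<close>

definition weighted_W11_loc ::
    "real \<Rightarrow> ('a::euclidean_space \<Rightarrow> 'b::euclidean_space) \<Rightarrow> bool" where
  "weighted_W11_loc R F \<longleftrightarrow> (\<exists>DF. (\<forall>b\<in>Basis. weak_partial (ball 0 R) b F (DF b)) \<and>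
     (\<forall>r. 0 < r \<and> r < R \<longrightarrow>
        (\<lambda>x. (norm (F x) + L2_set (\<lambda>b. norm (DF b x)) Basis)
              * norm x powr (- (real DIM('a) - 1))) absolutely_integrable_on ball 0 r))"

section \<open>Data of the equations\<close>

text \<open>At \<open>0\<close> the value is \<open>0\<close>, whatever \<open>p\<close> is.\<close>

definition Phi :: "real \<Rightarrow> 'a::euclidean_space \<Rightarrow> 'a" where
  "Phi p x = norm x powr (p - 2) *\<^sub>R x"

definition radial_on :: "'a::euclidean_space set \<Rightarrow> ('a \<Rightarrow> real) \<Rightarrow> bool" where
  "radial_on U w \<longleftrightarrow> (\<exists>u. \<forall>x\<in>U. w x = u (norm x))"

definition caratheodory :: "real \<Rightarrow> (real \<Rightarrow> real \<Rightarrow> real \<Rightarrow> real) \<Rightarrow> bool" where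
  "caratheodory R h \<longleftrightarrow>
     (\<forall>y z. (\<lambda>\<tau>. h \<tau> y z) \<in> borel_measurable (lebesgue_on {0<..<R})) \<and>
     (AE \<tau> in lebesgue. \<tau> \<in> {0<..<R} \<longrightarrow> continuous_on UNIV (\<lambda>(y, z). h \<tau> y z))"

definition delta_coeff ::
    "nat \<Rightarrow> real \<Rightarrow> (real \<Rightarrow> real) \<Rightarrow> (real \<Rightarrow> real) \<Rightarrow> real \<Rightarrow> real" where
  "delta_coeff n p a a' \<tau> = (real n - 1) * (a \<tau> / \<tau>) - (1 - 1 / p) * a' \<tau>"

definition d_coeff ::
    "nat \<Rightarrow> real \<Rightarrow> (real \<Rightarrow> real) \<Rightarrow> (real \<Rightarrow> real) \<Rightarrow> real \<Rightarrow> real" where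
  "d_coeff n p a a' \<tau> = (real n - 1) * (a \<tau> / \<tau>) + 1 / p * a' \<tau>"

text \<open>Powers with positive exponent of possibly infinite quantities.\<close>

definition ennreal_pow :: "ennreal \<Rightarrow> real \<Rightarrow> ennreal" where
  "ennreal_pow x e = (if x = \<infinity> then \<infinity> else ennreal (enn2real x powr e))"

definition K_const ::
    "real \<Rightarrow> real \<Rightarrow> real \<Rightarrow> real \<Rightarrow> (real \<Rightarrow> real) \<Rightarrow> (real \<Rightarrow> real) \<Rightarrow> ennreal" where
  "K_const p l s r q v =
     ennreal (((p - l) / p) powr ((p - l) / p)) *
     ennreal_pow
       (\<integral>\<^sup>+t\<in>{s<..<r}. ennreal (q t powr (p / l) * v t powr (- ((p - l) / l))) *
          ennreal_pow (\<integral>\<^sup>+\<sigma>\<in>{s<..<t}. ennreal (v \<sigma> powr (- (1 / (p - 1)))) \<partial>lebesgue) (p - 1)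
        \<partial>lebesgue)
       (l / p)"

section \<open>The two equations\<close>

definition lower_order ::
    "(real \<Rightarrow> real \<Rightarrow> real \<Rightarrow> real) \<Rightarrow> ('a::euclidean_space \<Rightarrow> real) \<Rightarrow> 'a \<Rightarrow> real" where
  "lower_order h w x = h (norm x) (w x) (grad w x \<bullet> (x /\<^sub>R norm x))"

text \<open>In both definitions every term is required to be a distribution, so the functions involved
  are locally integrable. Here \<open>g\<close> is the weak divergence of \<open>Phi p (grad w)\<close>, a locally
  integrable function, so its product with the coefficient makes sense.\<close>

definition solves_nondiv ::
    "real \<Rightarrow> real \<Rightarrow> (real \<Rightarrow> real) \<Rightarrow> (real \<Rightarrow> real \<Rightarrow> real \<Rightarrow> real) \<Rightarrow> (real \<Rightarrow> real) \<Rightarrow>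
     ('a::euclidean_space \<Rightarrow> real) \<Rightarrow> bool" where
  "solves_nondiv R p a h \<phi> w \<longleftrightarrow> (\<exists>g.
     weak_div (ball 0 R) (\<lambda>x. Phi p (grad w x)) g \<and>
     loc_integrable (ball 0 R) (\<lambda>x. a (norm x) * g x) \<and>
     loc_integrable (ball 0 R) (lower_order h w) \<and>
     loc_integrable (ball 0 R) (\<lambda>x. \<phi> (w x)) \<and>
     (\<forall>\<eta>. test_function (ball 0 R) \<eta> \<longrightarrow>
        - (LINT x:ball 0 R|lebesgue. a (norm x) * g x * \<eta> x)
        + (LINT x:ball 0 R|lebesgue. lower_order h w x * \<eta> x)
        = (LINT x:ball 0 R|lebesgue. \<phi> (w x) * \<eta> x)))"

definition solves_div ::
    "real \<Rightarrow> real \<Rightarrow> (real \<Rightarrow> real) \<Rightarrow> (real \<Rightarrow> real \<Rightarrow> real \<Rightarrow> real) \<Rightarrow> (real \<Rightarrow> real) \<Rightarrow>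
     ('a::euclidean_space \<Rightarrow> real) \<Rightarrow> bool" where
  "solves_div R p a h \<phi> w \<longleftrightarrow>
     loc_integrable (ball 0 R) (\<lambda>x. a (norm x) *\<^sub>R Phi p (grad w x)) \<and>
     loc_integrable (ball 0 R) (lower_order h w) \<and>
     loc_integrable (ball 0 R) (\<lambda>x. \<phi> (w x)) \<and>
     (\<forall>\<eta>. test_function (ball 0 R) \<eta> \<longrightarrow>
        (LINT x:ball 0 R|lebesgue. (a (norm x) *\<^sub>R Phi p (grad w x)) \<bullet> grad \<eta> x)
        + (LINT x:ball 0 R|lebesgue. lower_order h w x * \<eta> x)
        = (LINT x:ball 0 R|lebesgue. \<phi> (w x) * \<eta> x))"

text \<open>The functions \<open>w\<close> to which the uniqueness statement applies; \<open>a'\<close> is the weak derivative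
  of \<open>a\<close>, and \<open>v\<close> is the coefficient function attached to the equation that \<open>w\<close> solves.\<close>

definition admissible_solution ::
    "real \<Rightarrow> real \<Rightarrow> (real \<Rightarrow> real) \<Rightarrow> (real \<Rightarrow> real) \<Rightarrow> (real \<Rightarrow> real) \<Rightarrow>
     (real \<Rightarrow> real \<Rightarrow> real \<Rightarrow> real) \<Rightarrow> (real \<Rightarrow> real) \<Rightarrow> ('a::euclidean_space \<Rightarrow> real) \<Rightarrow> bool" where
  "admissible_solution R p a a' v h \<phi> w \<longleftrightarrow>
     C1_on (ball 0 R) w \<and> radial_on (ball 0 R) w \<and> w 0 = 0 \<and>
     weighted_W11_loc R (\<lambda>x. Phi p (grad w x)) \<and>
     ((v = delta_coeff DIM('a) p a a' \<and> solves_nondiv R p a h \<phi> w) \<or>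
      (v = d_coeff DIM('a) p a a' \<and> solves_div R p a h \<phi> w))"

end

theory Submission
  imports Defs
begin

text \<open>Write \<open>w x = u (norm x)\<close>. Tested with radial functions, either equation becomes an ordinary
differential equation for the profile \<open>u\<close>. Multiplied by \<open>u'\<close>, and with the continuous
representative \<open>A\<close> of \<open>a\<close>, it is the energy balance

  \<open>((1 - 1/p) A |u'|\<^sup>p + \<Psi>(u))' + v |u'|\<^sup>p = h(t, u, u') u'\<close>, where \<open>\<Psi>' = \<phi>\<close> and \<open>\<Psi>(0) = 0\<close>.

The coefficient \<open>v\<close> collects what \<open>a'\<close> and the curvature term \<open>(n - 1) a(t)/t\<close> leave over; this
is where \<open>delta_coeff\<close> and \<open>d_coeff\<close> come from. The energy in the bracket is nonnegative
because of the sign of \<open>\<phi>\<close>, and it vanishes at \<open>0\<close> because \<open>u(0) = u'(0) = 0\<close>. Integrating and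
inserting the bound on \<open>h\<close> gives (\<open>energy_bound\<close>)

  \<open>0 \<le> energy(r) \<le> \<theta> \<integral>\<^sub>0\<^sup>r (q |u|\<^sup>l |u'|\<^sup>p\<^sup>-\<^sup>l - v |u'|\<^sup>p) dt\<close>.

Suppose that \<open>u\<close> vanishes on \<open>[0,s]\<close>, and put \<open>G = \<integral>\<^sub>s\<^sup>r v |u'|\<^sup>p dt\<close>. The inequalities of Hoelder
and Young, in the manner of Opial, bound \<open>\<integral>\<^sub>s\<^sup>r q |u|\<^sup>l |u'|\<^sup>p\<^sup>-\<^sup>l dt\<close> by
\<open>(l/p) G \<integral>\<^sub>s\<^sup>r \<kappa> dt + ((p - l)/p) G\<close>, where \<open>\<kappa>\<close> is the integrand of \<open>K_const\<close>. Since \<open>\<kappa>\<close> is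
integrable, \<open>\<integral>\<^sub>s\<^sup>r \<kappa> dt < 1\<close> if \<open>r\<close> is close to \<open>s\<close>, and then \<open>G = 0\<close>, so that \<open>u\<close> vanishes on
\<open>[0,r]\<close> too (\<open>vanishing_step\<close>). Finitely many such steps of one fixed length cover any
interval \<open>[0,\<rho>]\<close> with \<open>\<rho> < R\<close> (\<open>profile_vanishes\<close>).

The rest is the passage from the distributional equation to the profile. Test functions that
approximate the indicator of a spherical shell show that \<open>t\<^sup>n\<^sup>-\<^sup>1 k(t)\<close> is an indefinite integral of
\<open>t\<^sup>n\<^sup>-\<^sup>1 f(t)\<close> whenever \<open>f(|x|)\<close> is the weak divergence of \<open>k(|x|) x/|x|\<close>
(\<open>radial_weak_imp_ac_deriv\<close>). For the equation in nondivergence form, \<open>k = Phi p u'\<close> and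
\<open>f = (h - \<phi>)/a\<close>; to divide by \<open>a\<close>, the equation is first read pointwise, with the
fundamental lemma of the calculus of variations. For the equation in divergence form,
\<open>k = A * Phi p u'\<close> and \<open>f = h - \<phi>\<close>, and one has to divide by \<open>A\<close>; it has no zeros in \<open>(0,R)\<close>,
since \<open>v > 0\<close> says that \<open>A(t) t\<^sup>p\<^sup>(\<^sup>n\<^sup>-\<^sup>1\<^sup>)\<close> increases (\<open>positive_if_weighted_increasing\<close>).

Finally, \<open>w = 0\<close> has vanishing flux, so the equation leaves \<open>h(t,0,0) = \<phi>(0) = 0\<close> almost everywhere.\<close>

section \<open>Smooth cutoff functions\<close>

lemma grad_eqI:
  assumes "GDERIV f x :> D"
  shows "grad f x = D"
  unfolding grad_def
proof (rule the_equality)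
  fix D' assume "GDERIV f x :> D'"
  then have "(\<lambda>h. h \<bullet> D') = (\<lambda>h. h \<bullet> D)"
    using assms unfolding gderiv_def by (rule has_derivative_unique)
  then show "D' = D" by (metis vector_eq_ldot inner_commute)
qed (fact assms)

text \<open>A smooth function on the line together with all its derivatives: \<open>D n\<close> is the \<open>n\<close>-th one.\<close>

definition deriv_seq :: "(nat \<Rightarrow> real \<Rightarrow> real) \<Rightarrow> bool" where
  "deriv_seq D \<longleftrightarrow> (\<forall>n x. DERIV (D n) x :> D (Suc n) x)"

lemma deriv_seqD: "deriv_seq D \<Longrightarrow> DERIV (D n) x :> D (Suc n) x"
  by (simp add: deriv_seq_def)

text \<open>A class of functions that is visibly closed under differentiation, rich enough to contain
all test functions that are used: \<open>C_k\<close> then follows by induction on \<open>k\<close>. The rule \<open>comp\<close> admits every derivative \<open>D k\<close>, so that the chain rule stays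
inside the class.\<close>

inductive smooth_gen :: "('a::euclidean_space \<Rightarrow> real) \<Rightarrow> bool" where
  const: "smooth_gen (\<lambda>_. c)"
| inner: "smooth_gen (\<lambda>x. x \<bullet> b)"
| add: "smooth_gen f \<Longrightarrow> smooth_gen g \<Longrightarrow> smooth_gen (\<lambda>x. f x + g x)"
| mult: "smooth_gen f \<Longrightarrow> smooth_gen g \<Longrightarrow> smooth_gen (\<lambda>x. f x * g x)"
| comp: "deriv_seq D \<Longrightarrow> smooth_gen f \<Longrightarrow> smooth_gen (\<lambda>x. D k (f x))"

lemma smooth_gen_sum: "(\<And>i. i \<in> I \<Longrightarrow> smooth_gen (f i)) \<Longrightarrow> smooth_gen (\<lambda>x. \<Sum>i\<in>I. f i x)"
  by (induction I rule: infinite_finite_induct) (auto intro: smooth_gen.const smooth_gen.add smooth_gen.mult)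

lemma smooth_gen_prod: "(\<And>i. i \<in> I \<Longrightarrow> smooth_gen (f i)) \<Longrightarrow> smooth_gen (\<lambda>x. \<Prod>i\<in>I. f i x)"
  by (induction I rule: infinite_finite_induct) (auto intro: smooth_gen.const smooth_gen.add smooth_gen.mult)

lemma smooth_gen_cmult: "smooth_gen f \<Longrightarrow> smooth_gen (\<lambda>x. c * f x)"
  by (rule smooth_gen.mult[OF smooth_gen.const])

lemma smooth_gen_diff:
  assumes "smooth_gen f" "smooth_gen g" shows "smooth_gen (\<lambda>x. f x - g x)"
  using smooth_gen.add[OF assms(1) smooth_gen_cmult[OF assms(2), of "-1"]] by simp

lemma smooth_gen_id: "smooth_gen (\<lambda>x::real. x)"
  using smooth_gen.inner[of "1::real"] by simp

lemma smooth_gen_inner_self: "smooth_gen (\<lambda>x::'a::euclidean_space. x \<bullet> x)"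
  unfolding euclidean_inner[of x x for x :: 'a]
  by (intro smooth_gen_sum smooth_gen.mult smooth_gen.inner)

lemma smooth_gen_grad:
  assumes "smooth_gen f"
  shows "(\<forall>x. GDERIV f x :> grad f x) \<and> (\<forall>b. smooth_gen (\<lambda>x. grad f x \<bullet> b))"
proof -
  have "\<exists>G. (\<forall>x. GDERIV f x :> G x) \<and> (\<forall>b. smooth_gen (\<lambda>x. G x \<bullet> b))"
    using assms
  proof induction
    case (const c)
    show ?case by (rule exI[of _ "\<lambda>_. 0"]) (auto intro: GDERIV_const smooth_gen.const)
  next
    case (inner b)
    have "GDERIV (\<lambda>x. x \<bullet> b) x :> b" for x
      unfolding gderiv_def by (auto intro!: derivative_eq_intros)
    then show ?case by (intro exI[of _ "\<lambda>_. b"]) (auto intro: smooth_gen.const)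
  next
    case (add f g)
    then obtain F G where "\<And>x. GDERIV f x :> F x" "\<And>x. GDERIV g x :> G x"
      "\<And>b. smooth_gen (\<lambda>x. F x \<bullet> b)" "\<And>b. smooth_gen (\<lambda>x. G x \<bullet> b)" by blast
    then show ?case
      by (intro exI[of _ "\<lambda>x. F x + G x"])
         (auto intro: GDERIV_add smooth_gen.add simp: inner_add_left)
  next
    case (mult f g)
    then obtain F G where "\<And>x. GDERIV f x :> F x" "\<And>x. GDERIV g x :> G x"
      "\<And>b. smooth_gen (\<lambda>x. F x \<bullet> b)" "\<And>b. smooth_gen (\<lambda>x. G x \<bullet> b)" by blast
    with mult.hyps show ?case
      by (intro exI[of _ "\<lambda>x. f x *\<^sub>R G x + g x *\<^sub>R F x"])
         (auto intro!: GDERIV_mult smooth_gen.add smooth_gen.mult simp: inner_add_left)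
  next
    case (comp D f k)
    then obtain F where F: "\<And>x. GDERIV f x :> F x" "\<And>b. smooth_gen (\<lambda>x. F x \<bullet> b)" by blast
    have "GDERIV (\<lambda>x. D k (f x)) x :> D (Suc k) (f x) *\<^sub>R F x" for x
      by (rule GDERIV_DERIV_compose[OF F(1) deriv_seqD[OF comp(1)]])
    moreover have "smooth_gen (\<lambda>x. D (Suc k) (f x) *\<^sub>R F x \<bullet> b)" for b
      using smooth_gen.mult[OF smooth_gen.comp[OF comp(1,2), of "Suc k"] F(2)[of b]] by simp
    ultimately show ?case by (intro exI[of _ "\<lambda>x. D (Suc k) (f x) *\<^sub>R F x"]) simp
  qed
  then obtain G where G: "\<And>x. GDERIV f x :> G x" "\<And>b. smooth_gen (\<lambda>x. G x \<bullet> b)" by blast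
  then have "grad f = G" by (auto intro: grad_eqI)
  with G show ?thesis by auto
qed

lemma GDERIV_isCont: "GDERIV f x :> D \<Longrightarrow> isCont f x"
  unfolding gderiv_def by (rule has_derivative_continuous)

lemma smooth_gen_continuous: "smooth_gen f \<Longrightarrow> continuous_on S f"
  using smooth_gen_grad GDERIV_isCont by (metis continuous_at_imp_continuous_on)

lemma smooth_gen_C_k: "smooth_gen f \<Longrightarrow> C_k k f"
  by (induction k arbitrary: f) (auto intro: smooth_gen_continuous simp: smooth_gen_grad)

definition smooth_bump :: "'a::euclidean_space set \<Rightarrow> ('a \<Rightarrow> real) \<Rightarrow> bool" where
  "smooth_bump U \<eta> \<longleftrightarrow> smooth_gen \<eta> \<and> (\<exists>K. compact K \<and> K \<subseteq> U \<and> (\<forall>x. x \<notin> K \<longrightarrow> \<eta> x = 0))"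

lemma smooth_bumpI:
  "smooth_gen \<eta> \<Longrightarrow> compact K \<Longrightarrow> K \<subseteq> U \<Longrightarrow> (\<And>x. x \<notin> K \<Longrightarrow> \<eta> x = 0) \<Longrightarrow> smooth_bump U \<eta>"
  unfolding smooth_bump_def by blast

lemma smooth_bump_test_function:
  assumes "smooth_bump U \<eta>"
  shows "test_function U \<eta>"
proof -
  obtain K where K: "smooth_gen \<eta>" "compact K" "K \<subseteq> U" "\<And>x. x \<notin> K \<Longrightarrow> \<eta> x = 0"
    using assms by (auto simp: smooth_bump_def)
  then have *: "closure {x. \<eta> x \<noteq> 0} \<subseteq> K"
    by (intro closure_minimal) (auto intro: compact_imp_closed)
  moreover have "compact (closure {x. \<eta> x \<noteq> 0})"
    using * K(2) by (metis compact_eq_bounded_closed bounded_subset closed_closure)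
  ultimately show ?thesis
    using K(1,3) by (auto simp: test_function_def intro: smooth_gen_C_k)
qed

text \<open>On the line the gradient is the derivative, so iterating \<open>grad\<close> gives all derivatives.\<close>

lemma smooth_gen_deriv_seq:
  fixes f :: "real \<Rightarrow> real"
  assumes "smooth_gen f"
  obtains D where "deriv_seq D" "D 0 = f"
proof
  have *: "smooth_gen ((grad ^^ n) f)" for n
  proof (induction n)
    case (Suc n)
    have "smooth_gen (\<lambda>x. grad ((grad ^^ n) f) x \<bullet> 1)" using smooth_gen_grad[OF Suc] by blast
    then show ?case by simp
  qed (use assms in auto)
  show "deriv_seq (\<lambda>n. (grad ^^ n) f)"
    unfolding deriv_seq_def using smooth_gen_grad[OF *] gderiv_deriv by (metis funpow.simps(2) o_apply)
qed simp

text \<open>For \<open>P = 1\<close> the classical smooth function \<open>exp (-1/t)\<close> that is flat at \<open>0\<close>; the polynomial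
factors account for its derivatives.\<close>

definition flat :: "real poly \<Rightarrow> real \<Rightarrow> real" where
  "flat P t = (if t \<le> 0 then 0 else poly P (1 / t) * exp (- (1 / t)))"

lemma poly_div_exp_tendsto_0: "((\<lambda>y::real. poly P y / exp y) \<longlongrightarrow> 0) at_top"
proof -
  have "((\<lambda>y::real. \<Sum>i\<le>degree P. coeff P i * (y ^ i / exp y)) \<longlongrightarrow> (\<Sum>i\<le>degree P. coeff P i * 0)) at_top"
    by (intro tendsto_sum tendsto_mult_left tendsto_power_div_exp_0)
  then show ?thesis by (simp add: poly_altdef sum_divide_distrib)
qed

lemma DERIV_flat: "DERIV (flat P) t :> flat ([:0, 0, 1:] * (P - pderiv P)) t"
proof (cases "t = 0")
  case False
  show ?thesis
  proof (cases "t < 0")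
    case True
    have "DERIV (\<lambda>_. 0) t :> (0::real)" by simp
    then have "DERIV (flat P) t :> 0"
      by (rule has_field_derivative_transform_within_open[of _ _ _ "{..<0}"])
         (use True in \<open>auto simp: flat_def\<close>)
    then show ?thesis using True by (simp add: flat_def)
  next
    case False
    with \<open>t \<noteq> 0\<close> have t: "t > 0" by simp
    have "DERIV (\<lambda>t. poly P (1 / t) * exp (- (1 / t))) t :>
        flat ([:0, 0, 1:] * (P - pderiv P)) t"
      using t by (auto intro!: derivative_eq_intros poly_DERIV simp: flat_def)
         (simp add: field_simps power2_eq_square)
    then show ?thesis
      by (rule has_field_derivative_transform_within_open[of _ _ _ "{0<..}"])
         (use t in \<open>auto simp: flat_def\<close>)
  qed
next
  case True
  have "((\<lambda>h::real. flat P h / h) \<longlongrightarrow> 0) (at_left 0)"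
    by (rule tendsto_eventually) (auto simp: eventually_at_left_field flat_def intro!: exI[of _ "-1"])
  moreover have "((\<lambda>h::real. flat P h / h) \<longlongrightarrow> 0) (at_right 0)"
  proof -
    have "((\<lambda>h::real. poly ([:0, 1:] * P) (inverse h) / exp (inverse h)) \<longlongrightarrow> 0) (at_right 0)"
      by (rule filterlim_compose[OF poly_div_exp_tendsto_0 filterlim_inverse_at_top_right])
    moreover have "\<forall>\<^sub>F h in at_right 0. poly ([:0, 1:] * P) (inverse h) / exp (inverse h) = flat P h / h"
      unfolding eventually_at_right_field
      by (intro exI[of _ 1]) (auto simp: flat_def field_simps exp_minus)
    ultimately show ?thesis by (rule Lim_transform_eventually)
  qed
  ultimately have "((\<lambda>h::real. flat P h / h) \<longlongrightarrow> 0) (at 0)"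
    by (simp add: filterlim_split_at)
  then show ?thesis unfolding True DERIV_def by (simp add: flat_def)
qed

text \<open>By \<open>DERIV_flat\<close> the derivatives of \<open>flat P\<close> are again of the form \<open>flat Q\<close>.\<close>

lemma smooth_gen_flat: assumes "smooth_gen f" shows "smooth_gen (\<lambda>x. flat P (f x))"
proof -
  define Q where "Q n = ((\<lambda>P. [:0, 0, 1:] * (P - pderiv P)) ^^ n) P" for n
  have "deriv_seq (\<lambda>n. flat (Q n))"
    unfolding deriv_seq_def using DERIV_flat by (auto simp: Q_def)
  from smooth_gen.comp[OF this assms, of 0] show ?thesis by (simp add: Q_def)
qed

lemma continuous_antiderivative:
  fixes f :: "real \<Rightarrow> real"
  assumes "continuous_on UNIV f"
  obtains F where "\<And>x. DERIV F x :> f x"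
proof -
  have "\<exists>F. \<forall>x::real. -\<infinity> < ereal x \<longrightarrow> ereal x < \<infinity> \<longrightarrow> (F has_vector_derivative f x) (at x)"
    using assms by (intro einterval_antiderivative) (auto simp: continuous_on_eq_continuous_at)
  then show ?thesis using that by (auto simp: has_real_derivative_iff_has_vector_derivative)
qed

lemma smooth_gen_antiderivative:
  fixes f :: "real \<Rightarrow> real"
  assumes "smooth_gen f" "\<And>x. DERIV F x :> f x"
  shows "smooth_gen F"
proof -
  obtain D where D: "deriv_seq D" "D 0 = f" using smooth_gen_deriv_seq[OF assms(1)] .
  define E where "E n = (case n of 0 \<Rightarrow> F | Suc m \<Rightarrow> D m)" for n
  have "deriv_seq E"
    unfolding deriv_seq_def using assms(2) D by (auto simp: E_def deriv_seq_def split: nat.split)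
  from smooth_gen.comp[OF this smooth_gen_id, of 0] show ?thesis by (simp add: E_def)
qed

definition is_step_seq :: "(nat \<Rightarrow> real \<Rightarrow> real) \<Rightarrow> bool" where
  "is_step_seq D \<longleftrightarrow> deriv_seq D \<and> (\<forall>x\<le>0. D 0 x = 0) \<and> (\<forall>x\<ge>1. D 0 x = 1) \<and> (\<forall>x. D 1 x \<ge> 0)"

text \<open>A normalized antiderivative of the bump \<open>exp (-1/x) exp (-1/(1-x))\<close> on \<open>(0,1)\<close>.\<close>

lemma step_seq_exists: "\<exists>D. is_step_seq D"
proof -
  define \<rho> where "\<rho> x = flat 1 x * flat 1 (1 - x)" for x
  have sm: "smooth_gen \<rho>"
    unfolding \<rho>_def
    by (intro smooth_gen.mult smooth_gen_flat smooth_gen_id smooth_gen_diff smooth_gen.const)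
  have nn: "\<rho> x \<ge> 0" for x by (simp add: \<rho>_def flat_def)
  have z: "\<rho> x = 0" if "x \<le> 0 \<or> x \<ge> 1" for x using that by (auto simp: \<rho>_def flat_def)
  have pos: "\<rho> x > 0" if "0 < x" "x < 1" for x using that by (auto simp: \<rho>_def flat_def)
  obtain F where F: "\<And>x::real. DERIV F x :> \<rho> x"
    using continuous_antiderivative[OF smooth_gen_continuous[OF sm]] by blast
  have less: "F 0 < F 1"
  proof -
    have "F 0 < F (1 / 2)"
    proof (rule DERIV_pos_imp_increasing_open[where f = F])
      fix x :: real assume "0 < x" "x < 1 / 2"
      then show "\<exists>y. DERIV F x :> y \<and> 0 < y" using F pos[of x] by auto
    qed (auto intro: DERIV_continuous_on DERIV_subset[OF F])
    moreover have "F (1/2) \<le> F 1"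
      by (rule DERIV_nonneg_imp_nondecreasing[where f = F]) (use F nn in auto)
    ultimately show ?thesis by simp
  qed
  have F0: "F x = F 0" if "x \<le> 0" for x
  proof (rule antisym)
    show "F x \<le> F 0" by (rule DERIV_nonneg_imp_nondecreasing[where f = F, OF that]) (use F nn in auto)
    show "F 0 \<le> F x"
      by (rule DERIV_nonpos_imp_nonincreasing[where f = F, OF that]) (use F z in force)
  qed
  have F1: "F x = F 1" if "1 \<le> x" for x
  proof (rule antisym)
    show "F 1 \<le> F x" by (rule DERIV_nonneg_imp_nondecreasing[where f = F, OF that]) (use F nn in auto)
    show "F x \<le> F 1"
      by (rule DERIV_nonpos_imp_nonincreasing[where f = F, OF that]) (use F z in force)
  qed
  define c where "c = F 1 - F 0"
  have c: "c \<noteq> 0" using less by (simp add: c_def)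
  have "smooth_gen (\<lambda>x. (1 / c) * (F x - F 0))"
    by (intro smooth_gen_cmult smooth_gen_diff smooth_gen.const smooth_gen_antiderivative[OF sm F])
  then obtain E where E: "deriv_seq E" "E 0 = (\<lambda>x. (1 / c) * (F x - F 0))"
    using smooth_gen_deriv_seq by blast
  have "DERIV (E 0) x :> (1 / c) * \<rho> x" for x
    unfolding E(2) using F[of x] c by (auto intro!: derivative_eq_intros)
  then have E1: "E (Suc 0) x = (1 / c) * \<rho> x" for x
    using DERIV_unique[OF deriv_seqD[OF E(1)]] by blast
  have "E 0 x = 0" if "x \<le> 0" for x using F0[OF that] by (simp add: E)
  moreover have "E 0 x = 1" if "1 \<le> x" for x using F1[OF that] c by (simp add: E c_def)
  moreover have "E 1 x \<ge> 0" for x using nn[of x] less by (simp add: E1 c_def)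
  ultimately have "is_step_seq E" using E(1) by (simp add: is_step_seq_def)
  then show ?thesis by blast
qed

definition smooth_step :: "nat \<Rightarrow> real \<Rightarrow> real" where
  "smooth_step = (SOME D. is_step_seq D)"

lemma is_step_seq_smooth_step: "is_step_seq smooth_step"
  unfolding smooth_step_def using step_seq_exists by (rule someI_ex)

lemma smooth_step_deriv_seq: "deriv_seq smooth_step"
  and smooth_step_left: "x \<le> 0 \<Longrightarrow> smooth_step 0 x = 0"
  and smooth_step_right: "x \<ge> 1 \<Longrightarrow> smooth_step 0 x = 1"
  and smooth_step_deriv_nonneg: "smooth_step (Suc 0) x \<ge> 0"
  using is_step_seq_smooth_step by (auto simp: is_step_seq_def)

lemma DERIV_smooth_step: "DERIV (smooth_step 0) x :> smooth_step (Suc 0) x"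
  by (rule deriv_seqD[OF smooth_step_deriv_seq])

lemma continuous_smooth_step: "continuous_on S (smooth_step n)"
  by (rule DERIV_continuous_on) (auto intro: DERIV_subset deriv_seqD[OF smooth_step_deriv_seq])

lemma smooth_step_mono: "x \<le> y \<Longrightarrow> smooth_step 0 x \<le> smooth_step 0 y"
  by (rule DERIV_nonneg_imp_nondecreasing[where f = "smooth_step 0"])
     (use DERIV_smooth_step smooth_step_deriv_nonneg in auto)

lemma smooth_step_bounds: "0 \<le> smooth_step 0 x" "smooth_step 0 x \<le> 1"
  using smooth_step_mono[of "min 0 x" x] smooth_step_mono[of x "max 1 x"]
    smooth_step_left[of "min 0 x"] smooth_step_right[of "max 1 x"] by auto

text \<open>Both ramps have width \<open>1/j\<close> and lie inside \<open>[\<alpha>,\<beta>]\<close>, the second one by the shift \<open>+ 1\<close>. So the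
support stays in \<open>[\<alpha>,\<beta>]\<close> as soon as the interval has length at least \<open>1/j\<close>.\<close>

definition cutoff :: "nat \<Rightarrow> real \<Rightarrow> real \<Rightarrow> real \<Rightarrow> real" where
  "cutoff j \<alpha> \<beta> t = smooth_step 0 (real j * (t - \<alpha>)) - smooth_step 0 (real j * (t - \<beta>) + 1)"

lemma smooth_gen_cutoff: "smooth_gen f \<Longrightarrow> smooth_gen (\<lambda>x. cutoff j \<alpha> \<beta> (f x))"
  unfolding cutoff_def
  by (rule smooth_gen_diff; rule smooth_gen.comp[OF smooth_step_deriv_seq];
      intro smooth_gen.add smooth_gen_cmult smooth_gen_diff smooth_gen.const)

lemma cutoff_outside:
  assumes "real j * (\<beta> - \<alpha>) \<ge> 1" "t \<le> \<alpha> \<or> \<beta> \<le> t"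
  shows "cutoff j \<alpha> \<beta> t = 0"
proof (cases "t \<le> \<alpha>")
  case True
  then have "real j * (t - \<alpha>) \<le> 0" by (simp add: mult_nonneg_nonpos)
  moreover have "real j * (t - \<beta>) + 1 \<le> 0"
    using assms \<open>real j * (t - \<alpha>) \<le> 0\<close> by (simp add: algebra_simps)
  ultimately show ?thesis by (simp add: cutoff_def smooth_step_left)
next
  case False
  with assms have "\<beta> \<le> t" by auto
  then have "real j * (t - \<beta>) \<ge> 0" by simp
  then show ?thesis using assms by (simp add: cutoff_def smooth_step_right algebra_simps)
qed

lemma cutoff_bound: "\<bar>cutoff j \<alpha> \<beta> t\<bar> \<le> 1"
  using smooth_step_bounds[of "real j * (t - \<alpha>)"] smooth_step_bounds[of "real j * (t - \<beta>) + 1"]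
  by (auto simp: cutoff_def)

lemma eventually_real_mult_ge: "0 < (c::real) \<Longrightarrow> \<forall>\<^sub>F j in sequentially. real j * c \<ge> 1"
  using eventually_ge_at_top[of "nat \<lceil>1 / c\<rceil>"]
  by eventually_elim (auto simp: field_simps nat_le_iff ceiling_le_iff)

lemma cutoff_tendsto:
  assumes "\<alpha> < \<beta>"
  shows "(\<lambda>j. cutoff j \<alpha> \<beta> t) \<longlonglongrightarrow> indicator {\<alpha><..<\<beta>} t"
proof (rule tendsto_eventually)
  have 1: "\<forall>\<^sub>F j in sequentially. real j * (\<beta> - \<alpha>) \<ge> 1"
    by (rule eventually_real_mult_ge) (use assms in auto)
  show "\<forall>\<^sub>F j in sequentially. cutoff j \<alpha> \<beta> t = indicator {\<alpha><..<\<beta>} t"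
  proof (cases "\<alpha> < t \<and> t < \<beta>")
    case True
    have "\<forall>\<^sub>F j in sequentially. real j * (t - \<alpha>) \<ge> 1" "\<forall>\<^sub>F j in sequentially. real j * (\<beta> - t) \<ge> 1"
      by (rule eventually_real_mult_ge; use True in simp)+
    then show ?thesis
    proof eventually_elim
      case (elim j)
      then show ?case using True
        by (auto simp: cutoff_def smooth_step_right smooth_step_left algebra_simps)
    qed
  qed (use 1 in \<open>auto elim!: eventually_mono simp: cutoff_outside indicator_def\<close>)
qed

lemma continuous_cutoff: "continuous_on S (cutoff j \<alpha> \<beta>)"
  using smooth_gen_continuous[OF smooth_gen_cutoff[OF smooth_gen_id]] .

section \<open>The fundamental lemma of the calculus of variations\<close>

text \<open>The measures with the densities \<open>max f 0\<close> and \<open>max (- f) 0\<close> agree on boxes, which form a generator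
stable under intersections, hence agree everywhere; densities are unique.\<close>

lemma AE_zero_if_integral_boxes_zero:
  fixes f :: "'a::euclidean_space \<Rightarrow> real"
  assumes f: "integrable lebesgue f" and z: "\<And>a b. (LINT x:box a b|lebesgue. f x) = 0"
  shows "AE x in lebesgue. f x = 0"
proof -
  obtain f' where f'[measurable]: "f' \<in> borel_measurable lborel" and eq: "AE x in lborel. f x = f' x"
    using completion_ex_borel_measurable_real[of f lborel] f by auto
  have eq': "AE x in lebesgue. f x = f' x" using eq by (rule AE_completion)
  have int: "integrable lborel f'"
    using f eq' integrable_cong_AE[of f lebesgue f'] measurable_completion[OF f']
    by (auto simp: integrable_completion)
  have box: "emeasure (density lborel (\<lambda>x. ennreal (f' x))) (box a b) =
      emeasure (density lborel (\<lambda>x. ennreal (- f' x))) (box a b)" for a b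
  proof -
    let ?g = "\<lambda>x. indicator (box a b) x *\<^sub>R f' x"
    have g: "integrable lborel ?g" by (rule integrable_mult_indicator[OF _ int]) auto
    have "(LINT x|lborel. ?g x) = (LINT x|lebesgue. ?g x)"
      using integral_completion[of ?g lborel] by simp
    also have "\<dots> = (LINT x:box a b|lebesgue. f x)"
      unfolding set_lebesgue_integral_def
    proof (rule integral_cong_AE)
      show "?g \<in> borel_measurable lebesgue" by (intro measurable_completion) simp
      show "(\<lambda>x. indicat_real (box a b) x *\<^sub>R f x) \<in> borel_measurable lebesgue"
        using f by (intro borel_measurable_scaleR borel_measurable_indicator) auto
    qed (use eq' in \<open>auto elim!: eventually_mono\<close>)
    finally have "(LINT x|lborel. ?g x) = 0" using z by simp
    then have "enn2real (\<integral>\<^sup>+ x. ennreal (?g x) \<partial>lborel) = enn2real (\<integral>\<^sup>+ x. ennreal (- ?g x) \<partial>lborel)"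
      using real_lebesgue_integral_def[OF g] by simp
    moreover have "(\<integral>\<^sup>+ x. ennreal (?g x) \<partial>lborel) \<noteq> \<infinity>" "(\<integral>\<^sup>+ x. ennreal (- ?g x) \<partial>lborel) \<noteq> \<infinity>"
      using g by (auto simp: real_integrable_def)
    moreover have "A = B" if "enn2real A = enn2real B" "A \<noteq> \<infinity>" "B \<noteq> \<infinity>" for A B :: ennreal
    proof -
      have "ennreal (enn2real A) = A" "ennreal (enn2real B) = B"
        using that(2,3) by (auto intro!: ennreal_enn2real simp: top.not_eq_extremum)
      then show ?thesis using that(1) by metis
    qed
    ultimately have "(\<integral>\<^sup>+ x. ennreal (?g x) \<partial>lborel) = (\<integral>\<^sup>+ x. ennreal (- ?g x) \<partial>lborel)"
      by blast
    moreover have "ennreal (?g x) = ennreal (f' x) * indicator (box a b) x"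
      "ennreal (- ?g x) = ennreal (- f' x) * indicator (box a b) x" for x
      by (auto simp: indicator_def)
    ultimately show ?thesis by (simp add: emeasure_density)
  qed
  have "density lborel (\<lambda>x. ennreal (f' x)) = density lborel (\<lambda>x. ennreal (- f' x))"
  proof (rule measure_eqI_generator_eq)
    let ?E = "range (\<lambda>(a, b). box a b::'a set)"
    show "Int_stable ?E" by (auto simp: Int_stable_def box_Int_box)
    show "?E \<subseteq> Pow UNIV" "sets (density lborel (\<lambda>x. ennreal (f' x))) = sigma_sets UNIV ?E"
      "sets (density lborel (\<lambda>x. ennreal (- f' x))) = sigma_sets UNIV ?E"
      by (simp_all add: borel_eq_box)
    let ?A = "\<lambda>n::nat. box (- (real n *\<^sub>R One)) (real n *\<^sub>R One) :: 'a set"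
    show "range ?A \<subseteq> ?E" "(\<Union>i. ?A i) = UNIV" unfolding UN_box_eq_UNIV by auto
    show "emeasure (density lborel (\<lambda>x. ennreal (f' x))) (?A i) \<noteq> \<infinity>" for i
    proof -
      have "(\<integral>\<^sup>+ x. ennreal (f' x) * indicator (?A i) x \<partial>lborel) \<le> (\<integral>\<^sup>+ x. ennreal (f' x) \<partial>lborel)"
        by (intro nn_integral_mono) (auto simp: indicator_def)
      moreover have "(\<integral>\<^sup>+ x. ennreal (f' x) \<partial>lborel) \<noteq> \<infinity>"
        using int by (auto simp: real_integrable_def)
      ultimately show ?thesis by (simp add: emeasure_density top_unique) (metis top_unique)
    qed
  qed (use box in auto)
  then have "AE x in lborel. ennreal (f' x) = ennreal (- f' x)"
    by (subst (asm) sigma_finite_measure.density_unique_iff[OF sigma_finite_lborel]) auto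
  moreover have "y = 0" if "ennreal y = ennreal (- y)" for y
    using that by (cases "0 \<le> y") (simp_all add: ennreal_neg ennreal_eq_0_iff)
  ultimately have "AE x in lborel. f' x = 0" by (auto elim!: eventually_mono)
  with eq have "AE x in lborel. f x = 0" by eventually_elim simp
  then show ?thesis by (rule AE_completion)
qed

text \<open>Products of one-dimensional cutoffs tend to the indicator of a box, so dominated convergence makes
the integral of \<open>f\<close> over every box vanish.\<close>

theorem fundamental_lemma:
  fixes f :: "'a::euclidean_space \<Rightarrow> real"
  assumes U: "open U" and f: "loc_integrable U f"
    and z: "\<And>\<eta>. smooth_bump U \<eta> \<Longrightarrow> (LINT x:U|lebesgue. \<eta> x * f x) = 0"
  shows "AE x in lebesgue. x \<in> U \<longrightarrow> f x = 0"
proof -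
  have box: "(LINT x:box a b|lebesgue. f x) = 0" if ab: "cbox a b \<subseteq> U" "box a b \<noteq> {}" for a b
  proof -
    have lt: "a \<bullet> i < b \<bullet> i" if "i \<in> Basis" for i using ab(2) that by (auto simp: box_ne_empty)
    define \<eta> where "\<eta> j x = (\<Prod>i\<in>Basis. cutoff j (a \<bullet> i) (b \<bullet> i) (x \<bullet> i))" for j and x :: 'a
    have ev: "\<forall>\<^sub>F j in sequentially. \<forall>i\<in>Basis. real j * (b \<bullet> i - a \<bullet> i) \<ge> 1"
      using lt by (intro eventually_ball_finite ballI eventually_real_mult_ge) auto
    then obtain N where N: "\<And>j i. j \<ge> N \<Longrightarrow> i \<in> Basis \<Longrightarrow> real j * (b \<bullet> i - a \<bullet> i) \<ge> 1"
      by (auto simp: eventually_sequentially)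
    have out: "\<eta> j x = 0" if "j \<ge> N" "x \<notin> box a b" for j x
    proof -
      obtain i where i: "i \<in> Basis" "x \<bullet> i \<le> a \<bullet> i \<or> b \<bullet> i \<le> x \<bullet> i"
        using \<open>x \<notin> box a b\<close> by (auto simp: box_def not_less)
      then show ?thesis
        using cutoff_outside[OF N[OF \<open>j \<ge> N\<close> i(1)] i(2)] by (auto simp: \<eta>_def)
    qed
    have test: "smooth_bump U (\<eta> j)" if "j \<ge> N" for j
    proof (rule smooth_bumpI)
      show "smooth_gen (\<eta> j)" unfolding \<eta>_def
        by (intro smooth_gen_prod smooth_gen_cutoff smooth_gen.inner)
      show "compact (cbox a b)" "cbox a b \<subseteq> U" using ab by auto
      show "\<eta> j x = 0" if "x \<notin> cbox a b" for x
        using out[OF \<open>j \<ge> N\<close>] that box_subset_cbox[of a b] by blast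
    qed
    have bnd: "\<bar>\<eta> j x\<bar> \<le> 1" for j x
      unfolding \<eta>_def abs_prod by (intro prod_le_1) (auto intro: cutoff_bound)
    have fi: "f absolutely_integrable_on cbox a b" using f ab by (auto simp: loc_integrable_def)
    then have fi': "integrable lebesgue (\<lambda>x. indicator (cbox a b) x *\<^sub>R f x)"
      by (simp add: set_integrable_def)
    have "(\<lambda>j. LINT x|lebesgue. \<eta> (j + N) x * (indicator (cbox a b) x *\<^sub>R f x)) \<longlonglongrightarrow>
        (LINT x|lebesgue. indicator (box a b) x *\<^sub>R (indicator (cbox a b) x *\<^sub>R f x))"
    proof (rule integral_dominated_convergence[where w="\<lambda>x. norm (indicator (cbox a b) x *\<^sub>R f x)"])
      have "continuous_on UNIV (\<eta> j)" for j
        unfolding \<eta>_def by (intro smooth_gen_continuous smooth_gen_prod smooth_gen_cutoff smooth_gen.inner)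
      then have "\<eta> j \<in> borel_measurable lebesgue" for j
        by (intro measurable_completion) (simp add: borel_measurable_continuous_onI)
      then show "(\<lambda>x. \<eta> (j + N) x * (indicator (cbox a b) x *\<^sub>R f x)) \<in> borel_measurable lebesgue" for j
        using fi' by (intro borel_measurable_times) auto
      show "(\<lambda>x. indicator (box a b) x *\<^sub>R (indicator (cbox a b) x *\<^sub>R f x)) \<in> borel_measurable lebesgue"
        by (intro borel_measurable_scaleR[OF borel_measurable_indicator borel_measurable_integrable[OF fi']])
          auto
      show "integrable lebesgue (\<lambda>x. norm (indicator (cbox a b) x *\<^sub>R f x))"
        using fi' by (rule integrable_norm)
      show "AE x in lebesgue. norm (\<eta> (j + N) x * (indicator (cbox a b) x *\<^sub>R f x))
          \<le> norm (indicator (cbox a b) x *\<^sub>R f x)" for j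
        using bnd[of "j + N"] by (intro AE_I2) (simp add: abs_mult mult_left_le_one_le)
      have "(\<lambda>j. \<eta> j x) \<longlonglongrightarrow> indicator (box a b) x" for x
      proof -
        have "(\<lambda>j. \<eta> j x) \<longlonglongrightarrow> (\<Prod>i\<in>Basis. indicator {a \<bullet> i<..<b \<bullet> i} (x \<bullet> i))"
          unfolding \<eta>_def by (intro tendsto_prod cutoff_tendsto lt)
        also have "(\<Prod>i\<in>Basis. indicator {a \<bullet> i<..<b \<bullet> i} (x \<bullet> i)) = (indicator (box a b) x :: real)"
          by (auto simp: box_def indicator_def of_bool_def prod_zero_iff)
        finally show ?thesis .
      qed
      then show "AE x in lebesgue. (\<lambda>j. \<eta> (j + N) x * (indicator (cbox a b) x *\<^sub>R f x)) \<longlonglongrightarrow>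
          indicator (box a b) x *\<^sub>R (indicator (cbox a b) x *\<^sub>R f x)"
        unfolding real_scaleR_def
        by (intro AE_I2 tendsto_mult tendsto_const LIMSEQ_ignore_initial_segment)
    qed
    moreover have "(LINT x|lebesgue. \<eta> (j + N) x * (indicator (cbox a b) x *\<^sub>R f x)) = 0" for j
    proof -
      have "(LINT x|lebesgue. \<eta> (j + N) x * (indicator (cbox a b) x *\<^sub>R f x)) =
          (LINT x:U|lebesgue. \<eta> (j + N) x * f x)"
        unfolding set_lebesgue_integral_def
        using out[of "j + N"] ab(1) box_subset_cbox[of a b]
        by (intro Bochner_Integration.integral_cong) (auto simp: indicator_def)
      then show ?thesis using z[OF test] by simp
    qed
    moreover have "(\<lambda>x. indicator (box a b) x *\<^sub>R (indicator (cbox a b) x *\<^sub>R f x)) =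
        (\<lambda>x. indicator (box a b) x *\<^sub>R f x)"
      using box_subset_cbox[of a b] by (auto simp: indicator_def fun_eq_iff)
    ultimately show ?thesis
      by (simp add: set_lebesgue_integral_def LIMSEQ_const_iff)
  qed
  have cb: "AE x in lebesgue. x \<in> cbox a b \<longrightarrow> f x = 0" if ab: "cbox a b \<subseteq> U" for a b
  proof -
    have "integrable lebesgue (\<lambda>x. indicator (cbox a b) x *\<^sub>R f x)"
      using f ab by (auto simp: loc_integrable_def set_integrable_def)
    then have "integrable lebesgue (\<lambda>x. indicator (box a b) x *\<^sub>R (indicator (cbox a b) x *\<^sub>R f x))"
      by (rule integrable_mult_indicator[rotated]) auto
    moreover have "(\<lambda>x. indicator (box a b) x *\<^sub>R (indicator (cbox a b) x *\<^sub>R f x)) =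
        (\<lambda>x. indicator (box a b) x *\<^sub>R f x)"
      using box_subset_cbox[of a b] by (auto simp: indicator_def fun_eq_iff)
    ultimately have int: "integrable lebesgue (\<lambda>x. indicator (box a b) x *\<^sub>R f x)" by simp
    have "AE x in lebesgue. indicator (box a b) x *\<^sub>R f x = 0"
    proof (rule AE_zero_if_integral_boxes_zero[OF int])
      fix c d :: 'a
      obtain a' b' where i: "box c d \<inter> box a b = box a' b'" using box_Int_box by blast
      have "(LINT x:box c d|lebesgue. indicator (box a b) x *\<^sub>R f x) = (LINT x:box a' b'|lebesgue. f x)"
        unfolding set_lebesgue_integral_def i[symmetric]
        by (intro Bochner_Integration.integral_cong) (auto simp: indicator_def)
      also have "\<dots> = 0"
      proof (cases "box a' b' = {}")
        case False
        have "box a' b' \<subseteq> box a b" using i by auto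
        then have "closure (box a' b') \<subseteq> cbox a b"
          using box_subset_cbox[of a b] by (intro closure_minimal closed_cbox) auto
        then have "cbox a' b' \<subseteq> cbox a b" using closure_box[OF False] by simp
        then show ?thesis using box[of a' b'] ab False by blast
      qed (simp add: set_lebesgue_integral_def)
      finally show "(LINT x:box c d|lebesgue. indicator (box a b) x *\<^sub>R f x) = 0" .
    qed
    moreover have "AE x in lebesgue. x \<notin> cbox a b - box a b"
      using negligible_frontier_interval[of a b] unfolding negligible_iff_null_sets by (rule AE_not_in)
    ultimately show ?thesis by eventually_elim (auto simp: indicator_def split: if_splits)
  qed
  obtain \<D> where D: "countable \<D>" "\<Union>\<D> = U" "\<And>X. X \<in> \<D> \<Longrightarrow> X \<subseteq> U \<and> (\<exists>a b. X = cbox a b)"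
    using open_countable_Union_open_cbox[OF U] by (metis Pow_iff subsetD)
  have "AE x in lebesgue. \<forall>X\<in>\<D>. x \<in> X \<longrightarrow> f x = 0"
  proof (subst AE_ball_countable[OF D(1)], rule ballI)
    fix X assume "X \<in> \<D>"
    then show "AE x in lebesgue. x \<in> X \<longrightarrow> f x = 0" using D(3)[of X] cb by blast
  qed
  then show ?thesis using D(2) by (auto elim!: eventually_mono)
qed

section \<open>Integration of radial functions\<close>

text \<open>The surface measure of the unit sphere: \<open>n\<close> times the volume of the unit ball.\<close>

definition sphere_area :: "'a::euclidean_space itself \<Rightarrow> real" where
  "sphere_area _ = real DIM('a) * measure lborel (ball (0::'a) 1)"

lemma sphere_area_pos: "sphere_area TYPE('a::euclidean_space) > 0"
  using content_ball_pos[of 1 "0::'a"] by (simp add: sphere_area_def)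

text \<open>Polar coordinates for radial functions: the volume of a ball of radius \<open>r\<close> is proportional to
\<open>r\<^sup>n\<close>, and this determines the distribution of the norm.\<close>

lemma distr_norm:
  "distr lborel borel (norm :: 'a::euclidean_space \<Rightarrow> real) =
   density lborel (\<lambda>t. ennreal (indicator {0<..} t * (sphere_area TYPE('a) * t ^ (DIM('a) - 1))))"
  (is "?M = ?N")
proof (rule measure_eqI_generator_eq)
  let ?E = "range (\<lambda>a::real. {..a})"
  show "Int_stable ?E" by (auto simp: Int_stable_def)
  show "?E \<subseteq> Pow UNIV" "sets ?M = sigma_sets UNIV ?E" "sets ?N = sigma_sets UNIV ?E"
    by (simp_all add: borel_eq_atMost)
  show "emeasure ?M X = emeasure ?N X" if "X \<in> ?E" for X
  proof -
    obtain r where X: "X = {..r}" using \<open>X \<in> ?E\<close> by auto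
    define c where "c = measure lborel (ball (0::'a) 1)"
    have M: "emeasure ?M X = emeasure lborel (cball (0::'a) r)"
      unfolding X by (subst emeasure_distr) (auto intro!: arg_cong[where f="emeasure lborel"])
    have N: "emeasure ?N X = (\<integral>\<^sup>+ t. ennreal (indicator {0<..} t * (sphere_area TYPE('a) * t ^ (DIM('a) - 1)))
        * indicator {..r} t \<partial>lborel)"
      unfolding X by (subst emeasure_density) auto
    show ?thesis
    proof (cases "r < 0")
      case True
      then have "emeasure ?N X = (\<integral>\<^sup>+ t. 0 \<partial>(lborel :: real measure))"
        unfolding N by (intro nn_integral_cong) (auto simp: indicator_def)
      then show ?thesis using M True by simp
    next
      case False
      then have r: "0 \<le> r" by simp
      have "emeasure ?N X = (\<integral>\<^sup>+ t. ennreal (sphere_area TYPE('a) * t ^ (DIM('a) - 1)) * indicator {0..r} t \<partial>lborel)"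
        unfolding N
      proof (rule nn_integral_cong_AE)
        have "AE t in lborel. t \<noteq> (0::real)" by (rule AE_lborel_singleton)
        then show "AE t in lborel. ennreal (indicator {0<..} t * (sphere_area TYPE('a) * t ^ (DIM('a) - 1)))
          * indicator {..r} t = ennreal (sphere_area TYPE('a) * t ^ (DIM('a) - 1)) * indicator {0..r} t"
          by eventually_elim (auto simp: indicator_def)
      qed
      also have "\<dots> = ennreal (c * r ^ DIM('a) - c * 0 ^ DIM('a))"
      proof (rule nn_integral_FTC_Icc[where F = "\<lambda>t. c * t ^ DIM('a)"])
        show "DERIV (\<lambda>t. c * t ^ DIM('a)) t :> sphere_area TYPE('a) * t ^ (DIM('a) - 1)" for t
          using DERIV_cmult[OF DERIV_pow, of c "DIM('a)" t UNIV]
          by (simp add: c_def sphere_area_def mult.commute mult.left_commute)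
        show "0 \<le> sphere_area TYPE('a) * t ^ (DIM('a) - 1)" if "t \<in> {0..r}" for t
          using that less_imp_le[OF sphere_area_pos[where 'a='a]]
          by (intro mult_nonneg_nonneg zero_le_power) auto
      qed (use r in auto)
      also have "\<dots> = ennreal (measure lborel (ball (0::'a) r))"
        using r by (subst content_ball_conv_unit_ball) (simp_all add: c_def mult.commute power_0_left)
      also have "\<dots> = emeasure lborel (cball (0::'a) r)"
        using emeasure_lborel_cball_finite[of "0::'a" r]
        by (subst content_cball_conv_ball[symmetric]) (simp add: emeasure_eq_ennreal_measure)
      finally show ?thesis using M by simp
    qed
  qed
  let ?A = "\<lambda>i::nat. {..real i}"
  show "range ?A \<subseteq> ?E" by auto
  show "(\<Union>i. ?A i) = UNIV" by (auto intro: real_arch_simple)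
  show "emeasure ?M (?A i) \<noteq> \<infinity>" for i
  proof -
    have "emeasure ?M (?A i) = emeasure lborel (cball (0::'a) (real i))"
      by (subst emeasure_distr) (auto intro!: arg_cong[where f="emeasure lborel"])
    then show ?thesis using emeasure_lborel_cball_finite[of "0::'a" "real i"] by simp
  qed
qed

lemma AE_norm:
  assumes "AE t in lebesgue. t > 0 \<longrightarrow> P t"
  shows "AE x in lebesgue. P (norm (x::'a::euclidean_space))"
proof -
  have "AE t in lborel. t > 0 \<longrightarrow> P t" using assms by (simp add: AE_completion_iff)
  then have "AE t in distr lborel borel (norm :: 'a \<Rightarrow> real). P t"
    unfolding distr_norm
    by (subst AE_density) (auto elim!: eventually_mono simp: indicator_def split: if_splits)
  from AE_distrD[OF _ this] have "AE x in lborel. P (norm (x::'a))" by simp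
  then show ?thesis by (rule AE_completion)
qed

text \<open>A Lebesgue measurable \<open>f\<close> may be composed with the norm because preimages of null sets under the
norm are null sets.\<close>

lemma borel_measurable_compose_norm:
  assumes "f \<in> borel_measurable (lebesgue :: real measure)"
  shows "(\<lambda>x::'a::euclidean_space. f (norm x) :: real) \<in> borel_measurable lebesgue"
proof -
  have "(norm :: 'a \<Rightarrow> real) \<in> lebesgue \<rightarrow>\<^sub>M completion lborel"
  proof (rule complete_measure.measurable_completion2[OF completion.complete_measure_axioms])
    show nm: "(norm :: 'a \<Rightarrow> real) \<in> lebesgue \<rightarrow>\<^sub>M lborel" by (intro measurable_completion) simp
    show "null_sets lborel \<subseteq> null_sets (distr lebesgue lborel (norm :: 'a \<Rightarrow> real))"
    proof
      fix N :: "real set" assume N: "N \<in> null_sets lborel"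
      then have "AE t in lborel. t \<notin> N" by (rule AE_not_in)
      then have "AE x in lebesgue. norm (x::'a) \<notin> N"
        by (intro AE_norm) (auto intro: AE_completion elim!: eventually_mono)
      moreover have [measurable]: "N \<in> sets lborel" using N by auto
      have "(norm :: 'a \<Rightarrow> real) -` N \<inter> space lebesgue \<in> sets lebesgue"
        using N by (intro measurable_sets[OF nm]) auto
      ultimately have "(norm :: 'a \<Rightarrow> real) -` N \<inter> space lebesgue \<in> null_sets lebesgue"
        by (subst AE_iff_null_sets) (auto elim!: eventually_mono)
      then show "N \<in> null_sets (distr lebesgue lborel (norm :: 'a \<Rightarrow> real))"
        using nm N by (subst null_sets_distr_iff) auto
    qed
  qed
  from measurable_compose[OF this assms] show ?thesis .
qed

lemma
  assumes f: "f \<in> borel_measurable (lebesgue :: real measure)"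
  shows integrable_norm_iff: "integrable lebesgue (\<lambda>x::'a::euclidean_space. f (norm x) :: real) \<longleftrightarrow>
      integrable lebesgue (\<lambda>t. indicator {0<..} t * (t ^ (DIM('a) - 1) * f t))" (is "?I \<longleftrightarrow> ?J")
    and integral_norm: "(LINT x|lebesgue. f (norm (x::'a))) =
      sphere_area TYPE('a) * (LINT t|lebesgue. indicator {0<..} t * (t ^ (DIM('a) - 1) * f t))"
proof -
  obtain f' where f'[measurable]: "f' \<in> borel_measurable lborel" and eq: "AE x in lborel. f x = f' x"
    using completion_ex_borel_measurable_real[of f lborel] f by auto
  then have [measurable]: "f' \<in> borel_measurable borel" by simp
  define k where "k = sphere_area TYPE('a)"
  have k: "k > 0" unfolding k_def by (rule sphere_area_pos)
  let ?w = "\<lambda>t. indicator {0<..} t * (k * t ^ (DIM('a) - 1)) :: real"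
  have w0: "?w t \<ge> 0" for t using k by (auto simp: indicator_def)
  let ?g = "\<lambda>t. indicator {0<..} t * (t ^ (DIM('a) - 1) * f t)"
  let ?g' = "\<lambda>t. indicator {0<..} t * (t ^ (DIM('a) - 1) * f' t)"
  have eqn: "AE x in lebesgue. f (norm (x::'a)) = f' (norm x)"
    using AE_completion[OF eq] by (intro AE_norm) (auto elim!: eventually_mono)
  have mn: "(\<lambda>x::'a. f (norm x)) \<in> borel_measurable lebesgue" by (rule borel_measurable_compose_norm[OF f])
  have mn': "(\<lambda>x::'a. f' (norm x)) \<in> borel_measurable lebesgue" by (intro measurable_completion) simp
  have mg': "?g' \<in> borel_measurable lebesgue" by (intro measurable_completion) simp
  have "(\<lambda>t. indicat_real {0<..} t * t ^ (DIM('a) - 1)) \<in> borel_measurable lebesgue"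
    by (intro measurable_completion) simp
  from borel_measurable_times[OF this f] have mg: "?g \<in> borel_measurable lebesgue"
    by (simp add: mult.assoc)
  have eqg: "AE t in lebesgue. ?g t = ?g' t" using AE_completion[OF eq] by (auto elim!: eventually_mono)
  have I: "integrable lebesgue (\<lambda>x::'a. f (norm x)) \<longleftrightarrow> integrable lborel (\<lambda>x::'a. f' (norm x))"
    using integrable_cong_AE[OF mn mn' eqn] by (simp add: integrable_completion)
  have "\<dots> \<longleftrightarrow> integrable (distr lborel borel (norm :: 'a \<Rightarrow> real)) f'"
    by (subst integrable_distr_eq) auto
  also have "\<dots> \<longleftrightarrow> integrable lborel (\<lambda>t. ?w t *\<^sub>R f' t)"
    unfolding distr_norm k_def[symmetric] using w0 by (subst integrable_density) auto
  also have "(\<lambda>t. ?w t *\<^sub>R f' t) = (\<lambda>t. k * ?g' t)" by (auto simp: fun_eq_iff)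
  also have "integrable lborel (\<lambda>t. k * ?g' t) \<longleftrightarrow> integrable lborel ?g'" using k by simp
  also have "\<dots> \<longleftrightarrow> integrable lebesgue ?g"
    using integrable_cong_AE[OF mg mg' eqg] integrable_completion[of ?g' lborel] by simp
  finally show "?I \<longleftrightarrow> ?J" using I by simp
  have "(LINT x|lebesgue. f (norm (x::'a))) = (LINT x|lebesgue. f' (norm (x::'a)))"
    by (rule integral_cong_AE[OF mn mn' eqn])
  also have "\<dots> = (LINT x|lborel. f' (norm (x::'a)))" by (rule integral_completion) simp
  also have "\<dots> = (LINT t|distr lborel borel (norm :: 'a \<Rightarrow> real). f' t)"
    by (subst integral_distr) auto
  also have "\<dots> = (LINT t|lborel. ?w t *\<^sub>R f' t)"
    unfolding distr_norm k_def[symmetric] using w0 by (subst integral_density) auto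
  also have "(\<lambda>t. ?w t *\<^sub>R f' t) = (\<lambda>t. k * ?g' t)" by (auto simp: fun_eq_iff)
  also have "(LINT t|lborel. k * ?g' t) = k * (LINT t|lborel. ?g' t)" by simp
  also have "(LINT t|lborel. ?g' t) = (LINT t|lebesgue. ?g' t)"
    by (rule integral_completion[symmetric]) simp
  also have "\<dots> = (LINT t|lebesgue. ?g t)" by (rule integral_cong_AE[OF mg mg' eqg, symmetric])
  finally show "(LINT x|lebesgue. f (norm (x::'a))) = sphere_area TYPE('a) * (LINT t|lebesgue. ?g t)"
    by (simp add: k_def)
qed

section \<open>Calculus of indefinite integrals\<close>

lemma absolutely_integrable_continuous_mult:
  fixes f g :: "real \<Rightarrow> real"
  assumes "continuous_on {a..b} g" "f absolutely_integrable_on {a..b}"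
  shows "(\<lambda>x. g x * f x) absolutely_integrable_on {a..b}"
proof (rule absolutely_integrable_bounded_measurable_product_real)
  show "g \<in> borel_measurable (lebesgue_on {a..b})"
    using assms(1) by (simp add: continuous_imp_measurable_on_sets_lebesgue)
  show "bounded (g ` {a..b})"
    using assms(1) by (intro compact_imp_bounded compact_continuous_image) auto
qed (use assms in auto)

text \<open>\<open>F\<close> is absolutely continuous on \<open>[a,b]\<close> and \<open>f\<close> is its derivative almost everywhere, expressed
through the indefinite integral, from which the product and chain rules below are proved.\<close>

definition ac_deriv :: "real \<Rightarrow> real \<Rightarrow> (real \<Rightarrow> real) \<Rightarrow> (real \<Rightarrow> real) \<Rightarrow> bool" where
  "ac_deriv a b F f \<longleftrightarrow> f absolutely_integrable_on {a..b} \<and>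
     (\<forall>x\<in>{a..b}. F x - F a = integral {a..x} f)"

lemma ac_deriv_abs_int: "ac_deriv a b F f \<Longrightarrow> f absolutely_integrable_on {a..b}"
  by (simp add: ac_deriv_def)

lemma abs_int_sub:
  fixes f :: "real \<Rightarrow> real"
  assumes "f absolutely_integrable_on {a..b}" "a \<le> x" "y \<le> b"
  shows "f absolutely_integrable_on {x..y}" "f integrable_on {x..y}"
    "(\<lambda>t. \<bar>f t\<bar>) integrable_on {x..y}"
proof -
  show *: "f absolutely_integrable_on {x..y}"
    by (rule absolutely_integrable_on_subinterval[OF assms(1)]) (use assms in auto)
  then show "f integrable_on {x..y}" "(\<lambda>t. \<bar>f t\<bar>) integrable_on {x..y}"
    by (auto simp: absolutely_integrable_on_def)
qed

lemma ac_deriv_diff: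
  assumes "ac_deriv a b F f" "a \<le> x" "x \<le> y" "y \<le> b"
  shows "F y - F x = integral {x..y} f"
proof -
  have "integral {a..x} f + integral {x..y} f = integral {a..y} f"
    using assms abs_int_sub(2)[OF ac_deriv_abs_int[OF assms(1)], of a y]
    by (intro Henstock_Kurzweil_Integration.integral_combine) auto
  moreover have "F x - F a = integral {a..x} f" "F y - F a = integral {a..y} f"
    using assms by (auto simp: ac_deriv_def)
  ultimately show ?thesis by linarith
qed

lemma ac_derivI:
  assumes "f absolutely_integrable_on {a..b}"
    and "\<And>x. a \<le> x \<Longrightarrow> x \<le> b \<Longrightarrow> F x - F a = integral {a..x} f"
  shows "ac_deriv a b F f"
  using assms by (simp add: ac_deriv_def)

lemma ac_deriv_continuous:
  assumes "ac_deriv a b F f"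
  shows "continuous_on {a..b} F"
proof -
  have "continuous_on {a..b} (\<lambda>x. F a + integral {a..x} f)"
    using abs_int_sub(2)[OF ac_deriv_abs_int[OF assms] order_refl order_refl]
    by (intro continuous_intros indefinite_integral_continuous_1)
  then show ?thesis
  proof (rule continuous_on_eq)
    show "F a + integral {a..x} f = F x" if "x \<in> {a..b}" for x
      using assms that unfolding ac_deriv_def by (metis add.commute diff_add_cancel)
  qed
qed

lemma ac_deriv_subinterval:
  assumes "ac_deriv a b F f" "a \<le> a'" "b' \<le> b"
  shows "ac_deriv a' b' F f"
proof (rule ac_derivI)
  show "f absolutely_integrable_on {a'..b'}"
    using abs_int_sub(1)[OF ac_deriv_abs_int[OF assms(1)]] assms by auto
qed (use ac_deriv_diff[OF assms(1)] assms in auto)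

lemma ac_deriv_cong:
  assumes "ac_deriv a b F f" "\<And>x. x \<in> {a..b} \<Longrightarrow> F x = G x" "AE x in lebesgue. x \<in> {a..b} \<longrightarrow> f x = g x"
  shows "ac_deriv a b G g"
proof -
  obtain N where N: "{x \<in> space lebesgue. \<not> (x \<in> {a..b} \<longrightarrow> f x = g x)} \<subseteq> N"
      "emeasure lebesgue N = 0" "N \<in> sets lebesgue"
    using AE_E[OF assms(3)] .
  then have neg: "negligible N" by (simp add: negligible_iff_emeasure0)
  have fg: "g x = f x" if "x \<in> {a..b} - N" for x using N(1) that by auto
  show ?thesis
  proof (rule ac_derivI)
    show "g absolutely_integrable_on {a..b}"
      by (rule absolutely_integrable_spike[OF ac_deriv_abs_int[OF assms(1)] neg fg])
    show "G x - G a = integral {a..x} g" if "a \<le> x" "x \<le> b" for x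
    proof -
      have "integral {a..x} g = integral {a..x} f"
        using fg that by (intro integral_spike[OF neg]) auto
      then show ?thesis
        using ac_deriv_diff[OF assms(1) order_refl that] assms(2)[of x] assms(2)[of a] that by simp
    qed
  qed
qed

lemma ac_deriv_C1:
  assumes "\<And>x. x \<in> {a..b} \<Longrightarrow> DERIV F x :> f x" "continuous_on {a..b} f"
  shows "ac_deriv a b F f"
proof (rule ac_derivI)
  show "f absolutely_integrable_on {a..b}" by (rule absolutely_integrable_continuous_real[OF assms(2)])
  show "F x - F a = integral {a..x} f" if "a \<le> x" "x \<le> b" for x
  proof -
    have "(f has_integral F x - F a) {a..x}"
    proof (rule fundamental_theorem_of_calculus[OF that(1)])
      fix y assume "y \<in> {a..x}"
      then show "(F has_vector_derivative f y) (at y within {a..x})"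
        using assms(1)[of y] that
        by (auto simp: has_real_derivative_iff_has_vector_derivative intro: has_vector_derivative_at_within)
    qed
    then show ?thesis by (simp add: integral_unique)
  qed
qed

lemma ac_deriv_add:
  assumes "ac_deriv a b F f" "ac_deriv a b G g"
  shows "ac_deriv a b (\<lambda>x. F x + G x) (\<lambda>x. f x + g x)"
proof (rule ac_derivI)
  show "(\<lambda>x. f x + g x) absolutely_integrable_on {a..b}"
    using assms by (intro set_integral_add) (auto simp: ac_deriv_def)
  show "F x + G x - (F a + G a) = integral {a..x} (\<lambda>x. f x + g x)" if "a \<le> x" "x \<le> b" for x
  proof -
    have "integral {a..x} (\<lambda>x. f x + g x) = integral {a..x} f + integral {a..x} g"
      using assms that
      by (intro Henstock_Kurzweil_Integration.integral_add abs_int_sub(2)[OF ac_deriv_abs_int]) auto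
    then show ?thesis
      using ac_deriv_diff[OF assms(1), of a x] ac_deriv_diff[OF assms(2), of a x] that by simp
  qed
qed

text \<open>On a partition with mesh less than \<open>d\<close>, the increments add up to at most \<open>e\<close> times the integral
of \<open>g\<close>, and \<open>e\<close> is arbitrary. The product and chain rules are verified in this way.\<close>

lemma constant_if_increments_small:
  fixes D g :: "real \<Rightarrow> real"
  assumes ab: "a \<le> b" and g: "g integrable_on {a..b}"
    and small: "\<And>e. e > 0 \<Longrightarrow> \<exists>d>0. \<forall>x y. a \<le> x \<and> x \<le> y \<and> y \<le> b \<and> y - x < d \<longrightarrow>
                  \<bar>D y - D x\<bar> \<le> e * integral {x..y} g"
  shows "D b = D a"
proof -
  have le: "\<bar>D b - D a\<bar> \<le> e * integral {a..b} g" if e: "e > 0" for e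
  proof -
    obtain d where d: "d > 0" "\<And>x y. a \<le> x \<Longrightarrow> x \<le> y \<Longrightarrow> y \<le> b \<Longrightarrow> y - x < d \<Longrightarrow>
                  \<bar>D y - D x\<bar> \<le> e * integral {x..y} g"
      using small[OF e] by blast
    obtain N where N: "(b - a) / d < real N" using reals_Archimedean2 by blast
    have N0: "0 < real N" using N ab d(1) by (meson divide_nonneg_pos diff_ge_0_iff_ge le_less_trans)
    \<comment> \<open>The equidistant partition into \<open>N\<close> intervals.\<close>
    define t where "t k = a + real k * ((b - a) / real N)" for k
    have w: "0 \<le> (b - a) / real N" "(b - a) / real N < d"
      using N N0 d(1) ab by (auto simp: field_simps)
    have "t (Suc k) - t k = (b - a) / real N" for k
      unfolding t_def of_nat_Suc by (simp only: distrib_right)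
    then have step: "t (Suc k) - t k < d" "t k \<le> t (Suc k)" for k
      using w by (metis, metis diff_ge_0_iff_ge)
    have t_ge: "a \<le> t k" for k using ab N0 by (simp add: t_def)
    have tN: "t N = b" using N0 by (simp add: t_def)
    have t_le: "t k \<le> b" if "k \<le> N" for k
    proof -
      have "real k * (b - a) \<le> real N * (b - a)" using that ab by (intro mult_right_mono) auto
      then show ?thesis using N0 by (simp add: t_def field_simps)
    qed
    have "\<bar>D (t k) - D a\<bar> \<le> e * integral {a..t k} g" if "k \<le> N" for k
      using that
    proof (induction k)
      case (Suc k)
      have eq: "integral {a..t k} g + integral {t k..t (Suc k)} g = integral {a..t (Suc k)} g"
        using step[of k] t_ge[of k] t_le[of "Suc k"] Suc.prems
        by (intro Henstock_Kurzweil_Integration.integral_combine integrable_on_subinterval[OF g]) auto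
      moreover have "\<bar>D (t (Suc k)) - D (t k)\<bar> \<le> e * integral {t k..t (Suc k)} g"
        using d(2)[of "t k" "t (Suc k)"] step[of k] t_ge[of k] t_le[of "Suc k"] Suc.prems by auto
      moreover have "\<bar>D (t k) - D a\<bar> \<le> e * integral {a..t k} g" using Suc by simp
      moreover have "e * integral {a..t (Suc k)} g = e * integral {a..t k} g + e * integral {t k..t (Suc k)} g"
        by (simp only: eq[symmetric] distrib_left)
      ultimately show ?case by linarith
    qed (simp add: t_def)
    from this[of N] show ?thesis using tN by simp
  qed
  have "\<bar>D b - D a\<bar> \<le> 0"
  proof (rule field_le_epsilon)
    fix e :: real assume e: "e > 0"
    have "\<bar>D b - D a\<bar> \<le> e / (\<bar>integral {a..b} g\<bar> + 1) * integral {a..b} g"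
      using e by (intro le) auto
    also have "\<dots> \<le> e"
    proof -
      have "e * integral {a..b} g \<le> e * (\<bar>integral {a..b} g\<bar> + 1)" using e by (intro mult_left_mono) auto
      then show ?thesis by (simp add: divide_le_eq)
    qed
    finally show "\<bar>D b - D a\<bar> \<le> 0 + e" by simp
  qed
  then show ?thesis by simp
qed

lemma ac_derivI_increments:
  assumes h: "h absolutely_integrable_on {a..b}" and g: "g absolutely_integrable_on {a..b}"
    and small: "\<And>e. e > 0 \<Longrightarrow> \<exists>d>0. \<forall>x y. a \<le> x \<and> x \<le> y \<and> y \<le> b \<and> y - x < d \<longrightarrow>
                  \<bar>H y - H x - integral {x..y} h\<bar> \<le> e * integral {x..y} g"
  shows "ac_deriv a b H h"
proof (rule ac_derivI[OF h])
  fix r assume r: "a \<le> r" "r \<le> b"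
  have "H r - integral {a..r} h = H a - integral {a..a} h"
  proof (rule constant_if_increments_small[OF r(1) abs_int_sub(2)[OF g order_refl r(2)]])
    fix e :: real assume "e > 0"
    then obtain d where d: "d > 0" "\<And>x y. a \<le> x \<Longrightarrow> x \<le> y \<Longrightarrow> y \<le> b \<Longrightarrow> y - x < d \<Longrightarrow>
                  \<bar>H y - H x - integral {x..y} h\<bar> \<le> e * integral {x..y} g"
      using small by meson
    have "\<bar>H y - integral {a..y} h - (H x - integral {a..x} h)\<bar> \<le> e * integral {x..y} g"
      if "a \<le> x" "x \<le> y" "y \<le> r" "y - x < d" for x y
    proof -
      have "integral {a..x} h + integral {x..y} h = integral {a..y} h"
        using that r by (intro Henstock_Kurzweil_Integration.integral_combine abs_int_sub(2)[OF h]) auto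
      then show ?thesis using d(2)[of x y] that r by (simp add: algebra_simps)
    qed
    then show "\<exists>d>0. \<forall>x y. a \<le> x \<and> x \<le> y \<and> y \<le> r \<and> y - x < d \<longrightarrow>
        \<bar>H y - integral {a..y} h - (H x - integral {a..x} h)\<bar> \<le> e * integral {x..y} g"
      using d(1) by blast
  qed
  then show "H r - H a = integral {a..r} h" by simp
qed

lemma uniform_oscillation:
  fixes G :: "real \<Rightarrow> real"
  assumes "continuous_on {a..b} G" "e > 0"
  shows "\<exists>d>0. \<forall>x y t s. a \<le> x \<and> y \<le> b \<and> y - x < d \<and> t \<in> {x..y} \<and> s \<in> {x..y} \<longrightarrow> \<bar>G t - G s\<bar> \<le> e"
proof -
  have "uniformly_continuous_on {a..b} G"
    by (rule compact_uniformly_continuous[OF assms(1)]) simp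
  then obtain d where "d > 0" "\<And>x x'. x \<in> {a..b} \<Longrightarrow> x' \<in> {a..b} \<Longrightarrow> dist x' x < d \<Longrightarrow> dist (G x') (G x) < e"
    using assms(2) unfolding uniformly_continuous_on_def by meson
  then show ?thesis
    by (intro exI[of _ d]) (auto simp: dist_real_def intro!: less_imp_le)
qed

text \<open>On a short interval \<open>[x,y]\<close> the increment \<open>F y G y - F x G x\<close> equals the integral of \<open>f G(y) + F(x) g\<close>,
and by uniform continuity it costs little to unfreeze \<open>G(y)\<close> and \<open>F(x)\<close>.\<close>

lemma ac_deriv_mult:
  assumes F: "ac_deriv a b F f" and G: "ac_deriv a b G g"
  shows "ac_deriv a b (\<lambda>x. F x * G x) (\<lambda>x. G x * f x + F x * g x)"
proof (rule ac_derivI_increments)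
  note fi = ac_deriv_abs_int[OF F] and gi = ac_deriv_abs_int[OF G]
  note cF = ac_deriv_continuous[OF F] and cG = ac_deriv_continuous[OF G]
  have Gf: "(\<lambda>x. G x * f x) absolutely_integrable_on {a..b}"
    and Fg: "(\<lambda>x. F x * g x) absolutely_integrable_on {a..b}"
    using absolutely_integrable_continuous_mult cF cG fi gi by auto
  show "(\<lambda>x. G x * f x + F x * g x) absolutely_integrable_on {a..b}"
    using Gf Fg by (rule set_integral_add)
  show "(\<lambda>x. \<bar>f x\<bar> + \<bar>g x\<bar>) absolutely_integrable_on {a..b}"
    using fi gi by (intro set_integral_add set_integrable_abs)
  fix e :: real assume e: "e > 0"
  obtain d1 where d1: "d1 > 0" "\<And>x y t s. a \<le> x \<Longrightarrow> y \<le> b \<Longrightarrow> y - x < d1 \<Longrightarrow> t \<in> {x..y} \<Longrightarrow> s \<in> {x..y} \<Longrightarrow>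
      \<bar>G t - G s\<bar> \<le> e" using uniform_oscillation[OF cG e] by meson
  obtain d2 where d2: "d2 > 0" "\<And>x y t s. a \<le> x \<Longrightarrow> y \<le> b \<Longrightarrow> y - x < d2 \<Longrightarrow> t \<in> {x..y} \<Longrightarrow> s \<in> {x..y} \<Longrightarrow>
      \<bar>F t - F s\<bar> \<le> e" using uniform_oscillation[OF cF e] by meson
  have "\<bar>F y * G y - F x * G x - integral {x..y} (\<lambda>x. G x * f x + F x * g x)\<bar>
      \<le> e * integral {x..y} (\<lambda>x. \<bar>f x\<bar> + \<bar>g x\<bar>)"
    if xy: "a \<le> x" "x \<le> y" "y \<le> b" "y - x < min d1 d2" for x y
  proof -
    note sub = abs_int_sub(2)[OF _ xy(1,3)] and asub = abs_int_sub(3)[OF _ xy(1,3)]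
    have "F y * G y - F x * G x = (F y - F x) * G y + F x * (G y - G x)" by (simp add: algebra_simps)
    also have "\<dots> = integral {x..y} f * G y + F x * integral {x..y} g"
      using ac_deriv_diff[OF F] ac_deriv_diff[OF G] xy by simp
    also have "\<dots> = integral {x..y} (\<lambda>t. f t * G y + F x * g t)"
      using sub[OF fi] sub[OF gi]
      by (subst Henstock_Kurzweil_Integration.integral_add) (auto intro: integrable_on_mult_left integrable_on_mult_right)
    finally have "F y * G y - F x * G x - integral {x..y} (\<lambda>x. G x * f x + F x * g x) =
        integral {x..y} (\<lambda>t. (f t * G y + F x * g t) - (G t * f t + F t * g t))"
      using sub[OF fi] sub[OF gi] sub[OF Gf] sub[OF Fg]
      by (subst Henstock_Kurzweil_Integration.integral_diff)
         (auto intro!: integrable_on_mult_left integrable_on_mult_right integrable_add)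
    moreover have "norm (integral {x..y} (\<lambda>t. (f t * G y + F x * g t) - (G t * f t + F t * g t)))
        \<le> integral {x..y} (\<lambda>t. e * (\<bar>f t\<bar> + \<bar>g t\<bar>))"
    proof (rule Henstock_Kurzweil_Integration.integral_norm_bound_integral)
      show "(\<lambda>t. (f t * G y + F x * g t) - (G t * f t + F t * g t)) integrable_on {x..y}"
        using sub[OF fi] sub[OF gi] sub[OF Gf] sub[OF Fg]
        by (intro integrable_diff integrable_add integrable_on_mult_left integrable_on_mult_right)
      show "(\<lambda>t. e * (\<bar>f t\<bar> + \<bar>g t\<bar>)) integrable_on {x..y}"
        using asub[OF fi] asub[OF gi] by (intro integrable_on_mult_right integrable_add)
      fix t assume t: "t \<in> {x..y}"
      have "\<bar>(G y - G t) * f t + (F x - F t) * g t\<bar> \<le> \<bar>G y - G t\<bar> * \<bar>f t\<bar> + \<bar>F x - F t\<bar> * \<bar>g t\<bar>"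
        by (metis abs_mult abs_triangle_ineq)
      also have "\<dots> \<le> e * \<bar>f t\<bar> + e * \<bar>g t\<bar>"
        using d1(2)[of x y y t] d2(2)[of x y x t] xy t by (intro add_mono mult_right_mono) auto
      finally show "norm ((f t * G y + F x * g t) - (G t * f t + F t * g t)) \<le> e * (\<bar>f t\<bar> + \<bar>g t\<bar>)"
        by (simp add: algebra_simps)
    qed
    ultimately show ?thesis by simp
  qed
  then show "\<exists>d>0. \<forall>x y. a \<le> x \<and> x \<le> y \<and> y \<le> b \<and> y - x < d \<longrightarrow>
      \<bar>F y * G y - F x * G x - integral {x..y} (\<lambda>x. G x * f x + F x * g x)\<bar>
      \<le> e * integral {x..y} (\<lambda>x. \<bar>f x\<bar> + \<bar>g x\<bar>)"
    using d1(1) d2(1) by (intro exI[of _ "min d1 d2"]) auto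
qed

text \<open>By the mean value theorem, and since the range of \<open>F\<close> on \<open>[x,y]\<close> contains the intermediate point, the
increment of \<open>H \<circ> F\<close> equals \<open>H'(F s)\<close> times the integral of \<open>f\<close> for some \<open>s\<close> in \<open>[x,y]\<close>; then \<open>s\<close> is
unfrozen as in the product rule.\<close>

lemma ac_deriv_chain:
  assumes F: "ac_deriv a b F f"
    and H: "\<And>t. t \<in> {a..b} \<Longrightarrow> DERIV H (F t) :> H' (F t)"
    and cH: "continuous_on {a..b} (\<lambda>t. H' (F t))"
  shows "ac_deriv a b (\<lambda>t. H (F t)) (\<lambda>t. H' (F t) * f t)"
proof (rule ac_derivI_increments)
  note fi = ac_deriv_abs_int[OF F]
  note cF = ac_deriv_continuous[OF F]
  show Hf: "(\<lambda>t. H' (F t) * f t) absolutely_integrable_on {a..b}"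
    using absolutely_integrable_continuous_mult cH fi by auto
  show "(\<lambda>t. \<bar>f t\<bar>) absolutely_integrable_on {a..b}" using fi by (rule set_integrable_abs)
  fix e :: real assume e: "e > 0"
  obtain d where d: "d > 0" "\<And>x y t s. a \<le> x \<Longrightarrow> y \<le> b \<Longrightarrow> y - x < d \<Longrightarrow> t \<in> {x..y} \<Longrightarrow> s \<in> {x..y} \<Longrightarrow>
      \<bar>H' (F t) - H' (F s)\<bar> \<le> e" using uniform_oscillation[OF cH e] by meson
  have "\<bar>H (F y) - H (F x) - integral {x..y} (\<lambda>t. H' (F t) * f t)\<bar> \<le> e * integral {x..y} (\<lambda>t. \<bar>f t\<bar>)"
    if xy: "a \<le> x" "x \<le> y" "y \<le> b" "y - x < d" for x y
  proof -
    note sub = abs_int_sub(2)[OF _ xy(1,3)] and asub = abs_int_sub(3)[OF _ xy(1,3)]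
    have cFs: "continuous_on {x..y} F" using cF xy by (auto intro: continuous_on_subset)
    have between: "\<exists>s\<in>{x..y}. F s = z" if "min (F x) (F y) \<le> z" "z \<le> max (F x) (F y)" for z
    proof (cases "F x \<le> F y")
      case True
      then show ?thesis using IVT'[of F x z y] cFs xy that by auto
    next
      case False
      then show ?thesis using IVT2'[of F y z x] cFs xy that by auto
    qed
    have "\<exists>s\<in>{x..y}. H (F y) - H (F x) = H' (F s) * (F y - F x)"
    proof (cases "F x = F y")
      case False
      define m M where "m = min (F x) (F y)" and "M = max (F x) (F y)"
      have "m < M" using False by (auto simp: m_def M_def)
      moreover have "DERIV H z :> H' z" if "m \<le> z" "z \<le> M" for z
        using between[of z] that H xy unfolding m_def M_def by force
      ultimately obtain z where z: "m < z" "z < M" "H M - H m = (M - m) * H' z"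
        using MVT2[of m M H H'] by blast
      obtain s where s: "s \<in> {x..y}" "F s = z" using between[of z] z by (auto simp: m_def M_def)
      have "H (F y) - H (F x) = H' z * (F y - F x)"
        using z(3) by (cases "F x \<le> F y") (auto simp: m_def M_def algebra_simps)
      then show ?thesis using s by blast
    qed (use xy in auto)
    then obtain s where s: "s \<in> {x..y}" "H (F y) - H (F x) = H' (F s) * (F y - F x)" by blast
    have "H (F y) - H (F x) = integral {x..y} (\<lambda>t. H' (F s) * f t)"
      using s ac_deriv_diff[OF F] xy by simp
    then have "H (F y) - H (F x) - integral {x..y} (\<lambda>t. H' (F t) * f t) =
        integral {x..y} (\<lambda>t. H' (F s) * f t - H' (F t) * f t)"
      using sub[OF fi] sub[OF Hf]
      by (subst Henstock_Kurzweil_Integration.integral_diff) (auto intro!: integrable_on_mult_right)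
    moreover have "norm (integral {x..y} (\<lambda>t. H' (F s) * f t - H' (F t) * f t))
        \<le> integral {x..y} (\<lambda>t. e * \<bar>f t\<bar>)"
    proof (rule Henstock_Kurzweil_Integration.integral_norm_bound_integral)
      show "(\<lambda>t. H' (F s) * f t - H' (F t) * f t) integrable_on {x..y}"
        using sub[OF fi] sub[OF Hf] by (intro integrable_diff integrable_on_mult_right)
      show "(\<lambda>t. e * \<bar>f t\<bar>) integrable_on {x..y}"
        using asub[OF fi] by (intro integrable_on_mult_right)
      fix t assume t: "t \<in> {x..y}"
      have "\<bar>H' (F s) - H' (F t)\<bar> * \<bar>f t\<bar> \<le> e * \<bar>f t\<bar>"
        using d(2)[of x y s t] xy t s by (intro mult_right_mono) auto
      then show "norm (H' (F s) * f t - H' (F t) * f t) \<le> e * \<bar>f t\<bar>"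
        by (simp add: abs_mult left_diff_distrib flip: abs_mult)
    qed
    ultimately show ?thesis by simp
  qed
  then show "\<exists>d>0. \<forall>x y. a \<le> x \<and> x \<le> y \<and> y \<le> b \<and> y - x < d \<longrightarrow>
      \<bar>H (F y) - H (F x) - integral {x..y} (\<lambda>t. H' (F t) * f t)\<bar> \<le> e * integral {x..y} (\<lambda>t. \<bar>f t\<bar>)"
    using d(1) by blast
qed

section \<open>Weak derivatives on an interval\<close>

lemma smooth_bump_real_support:
  assumes "smooth_bump {\<alpha><..<\<beta>::real} X" "\<alpha> < \<beta>"
  obtains \<alpha>' \<beta>' where "\<alpha> < \<alpha>'" "\<alpha>' \<le> \<beta>'" "\<beta>' < \<beta>" "\<And>x. x \<notin> {\<alpha>'..\<beta>'} \<Longrightarrow> X x = 0"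
proof -
  obtain K where K: "compact K" "K \<subseteq> {\<alpha><..<\<beta>}" "\<And>x. x \<notin> K \<Longrightarrow> X x = 0"
    using assms(1) by (auto simp: smooth_bump_def)
  \<comment> \<open>The midpoint makes the compact set nonempty.\<close>
  define L where "L = insert ((\<alpha> + \<beta>) / 2) K"
  have L: "compact L" "L \<noteq> {}" "L \<subseteq> {\<alpha><..<\<beta>}" using K assms(2) by (auto simp: L_def)
  obtain m where m: "m \<in> L" "\<And>x. x \<in> L \<Longrightarrow> m \<le> x" using compact_attains_inf[OF L(1,2)] by blast
  obtain M where M: "M \<in> L" "\<And>x. x \<in> L \<Longrightarrow> x \<le> M" using compact_attains_sup[OF L(1,2)] by blast
  show ?thesis
  proof (rule that[of m M])
    show "\<alpha> < m" "M < \<beta>" using m(1) M(1) L(3) by auto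
    show "m \<le> M" using m M by auto
    show "X x = 0" if "x \<notin> {m..M}" for x
      using that m(2)[of x] M(2)[of x] K(3)[of x] by (auto simp: L_def)
  qed
qed

text \<open>Beyond the support of \<open>X\<close> an antiderivative is constant, on the left \<open>0\<close> by normalization and on the right
the mean of \<open>X\<close>.\<close>

lemma zero_mean_antiderivative:
  assumes X: "smooth_bump {\<alpha><..<\<beta>::real} X" and ab: "\<alpha> < \<beta>" and mean: "integral {\<alpha>..\<beta>} X = 0"
  obtains \<xi> where "smooth_bump {\<alpha><..<\<beta>} \<xi>" "\<And>x. DERIV \<xi> x :> X x"
proof -
  obtain \<alpha>' \<beta>' where s: "\<alpha> < \<alpha>'" "\<alpha>' \<le> \<beta>'" "\<beta>' < \<beta>" "\<And>x. x \<notin> {\<alpha>'..\<beta>'} \<Longrightarrow> X x = 0"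
    using smooth_bump_real_support[OF X ab] by blast
  have sm: "smooth_gen X" using X by (simp add: smooth_bump_def)
  obtain F where F: "\<And>x. DERIV F x :> X x"
    using continuous_antiderivative[OF smooth_gen_continuous[OF sm]] by blast
  define \<xi> where "\<xi> x = F x - F \<alpha>" for x
  have d: "DERIV \<xi> x :> X x" for x unfolding \<xi>_def using F[of x] by (auto intro!: derivative_eq_intros)
  have ac: "ac_deriv a b \<xi> X" for a b
    using d smooth_gen_continuous[OF sm] by (intro ac_deriv_C1) auto
  have const: "\<xi> y = \<xi> x" if "x \<le> y" "\<And>t. x < t \<Longrightarrow> t < y \<Longrightarrow> X t = 0" for x y
  proof -
    have "\<xi> y - \<xi> x = integral {x<..<y} X"
      using ac_deriv_diff[OF ac[of x y], of x y] that(1) by (simp add: integral_open_interval_real)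
    also have "\<dots> = integral {x<..<y} (\<lambda>_. 0)"
      by (rule Henstock_Kurzweil_Integration.integral_cong) (use that in auto)
    finally show ?thesis by simp
  qed
  have at\<alpha>: "\<xi> \<alpha> = 0" by (simp add: \<xi>_def)
  have at\<beta>: "\<xi> \<beta> = 0" using ac_deriv_diff[OF ac[of \<alpha> \<beta>], of \<alpha> \<beta>] mean ab at\<alpha> by simp
  have "\<xi> x = 0" if x: "x \<notin> {\<alpha>'..\<beta>'}" for x
  proof (cases "x < \<alpha>'")
    case True
    then have "\<xi> x = \<xi> \<alpha>"
      using const[of x \<alpha>] const[of \<alpha> x] s by (cases "x \<le> \<alpha>") auto
    then show ?thesis using at\<alpha> by simp
  next
    case False
    then have "\<xi> x = \<xi> \<beta>"
      using const[of x \<beta>] const[of \<beta> x] s x by (cases "x \<le> \<beta>") auto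
    then show ?thesis using at\<beta> by simp
  qed
  then have "smooth_bump {\<alpha><..<\<beta>} \<xi>"
    using s by (intro smooth_bumpI[of \<xi> "{\<alpha>'..\<beta>'}"] smooth_gen_antiderivative[OF sm d]) auto
  then show ?thesis using d that by blast
qed

lemma abs_int_imp_loc_integrable:
  assumes "f absolutely_integrable_on U" shows "loc_integrable U f"
  unfolding loc_integrable_def
proof (intro allI impI, elim conjE)
  fix K assume "compact K" "K \<subseteq> U"
  then show "f absolutely_integrable_on K"
    by (intro set_integrable_subset[OF assms]) (auto intro: lmeasurable_compact fmeasurableD)
qed

lemma LINT_Ioo:
  fixes g :: "real \<Rightarrow> real"
  assumes "g absolutely_integrable_on {\<alpha>..\<beta>}"
  shows "(LINT x:{\<alpha><..<\<beta>}|lebesgue. g x) = integral {\<alpha>..\<beta>} g"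
  using assms set_lebesgue_integral_eq_integral(2)[of "{\<alpha><..<\<beta>}" g]
  by (simp add: absolutely_integrable_on_Icc_iff_Ioo integral_open_interval_real)

lemma smooth_bump_grad_real:
  assumes "smooth_bump U (\<xi> :: real \<Rightarrow> real)" "\<And>x. DERIV \<xi> x :> X x"
  shows "grad \<xi> x = X x"
  using assms by (intro grad_eqI) auto

text \<open>The lemma of du Bois-Reymond: every bump \<open>X\<close> becomes a derivative of a bump after subtraction of a
multiple of one fixed bump \<open>\<rho>\<close>, so \<open>k\<close> minus its \<open>\<rho>\<close>-average is orthogonal to all bumps.\<close>

lemma weak_derivative_zero_imp_constant:
  fixes k :: "real \<Rightarrow> real"
  assumes ab: "\<alpha> < \<beta>" and k: "k absolutely_integrable_on {\<alpha>..\<beta>}"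
    and z: "\<And>\<xi> X. smooth_bump {\<alpha><..<\<beta>} \<xi> \<Longrightarrow> (\<And>x. DERIV \<xi> x :> X x) \<Longrightarrow> continuous_on UNIV X \<Longrightarrow>
              integral {\<alpha>..\<beta>} (\<lambda>x. X x * k x) = 0"
  shows "\<exists>c. AE x in lebesgue. x \<in> {\<alpha><..<\<beta>} \<longrightarrow> k x = c"
proof -
  obtain \<alpha>0 \<beta>0 where ab0: "\<alpha> < \<alpha>0" "\<alpha>0 < \<beta>0" "\<beta>0 < \<beta>"
    by (meson ab dense)
  obtain j where j: "real j * (\<beta>0 - \<alpha>0) \<ge> 2"
    using eventually_real_mult_ge[of "(\<beta>0 - \<alpha>0) / 2"] ab0
    by (auto simp: eventually_sequentially field_simps)
  define \<rho> where "\<rho> = cutoff j \<alpha>0 \<beta>0"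
  have \<rho>: "smooth_bump {\<alpha><..<\<beta>} \<rho>"
  proof (rule smooth_bumpI[of _ "{\<alpha>0..\<beta>0}"])
    show "smooth_gen \<rho>" unfolding \<rho>_def using smooth_gen_cutoff[OF smooth_gen_id] .
    show "\<rho> x = 0" if "x \<notin> {\<alpha>0..\<beta>0}" for x
      unfolding \<rho>_def using j that by (intro cutoff_outside) auto
  qed (use ab0 in auto)
  have c\<rho>: "continuous_on S \<rho>" for S unfolding \<rho>_def by (rule continuous_cutoff)
  define m where "m = integral {\<alpha>..\<beta>} \<rho>"
  have m: "m \<noteq> 0"
  proof
    have jp: "real j > 0" using j ab0 by (cases "j = 0") auto
    have nn: "\<rho> x \<ge> 0" for x
    proof -
      have "real j * (x - \<beta>0) + 1 \<le> real j * (x - \<alpha>0)" using j by (simp add: algebra_simps)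
      then show ?thesis unfolding \<rho>_def cutoff_def using smooth_step_mono by simp
    qed
    assume "m = 0"
    then have "\<forall>x\<in>{\<alpha>..\<beta>}. \<rho> x = 0"
      unfolding m_def using c\<rho> nn ab by (subst (asm) integral_eq_0_iff) auto
    moreover have "\<alpha>0 + 1 / real j \<in> {\<alpha>..\<beta>}"
    proof -
      have "1 / real j \<le> \<beta>0 - \<alpha>0" using j jp by (simp add: field_simps)
      moreover have "0 \<le> 1 / real j" using jp by simp
      ultimately show ?thesis using ab0 by (simp only: atLeastAtMost_iff) linarith
    qed
    ultimately have "\<rho> (\<alpha>0 + 1 / real j) = 0" by blast
    moreover have "\<rho> (\<alpha>0 + 1 / real j) = 1"
    proof -
      have "real j * (\<alpha>0 + 1 / real j - \<beta>0) + 1 \<le> 0" using j jp by (simp add: algebra_simps)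
      moreover have "real j * (\<alpha>0 + 1 / real j - \<alpha>0) = 1" using jp by simp
      ultimately show ?thesis unfolding \<rho>_def cutoff_def by (simp add: smooth_step_right smooth_step_left)
    qed
    ultimately show False by simp
  qed
  define c where "c = integral {\<alpha>..\<beta>} (\<lambda>x. \<rho> x * k x) / m"
  have "AE x in lebesgue. x \<in> {\<alpha><..<\<beta>} \<longrightarrow> k x - c = 0"
  proof (rule fundamental_lemma)
    have kc: "(\<lambda>x. k x - c) absolutely_integrable_on {\<alpha>..\<beta>}"
      using k by (intro set_integral_diff) (auto intro: absolutely_integrable_on_const)
    then show "loc_integrable {\<alpha><..<\<beta>} (\<lambda>x. k x - c)"
      by (intro abs_int_imp_loc_integrable) (simp flip: absolutely_integrable_on_Icc_iff_Ioo)
    fix X assume X: "smooth_bump {\<alpha><..<\<beta>} X"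
    have cX: "continuous_on S X" for S using X smooth_gen_continuous by (auto simp: smooth_bump_def)
    note iX = integrable_continuous_real[OF cX] and i\<rho> = integrable_continuous_real[OF c\<rho>]
    define M where "M = integral {\<alpha>..\<beta>} X"
    \<comment> \<open>\<open>Y\<close> has mean \<open>0\<close>.\<close>
    define Y where "Y x = X x - (M / m) * \<rho> x" for x
    have "smooth_bump {\<alpha><..<\<beta>} Y"
    proof -
      obtain K1 K2 where K: "compact K1" "K1 \<subseteq> {\<alpha><..<\<beta>}" "\<And>x. x \<notin> K1 \<Longrightarrow> X x = 0"
        "compact K2" "K2 \<subseteq> {\<alpha><..<\<beta>}" "\<And>x. x \<notin> K2 \<Longrightarrow> \<rho> x = 0"
        using X \<rho> by (auto simp: smooth_bump_def)
      show ?thesis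
      proof (rule smooth_bumpI[of _ "K1 \<union> K2"])
        show "smooth_gen Y" unfolding Y_def using X \<rho>
          by (intro smooth_gen_diff smooth_gen_cmult) (auto simp: smooth_bump_def)
      qed (use K in \<open>auto simp: Y_def\<close>)
    qed
    moreover have "integral {\<alpha>..\<beta>} Y = 0"
    proof -
      have "integral {\<alpha>..\<beta>} Y = integral {\<alpha>..\<beta>} X - integral {\<alpha>..\<beta>} (\<lambda>x. (M / m) * \<rho> x)"
        unfolding Y_def
        by (rule Henstock_Kurzweil_Integration.integral_diff[OF iX integrable_on_mult_right[OF i\<rho>]])
      also have "\<dots> = M - (M / m) * m" by (simp only: integral_mult_right M_def m_def)
      finally have "integral {\<alpha>..\<beta>} Y = M - (M / m) * m" .
      then show ?thesis using m by simp
    qed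
    ultimately obtain \<xi> where \<xi>: "smooth_bump {\<alpha><..<\<beta>} \<xi>" "\<And>x. DERIV \<xi> x :> Y x"
      using zero_mean_antiderivative[OF _ ab] by blast
    have Xk: "(\<lambda>x. X x * k x) absolutely_integrable_on {\<alpha>..\<beta>}"
      and \<rho>k: "(\<lambda>x. \<rho> x * k x) absolutely_integrable_on {\<alpha>..\<beta>}"
      using absolutely_integrable_continuous_mult k cX c\<rho> by auto
    have cY: "continuous_on UNIV Y" unfolding Y_def by (intro continuous_intros cX c\<rho>)
    have "0 = integral {\<alpha>..\<beta>} (\<lambda>x. Y x * k x)"
      using z[OF \<xi> cY] by simp
    also have "(\<lambda>x. Y x * k x) = (\<lambda>x. X x * k x - (M / m) * (\<rho> x * k x))"
      by (auto simp: Y_def algebra_simps)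
    also have "integral {\<alpha>..\<beta>} \<dots> = integral {\<alpha>..\<beta>} (\<lambda>x. X x * k x) - (M / m) * integral {\<alpha>..\<beta>} (\<lambda>x. \<rho> x * k x)"
      using Henstock_Kurzweil_Integration.integral_diff[OF set_lebesgue_integral_eq_integral(1)[OF Xk]
          integrable_on_mult_right[OF set_lebesgue_integral_eq_integral(1)[OF \<rho>k], of "M / m"]]
      by (simp only: integral_mult_right)
    finally have eq: "integral {\<alpha>..\<beta>} (\<lambda>x. X x * k x) = c * M" by (simp add: c_def)
    have "(LINT x:{\<alpha><..<\<beta>}|lebesgue. X x * (k x - c)) = integral {\<alpha>..\<beta>} (\<lambda>x. X x * (k x - c))"
      using absolutely_integrable_continuous_mult[OF cX kc] by (rule LINT_Ioo)
    also have "\<dots> = integral {\<alpha>..\<beta>} (\<lambda>x. X x * k x - c * X x)" by (simp add: algebra_simps)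
    also have "\<dots> = integral {\<alpha>..\<beta>} (\<lambda>x. X x * k x) - c * M"
      using Henstock_Kurzweil_Integration.integral_diff[OF set_lebesgue_integral_eq_integral(1)[OF Xk]
          integrable_on_mult_right[OF iX, of c]]
      by (simp only: integral_mult_right M_def)
    finally show "(LINT x:{\<alpha><..<\<beta>}|lebesgue. X x * (k x - c)) = 0" using eq by simp
  qed simp
  then show ?thesis by (intro exI[of _ c]) simp
qed

text \<open>The indefinite integral of \<open>f'\<close> has the same weak derivative as \<open>f\<close>, by the product rule.\<close>

lemma weak_partial_imp_ac_deriv:
  fixes f f' :: "real \<Rightarrow> real"
  assumes ab: "\<alpha> < \<beta>" and w: "weak_partial {\<alpha><..<\<beta>} 1 f f'"
    and f: "f absolutely_integrable_on {\<alpha>..\<beta>}" and f': "f' absolutely_integrable_on {\<alpha>..\<beta>}"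
  obtains F where "ac_deriv \<alpha> \<beta> F f'" "AE x in lebesgue. x \<in> {\<alpha><..<\<beta>} \<longrightarrow> f x = F x"
proof -
  define F0 where "F0 x = integral {\<alpha>..x} f'" for x
  have ac: "ac_deriv \<alpha> \<beta> F0 f'" using f' by (intro ac_derivI) (auto simp: F0_def)
  note cF = ac_deriv_continuous[OF ac]
  have F0i: "F0 absolutely_integrable_on {\<alpha>..\<beta>}" by (rule absolutely_integrable_continuous_real[OF cF])
  have "\<exists>c. AE x in lebesgue. x \<in> {\<alpha><..<\<beta>} \<longrightarrow> f x - F0 x = c"
  proof (rule weak_derivative_zero_imp_constant[OF ab])
    show "(\<lambda>x. f x - F0 x) absolutely_integrable_on {\<alpha>..\<beta>}" by (rule set_integral_diff[OF f F0i])
    fix \<xi> X assume \<xi>: "smooth_bump {\<alpha><..<\<beta>} \<xi>" and d: "\<And>x. DERIV \<xi> x :> X x" and cX: "continuous_on UNIV (X :: real \<Rightarrow> real)"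
    have cX': "continuous_on S X" for S using cX by (rule continuous_on_subset) auto
    have c\<xi>: "continuous_on S \<xi>" for S using \<xi> smooth_gen_continuous by (auto simp: smooth_bump_def)
    have Xf: "(\<lambda>x. X x * f x) absolutely_integrable_on {\<alpha>..\<beta>}"
      and \<xi>f': "(\<lambda>x. \<xi> x * f' x) absolutely_integrable_on {\<alpha>..\<beta>}"
      and XF: "(\<lambda>x. X x * F0 x) absolutely_integrable_on {\<alpha>..\<beta>}"
      using absolutely_integrable_continuous_mult cX' c\<xi> f f' F0i by auto
    have "test_function {\<alpha><..<\<beta>} \<xi>" by (rule smooth_bump_test_function[OF \<xi>])
    then have "(LINT x:{\<alpha><..<\<beta>}|lebesgue. (grad \<xi> x \<bullet> 1) *\<^sub>R f x) = - (LINT x:{\<alpha><..<\<beta>}|lebesgue. \<xi> x *\<^sub>R f' x)"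
      using w by (auto simp: weak_partial_def)
    then have 1: "integral {\<alpha>..\<beta>} (\<lambda>x. X x * f x) = - integral {\<alpha>..\<beta>} (\<lambda>x. \<xi> x * f' x)"
      using smooth_bump_grad_real[OF \<xi> d] LINT_Ioo[OF Xf] LINT_Ioo[OF \<xi>f'] by simp
    have "ac_deriv \<alpha> \<beta> \<xi> X" using d cX' by (intro ac_deriv_C1) auto
    from ac_deriv_mult[OF ac this]
    have "F0 \<beta> * \<xi> \<beta> - F0 \<alpha> * \<xi> \<alpha> = integral {\<alpha>..\<beta>} (\<lambda>x. \<xi> x * f' x + F0 x * X x)"
      using ab by (intro ac_deriv_diff) auto
    moreover have "\<xi> \<alpha> = 0" "\<xi> \<beta> = 0"
      using smooth_bump_real_support[OF \<xi> ab] by (metis atLeastAtMost_iff not_le)+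
    ultimately have "0 = integral {\<alpha>..\<beta>} (\<lambda>x. \<xi> x * f' x + X x * F0 x)" by (simp add: mult.commute)
    also have "\<dots> = integral {\<alpha>..\<beta>} (\<lambda>x. \<xi> x * f' x) + integral {\<alpha>..\<beta>} (\<lambda>x. X x * F0 x)"
      using \<xi>f' XF by (intro Henstock_Kurzweil_Integration.integral_add) (auto simp: absolutely_integrable_on_def)
    finally have 2: "integral {\<alpha>..\<beta>} (\<lambda>x. \<xi> x * f' x) = - integral {\<alpha>..\<beta>} (\<lambda>x. X x * F0 x)" by simp
    have "integral {\<alpha>..\<beta>} (\<lambda>x. X x * (f x - F0 x)) = integral {\<alpha>..\<beta>} (\<lambda>x. X x * f x) - integral {\<alpha>..\<beta>} (\<lambda>x. X x * F0 x)"
      unfolding right_diff_distrib using Xf XF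
      by (intro Henstock_Kurzweil_Integration.integral_diff) (auto simp: absolutely_integrable_on_def)
    then show "integral {\<alpha>..\<beta>} (\<lambda>x. X x * (f x - F0 x)) = 0" using 1 2 by simp
  qed
  then obtain c where c: "AE x in lebesgue. x \<in> {\<alpha><..<\<beta>} \<longrightarrow> f x - F0 x = c" by blast
  show ?thesis
  proof (rule that[of "\<lambda>x. F0 x + c"])
    show "ac_deriv \<alpha> \<beta> (\<lambda>x. F0 x + c) f'" using ac by (simp add: ac_deriv_def)
    show "AE x in lebesgue. x \<in> {\<alpha><..<\<beta>} \<longrightarrow> f x = F0 x + c" using c by eventually_elim auto
  qed
qed

section \<open>Nonlinear superposition and radial profiles\<close>

text \<open>Round \<open>y\<close> and \<open>z\<close> down to multiples of \<open>2\<^sup>-\<^sup>k\<close>: then only countably many sections of \<open>h\<close> are involved, and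
continuity in the last two arguments allows to pass to the limit.\<close>

lemma caratheodory_compose:
  assumes h: "caratheodory R h"
    and y: "y \<in> borel_measurable (lebesgue_on {0<..<R})" and z: "z \<in> borel_measurable (lebesgue_on {0<..<R})"
  shows "(\<lambda>\<tau>. h \<tau> (y \<tau>) (z \<tau>)) \<in> borel_measurable (lebesgue_on {0<..<R})"
proof -
  define M where "M = lebesgue_on {0<..<R}"
  define d where "d k x = real_of_int \<lfloor>2 ^ k * x\<rfloor> / 2 ^ k" for k and x :: real
  have d_lim: "(\<lambda>k. d k x) \<longlonglongrightarrow> x" for x
  proof (rule real_tendsto_sandwich)
    have "x - (1 / 2) ^ k \<le> d k x \<and> d k x \<le> x" for k
    proof -
      have "(2 ^ k * x - 1) / 2 ^ k \<le> d k x"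
        unfolding d_def by (rule divide_right_mono) (linarith, simp)
      moreover have "d k x \<le> 2 ^ k * x / 2 ^ k"
        unfolding d_def by (rule divide_right_mono) (linarith, simp)
      ultimately show ?thesis by (simp add: diff_divide_distrib power_one_over)
    qed
    then show "\<forall>\<^sub>F k in sequentially. x - (1 / 2) ^ k \<le> d k x" "\<forall>\<^sub>F k in sequentially. d k x \<le> x" by auto
    show "(\<lambda>k. x - (1 / 2) ^ k) \<longlonglongrightarrow> x"
      using tendsto_diff[OF tendsto_const[of x] LIMSEQ_power_zero[of "1 / 2 :: real"]] by simp
  qed simp
  have meas: "(\<lambda>\<tau>. h \<tau> (d k (y \<tau>)) (d k (z \<tau>))) \<in> borel_measurable M" for k
  proof -
    have "(\<lambda>\<tau>. h \<tau> (real_of_int (fst i) / 2 ^ k) (real_of_int (snd i) / 2 ^ k)) \<in> borel_measurable M"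
      for i :: "int \<times> int"
      using h unfolding caratheodory_def M_def by blast
    moreover have "(\<lambda>\<tau>. (\<lfloor>2 ^ k * y \<tau>\<rfloor>, \<lfloor>2 ^ k * z \<tau>\<rfloor>)) \<in> M \<rightarrow>\<^sub>M count_space UNIV"
    proof -
      have "(\<lambda>\<tau>. \<lfloor>2 ^ k * y \<tau>\<rfloor>) \<in> M \<rightarrow>\<^sub>M count_space UNIV" "(\<lambda>\<tau>. \<lfloor>2 ^ k * z \<tau>\<rfloor>) \<in> M \<rightarrow>\<^sub>M count_space UNIV"
        using y z unfolding M_def by measurable
      then have "(\<lambda>\<tau>. (\<lfloor>2 ^ k * y \<tau>\<rfloor>, \<lfloor>2 ^ k * z \<tau>\<rfloor>)) \<in> M \<rightarrow>\<^sub>M count_space UNIV \<Otimes>\<^sub>M count_space UNIV"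
        by (rule measurable_Pair)
      also have "count_space UNIV \<Otimes>\<^sub>M count_space UNIV = (count_space UNIV :: (int \<times> int) measure)"
        by (subst pair_measure_countable) auto
      finally show ?thesis .
    qed
    ultimately have "(\<lambda>\<tau>. (\<lambda>i \<tau>. h \<tau> (real_of_int (fst i) / 2 ^ k) (real_of_int (snd i) / 2 ^ k))
        (\<lfloor>2 ^ k * y \<tau>\<rfloor>, \<lfloor>2 ^ k * z \<tau>\<rfloor>) \<tau>) \<in> borel_measurable M"
      by (rule measurable_compose_countable)
    then show ?thesis by (simp add: d_def)
  qed
  obtain N where N: "{\<tau> \<in> space lebesgue. \<not> (\<tau> \<in> {0<..<R} \<longrightarrow> continuous_on UNIV (\<lambda>(y, z). h \<tau> y z))} \<subseteq> N"
      "emeasure lebesgue N = 0" "N \<in> sets lebesgue"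
    using AE_E h unfolding caratheodory_def by blast
  have Nn: "N \<in> null_sets lebesgue" using N by auto
  define g where "g k \<tau> = (if \<tau> \<in> {0<..<R} - N then h \<tau> (d k (y \<tau>)) (d k (z \<tau>)) else 0)" for k \<tau>
  define G where "G \<tau> = (if \<tau> \<in> {0<..<R} - N then h \<tau> (y \<tau>) (z \<tau>) else 0)" for \<tau>
  have "(\<lambda>\<tau>. if \<tau> \<in> {0<..<R} then h \<tau> (d k (y \<tau>)) (d k (z \<tau>)) else 0) \<in> borel_measurable lebesgue" for k
    using meas[of k] unfolding M_def by (subst borel_measurable_if) auto
  then have gm: "g k \<in> borel_measurable lebesgue" for k
  proof (rule borel_measurable_AE)
    show "AE \<tau> in lebesgue. (if \<tau> \<in> {0<..<R} then h \<tau> (d k (y \<tau>)) (d k (z \<tau>)) else 0) = g k \<tau>"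
      using AE_not_in[OF Nn] by eventually_elim (simp add: g_def)
  qed
  have lim: "(\<lambda>k. g k \<tau>) \<longlonglongrightarrow> G \<tau>" for \<tau>
  proof (cases "\<tau> \<in> {0<..<R} - N")
    case True
    then have "continuous_on UNIV (\<lambda>(y, z). h \<tau> y z)" using N(1) by auto
    then have "isCont (\<lambda>(y, z). h \<tau> y z) (y \<tau>, z \<tau>)" by (simp add: continuous_on_eq_continuous_at)
    then have "(\<lambda>k. (\<lambda>(y, z). h \<tau> y z) (d k (y \<tau>), d k (z \<tau>))) \<longlonglongrightarrow> (\<lambda>(y, z). h \<tau> y z) (y \<tau>, z \<tau>)"
      by (rule isCont_tendsto_compose) (intro tendsto_Pair d_lim)
    then show ?thesis using True by (simp add: g_def G_def)
  next
    case False
    then have "g k \<tau> = 0" "G \<tau> = 0" for k unfolding g_def G_def by (simp_all only: if_False)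
    then show ?thesis by simp
  qed
  have "G \<in> borel_measurable lebesgue"
    by (rule borel_measurable_LIMSEQ_real[OF lim gm])
  then have "(\<lambda>\<tau>. if \<tau> \<in> {0<..<R} then h \<tau> (y \<tau>) (z \<tau>) else 0) \<in> borel_measurable lebesgue"
  proof (rule borel_measurable_AE)
    show "AE \<tau> in lebesgue. G \<tau> = (if \<tau> \<in> {0<..<R} then h \<tau> (y \<tau>) (z \<tau>) else 0)"
      using AE_not_in[OF Nn] by eventually_elim (simp add: G_def)
  qed
  then show ?thesis by (subst (asm) borel_measurable_if) auto
qed

text \<open>The profile is taken along a fixed axis through the origin, where it is an even function;
so its derivative vanishes at \<open>0\<close>.\<close>

lemma radial_C1_profile:
  fixes w :: "'a::euclidean_space \<Rightarrow> real"
  assumes R: "0 < R" and C1: "C1_on (ball 0 R) w" and rad: "radial_on (ball 0 R) w"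
  obtains u u' where "\<And>x. x \<in> ball 0 R \<Longrightarrow> w x = u (norm x)"
    and "\<And>t. \<bar>t\<bar> < R \<Longrightarrow> DERIV u t :> u' t" and "continuous_on {-R<..<R} u'" and "u' 0 = 0"
    and "\<And>x. x \<in> ball 0 R \<Longrightarrow> grad w x = u' (norm x) *\<^sub>R sgn x"
proof -
  obtain U where U: "\<And>x. x \<in> ball 0 R \<Longrightarrow> w x = U (norm x)" using rad by (auto simp: radial_on_def)
  have gw: "GDERIV w x :> grad w x" if "x \<in> ball 0 R" for x using C1 that by (auto simp: C1_on_def)
  have along: "DERIV (\<lambda>t. w (t *\<^sub>R b)) t :> grad w (t *\<^sub>R b) \<bullet> b" if "\<bar>t\<bar> < R" "b \<in> Basis" for t b
  proof -
    have "(w has_derivative (\<lambda>h. h \<bullet> grad w (t *\<^sub>R b))) (at (t *\<^sub>R b))"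
      using gw[of "t *\<^sub>R b"] that by (simp add: gderiv_def)
    then have "((\<lambda>t. w (t *\<^sub>R b)) has_derivative (\<lambda>h. (h *\<^sub>R b) \<bullet> grad w (t *\<^sub>R b))) (at t)"
      by (rule has_derivative_compose[rotated]) (auto intro!: derivative_eq_intros)
    then show ?thesis
      unfolding has_field_derivative_def
      by (rule has_derivative_eq_rhs) (auto simp: fun_eq_iff inner_commute mult.commute)
  qed
  have even: "w (t *\<^sub>R b) = w ((- t) *\<^sub>R b)" if "\<bar>t\<bar> < R" "b \<in> Basis" for t b
    using U[of "t *\<^sub>R b"] U[of "(- t) *\<^sub>R b"] that by simp
  have g0b: "grad w 0 \<bullet> b = 0" if b: "b \<in> Basis" for b
  proof -
    let ?f = "\<lambda>t. w (t *\<^sub>R b)"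
    have d: "DERIV ?f 0 :> grad w 0 \<bullet> b" using along[of 0 b] R b by simp
    have "DERIV (\<lambda>t. ?f (- t)) 0 :> - (grad w 0 \<bullet> b)"
      using DERIV_mirror[of ?f "grad w 0 \<bullet> b" 0] d by simp
    then have "DERIV ?f 0 :> - (grad w 0 \<bullet> b)"
      by (rule has_field_derivative_transform_within_open[of _ _ _ "{-R<..<R}"])
         (use even[OF _ b] R in auto)
    from DERIV_unique[OF this d] show ?thesis by simp
  qed
  then have g0: "grad w 0 = 0" by (metis euclidean_all_zero_iff)
  obtain e :: 'a where e: "e \<in> Basis" using nonempty_Basis by blast
  define u where "u t = w (t *\<^sub>R e)" for t
  define u' where "u' t = grad w (t *\<^sub>R e) \<bullet> e" for t
  have wu: "w x = u (norm x)" if "x \<in> ball 0 R" for x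
    using U[OF that] U[of "norm x *\<^sub>R e"] that e by (simp add: u_def)
  have du: "DERIV u t :> u' t" if "\<bar>t\<bar> < R" for t
    unfolding u_def u'_def using along[OF that e] .
  show ?thesis
  proof (rule that[OF wu du])
    have "continuous_on {-R<..<R} (\<lambda>t. grad w (t *\<^sub>R e))"
    proof (rule continuous_on_compose2[of "ball 0 R" "grad w"])
      show "continuous_on (ball 0 R) (grad w)" using C1 by (simp add: C1_on_def)
      show "continuous_on {-R<..<R} (\<lambda>t. t *\<^sub>R e)" by (intro continuous_intros)
      show "(\<lambda>t. t *\<^sub>R e) ` {-R<..<R} \<subseteq> ball 0 R" using e by auto
    qed
    then show "continuous_on {-R<..<R} u'" unfolding u'_def by (intro continuous_intros)
    show "u' 0 = 0" by (simp add: u'_def g0)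
    show "grad w x = u' (norm x) *\<^sub>R sgn x" if x: "x \<in> ball 0 R" for x
    proof (cases "x = 0")
      case False
      have "GDERIV (\<lambda>x. u (norm x)) x :> u' (norm x) *\<^sub>R sgn x"
        using du[of "norm x"] x by (intro GDERIV_DERIV_compose[OF GDERIV_norm[OF False]]) auto
      then have "GDERIV w x :> u' (norm x) *\<^sub>R sgn x"
        unfolding gderiv_def
        by (rule has_derivative_transform_within_open[of _ _ _ _ "ball 0 R"]) (use x wu in auto)
      then show ?thesis by (rule grad_eqI)
    qed (simp add: g0)
  qed auto
qed

section \<open>Radial fields and their weak divergence\<close>

text \<open>Kernels of mass one that concentrate at \<open>c\<close>. The point \<open>c\<close> may be an endpoint of the interval.\<close>

lemma concentrating_kernel:
  fixes \<kappa> :: "real \<Rightarrow> real" and g :: "nat \<Rightarrow> real \<Rightarrow> real"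
  assumes \<kappa>: "continuous_on {s..r} \<kappa>" and c: "c \<in> {s..r}"
    and g: "\<And>j. continuous_on {s..r} (g j)" "\<And>j t. t \<in> {s..r} \<Longrightarrow> 0 \<le> g j t"
    and mass: "\<forall>\<^sub>F j in sequentially. integral {s..r} (g j) = 1"
    and conc: "\<And>\<delta>. \<delta> > 0 \<Longrightarrow> \<forall>\<^sub>F j in sequentially. \<forall>t\<in>{s..r}. \<bar>t - c\<bar> \<ge> \<delta> \<longrightarrow> g j t = 0"
  shows "(\<lambda>j. integral {s..r} (\<lambda>t. g j t * \<kappa> t)) \<longlonglongrightarrow> \<kappa> c"
proof (rule LIMSEQ_I)
  fix e :: real assume e: "e > 0"
  obtain \<delta> where \<delta>: "\<delta> > 0" "\<And>t. t \<in> {s..r} \<Longrightarrow> \<bar>t - c\<bar> < \<delta> \<Longrightarrow> \<bar>\<kappa> t - \<kappa> c\<bar> < e / 2"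
    using \<kappa> c e unfolding continuous_on_iff dist_real_def by (metis half_gt_zero)
  have "\<forall>\<^sub>F j in sequentially. norm (integral {s..r} (\<lambda>t. g j t * \<kappa> t) - \<kappa> c) < e"
    using mass conc[OF \<delta>(1)]
  proof eventually_elim
    case (elim j)
    have i1: "(\<lambda>t. g j t * \<kappa> t) integrable_on {s..r}" and i2: "g j integrable_on {s..r}"
      using g(1) \<kappa> by (auto intro!: integrable_continuous_real continuous_on_mult)
    have "integral {s..r} (\<lambda>t. g j t * \<kappa> t) - \<kappa> c = integral {s..r} (\<lambda>t. g j t * \<kappa> t) - integral {s..r} (\<lambda>t. g j t * \<kappa> c)"
      using elim(1) by simp
    also have "\<dots> = integral {s..r} (\<lambda>t. g j t * \<kappa> t - g j t * \<kappa> c)"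
      using i1 i2 by (intro Henstock_Kurzweil_Integration.integral_diff[symmetric] integrable_on_mult_left)
    also have "norm \<dots> \<le> integral {s..r} (\<lambda>t. g j t * (e / 2))"
    proof (rule Henstock_Kurzweil_Integration.integral_norm_bound_integral)
      show "(\<lambda>t. g j t * \<kappa> t - g j t * \<kappa> c) integrable_on {s..r}"
        using i1 i2 by (intro integrable_diff integrable_on_mult_left)
      show "(\<lambda>t. g j t * (e / 2)) integrable_on {s..r}" using i2 by (intro integrable_on_mult_left)
      fix t assume t: "t \<in> {s..r}"
      show "norm (g j t * \<kappa> t - g j t * \<kappa> c) \<le> g j t * (e / 2)"
      proof (cases "\<bar>t - c\<bar> < \<delta>")
        case True
        have "\<bar>g j t\<bar> * \<bar>\<kappa> t - \<kappa> c\<bar> \<le> g j t * (e / 2)"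
          using mult_left_mono[OF less_imp_le[OF \<delta>(2)[OF t True]] g(2)[OF t, of j]] g(2)[OF t, of j]
          by simp
        then show ?thesis by (simp only: right_diff_distrib[symmetric] real_norm_def abs_mult)
      next
        case False
        then have "g j t = 0" using elim(2) t by auto
        then show ?thesis by simp
      qed
    qed
    also have "\<dots> = e / 2" using elim(1) by simp
    finally show ?case using e by simp
  qed
  then show "\<exists>N. \<forall>n\<ge>N. norm (integral {s..r} (\<lambda>t. g n t * \<kappa> t) - \<kappa> c) < e"
    by (simp add: eventually_sequentially)
qed

text \<open>The derivative with respect to the radius of a ramp in the squared radius. The square keeps
the test functions smooth at the origin.\<close>

definition ramp_deriv :: "nat \<Rightarrow> real \<Rightarrow> real \<Rightarrow> real \<Rightarrow> real" where
  "ramp_deriv j \<beta> c t = 2 * t * (real j * smooth_step (Suc 0) (real j * (t\<^sup>2 - \<beta>) + c))"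

lemma DERIV_ramp:
  "DERIV (\<lambda>t. smooth_step 0 (real j * (t\<^sup>2 - \<beta>) + c)) t :> ramp_deriv j \<beta> c t"
proof -
  have "DERIV (\<lambda>t. real j * (t\<^sup>2 - \<beta>) + c) t :> real j * (2 * t)"
    by (auto intro!: derivative_eq_intros)
  from DERIV_chain2[OF DERIV_smooth_step this] show ?thesis
    by (simp add: ramp_deriv_def algebra_simps)
qed

lemma continuous_ramp_deriv: "continuous_on S (ramp_deriv j \<beta> c)"
  unfolding ramp_deriv_def
  by (intro continuous_intros continuous_on_compose2[OF continuous_smooth_step[of UNIV]]) auto

lemma smooth_step_deriv_zero:
  assumes "x < 0 \<or> x > 1"
  shows "smooth_step (Suc 0) x = 0"
proof -
  define S where "S = (if x < 0 then {..<0} else {1<..}::real set)"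
  define v where "v = (if x < 0 then 0 else 1::real)"
  have "DERIV (smooth_step 0) x :> 0"
  proof (rule has_field_derivative_transform_within_open[of "\<lambda>_. v" _ _ S])
    show "\<And>y. y \<in> S \<Longrightarrow> v = smooth_step 0 y"
      using assms by (auto simp: S_def v_def smooth_step_left smooth_step_right split: if_splits)
  qed (use assms in \<open>auto simp: S_def split: if_splits\<close>)
  then show ?thesis using DERIV_smooth_step DERIV_unique by blast
qed

lemma ramp_deriv_tendsto:
  fixes \<kappa> :: "real \<Rightarrow> real"
  assumes sr: "0 < s" "s < r" and \<kappa>: "continuous_on {s..r} \<kappa>"
  shows "(\<lambda>j. integral {s..r} (\<lambda>t. ramp_deriv j (s\<^sup>2) 0 t * \<kappa> t)) \<longlonglongrightarrow> \<kappa> s"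
    and "(\<lambda>j. integral {s..r} (\<lambda>t. ramp_deriv j (r\<^sup>2) 1 t * \<kappa> t)) \<longlonglongrightarrow> \<kappa> r"
proof -
  have sq: "s\<^sup>2 < r\<^sup>2" using sr by (simp add: power_strict_mono)
  then have large: "\<forall>\<^sub>F j in sequentially. real j * (r\<^sup>2 - s\<^sup>2) \<ge> 1"
    by (intro eventually_real_mult_ge) simp
  have nn: "0 \<le> ramp_deriv j \<beta> c t" if "t \<in> {s..r}" for j \<beta> c t
    using that sr smooth_step_deriv_nonneg by (simp add: ramp_deriv_def)
  have ftc: "integral {s..r} (ramp_deriv j \<beta> c) =
      smooth_step 0 (real j * (r\<^sup>2 - \<beta>) + c) - smooth_step 0 (real j * (s\<^sup>2 - \<beta>) + c)" for j \<beta> c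
  proof -
    have "ac_deriv s r (\<lambda>t. smooth_step 0 (real j * (t\<^sup>2 - \<beta>) + c)) (ramp_deriv j \<beta> c)"
      by (rule ac_deriv_C1[OF DERIV_ramp continuous_ramp_deriv])
    from ac_deriv_diff[OF this, of s r] sr show ?thesis by simp
  qed
  show "(\<lambda>j. integral {s..r} (\<lambda>t. ramp_deriv j (s\<^sup>2) 0 t * \<kappa> t)) \<longlonglongrightarrow> \<kappa> s"
  proof (rule concentrating_kernel[OF \<kappa> _ continuous_ramp_deriv nn])
    show "\<forall>\<^sub>F j in sequentially. integral {s..r} (ramp_deriv j (s\<^sup>2) 0) = 1"
      using large by eventually_elim (simp add: ftc smooth_step_left smooth_step_right)
    fix \<delta> :: real assume \<delta>: "\<delta> > 0"
    have "\<forall>\<^sub>F j in sequentially. real j * (s * \<delta>) \<ge> 1" using \<delta> sr by (intro eventually_real_mult_ge) simp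
    then show "\<forall>\<^sub>F j in sequentially. \<forall>t\<in>{s..r}. \<bar>t - s\<bar> \<ge> \<delta> \<longrightarrow> ramp_deriv j (s\<^sup>2) 0 t = 0"
    proof (eventually_elim, safe)
      fix j t assume j: "1 \<le> real j * (s * \<delta>)" and t: "t \<in> {s..r}" "\<delta> \<le> \<bar>t - s\<bar>"
      have jp: "0 < real j" using j by (cases "j = 0") auto
      have "s * \<delta> \<le> s * (t - s)" using t sr by (intro mult_left_mono) auto
      also have "\<dots> < (t + s) * (t - s)" using t sr \<delta> by (intro mult_strict_right_mono) auto
      also have "\<dots> = t\<^sup>2 - s\<^sup>2" by (simp add: power2_eq_square algebra_simps)
      finally have "real j * (s * \<delta>) < real j * (t\<^sup>2 - s\<^sup>2)" using jp by simp
      then show "ramp_deriv j (s\<^sup>2) 0 t = 0" using j by (simp add: ramp_deriv_def smooth_step_deriv_zero)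
    qed
  qed (use sr in auto)
  show "(\<lambda>j. integral {s..r} (\<lambda>t. ramp_deriv j (r\<^sup>2) 1 t * \<kappa> t)) \<longlonglongrightarrow> \<kappa> r"
  proof (rule concentrating_kernel[OF \<kappa> _ continuous_ramp_deriv nn])
    show "\<forall>\<^sub>F j in sequentially. integral {s..r} (ramp_deriv j (r\<^sup>2) 1) = 1"
      using large
    proof eventually_elim
      case (elim j)
      have "real j * (s\<^sup>2 - r\<^sup>2) + 1 \<le> 0" using elim by (simp add: algebra_simps)
      then show ?case by (simp add: ftc smooth_step_left smooth_step_right)
    qed
    fix \<delta> :: real assume \<delta>: "\<delta> > 0"
    have "\<forall>\<^sub>F j in sequentially. real j * (s * \<delta>) \<ge> 1" using \<delta> sr by (intro eventually_real_mult_ge) simp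
    then show "\<forall>\<^sub>F j in sequentially. \<forall>t\<in>{s..r}. \<bar>t - r\<bar> \<ge> \<delta> \<longrightarrow> ramp_deriv j (r\<^sup>2) 1 t = 0"
    proof (eventually_elim, safe)
      fix j t assume j: "1 \<le> real j * (s * \<delta>)" and t: "t \<in> {s..r}" "\<delta> \<le> \<bar>t - r\<bar>"
      have jp: "0 < real j" using j by (cases "j = 0") auto
      have "s * \<delta> \<le> s * (r - t)" using t sr by (intro mult_left_mono) auto
      also have "\<dots> < (r + t) * (r - t)" using t sr \<delta> by (intro mult_strict_right_mono) auto
      also have "\<dots> = r\<^sup>2 - t\<^sup>2" by (simp add: power2_eq_square algebra_simps)
      finally have "real j * (s * \<delta>) < real j * (r\<^sup>2 - t\<^sup>2)" using jp by simp
      then have "real j * (t\<^sup>2 - r\<^sup>2) + 1 < 0" using j by (simp add: algebra_simps)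
      then show "ramp_deriv j (r\<^sup>2) 1 t = 0" by (simp add: ramp_deriv_def smooth_step_deriv_zero)
    qed
  qed (use sr in auto)
qed

text \<open>The test functions are cutoffs in the squared norm, tending to the indicator of the shell
\<open>s < |x| < r\<close>. In polar coordinates the left-hand side tests \<open>t\<^sup>n\<^sup>-\<^sup>1 k(t)\<close> with two kernels that concentrate
at \<open>s\<close> and at \<open>r\<close>.\<close>

lemma radial_weak_increment:
  fixes k f :: "real \<Rightarrow> real"
  assumes k: "continuous_on {s..r} k" and sr: "0 < s" "s < r" "r < R"
    and f: "(\<lambda>t. t ^ (DIM('a::euclidean_space) - 1) * f t) absolutely_integrable_on {s..r}"
    and eq: "\<And>\<eta>. smooth_bump (ball (0::'a) R) \<eta> \<Longrightarrow>
        (LINT x:ball 0 R|lebesgue. (k (norm x) *\<^sub>R sgn x) \<bullet> grad \<eta> x) = - (LINT x:ball 0 R|lebesgue. f (norm x) * \<eta> x)"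
  shows "r ^ (DIM('a) - 1) * k r - s ^ (DIM('a) - 1) * k s = integral {s..r} (\<lambda>t. t ^ (DIM('a) - 1) * f t)"
proof -
  define m where "m = DIM('a) - 1"
  define \<kappa> where "\<kappa> t = t ^ m * k t" for t
  define F where "F t = t ^ m * f t" for t
  have Fi: "F absolutely_integrable_on {s..r}" using f by (simp add: F_def[abs_def] m_def)
  have c\<kappa>: "continuous_on {s..r} \<kappa>" unfolding \<kappa>_def
    by (intro continuous_intros k)
  have sq: "s\<^sup>2 < r\<^sup>2" using sr by (simp add: power_strict_mono)
  then obtain N where N: "\<And>j. j \<ge> N \<Longrightarrow> real j * (r\<^sup>2 - s\<^sup>2) \<ge> 1"
    using eventually_real_mult_ge[of "r\<^sup>2 - s\<^sup>2"] by (auto simp: eventually_sequentially)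
  define D where "D j t = ramp_deriv j (s\<^sup>2) 0 t - ramp_deriv j (r\<^sup>2) 1 t" for j t
  define X where "X j t = cutoff j (s\<^sup>2) (r\<^sup>2) (t\<^sup>2)" for j t
  have cD: "continuous_on S (D j)" for S j
    unfolding D_def by (intro continuous_on_diff continuous_ramp_deriv)
  have cX: "continuous_on S (X j)" for S j
    unfolding X_def by (intro continuous_on_compose2[OF continuous_cutoff[of UNIV]] continuous_intros) auto
  have XD: "DERIV (X j) t :> D j t" for j t
    unfolding X_def cutoff_def D_def
    using DERIV_diff[OF DERIV_ramp[of j "s\<^sup>2" 0 t] DERIV_ramp[of j "r\<^sup>2" 1 t]] by simp
  have Xout: "X j t = 0" if "j \<ge> N" "0 \<le> t" "t \<notin> {s<..<r}" for j t
  proof -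
    have "t\<^sup>2 \<le> s\<^sup>2 \<or> r\<^sup>2 \<le> t\<^sup>2" using that sr by (auto simp: not_less intro!: power_mono)
    then show ?thesis unfolding X_def using cutoff_outside[OF N[OF that(1)]] by blast
  qed
  have Dout: "D j t = 0" if "j \<ge> N" "0 \<le> t" "t \<notin> {s..r}" for j t
  proof -
    define S where "S = (if t < s then {-s<..<s} else {r<..})"
    have "DERIV (X j) t :> 0"
    proof (rule has_field_derivative_transform_within_open[of "\<lambda>_. 0" _ _ S])
      show "0 = X j y" if y: "y \<in> S" for y
      proof -
        have "X j y = X j \<bar>y\<bar>" by (simp add: X_def)
        also have "\<dots> = 0" using y \<open>t \<notin> {s..r}\<close> sr
          by (intro Xout[OF \<open>j \<ge> N\<close>]) (auto simp: S_def split: if_splits)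
        finally show ?thesis by simp
      qed
    qed (use that sr in \<open>auto simp: S_def\<close>)
    then show ?thesis using XD DERIV_unique by blast
  qed
  have main: "integral {s..r} (\<lambda>t. D j t * \<kappa> t) = - integral {s..r} (\<lambda>t. X j t * F t)" if j: "j \<ge> N" for j
  proof -
    define \<eta> where "\<eta> x = cutoff j (s\<^sup>2) (r\<^sup>2) (x \<bullet> x)" for x :: 'a
    have \<eta>X: "\<eta> x = X j (norm x)" for x by (simp add: \<eta>_def X_def dot_square_norm)
    have bump: "smooth_bump (ball 0 R) \<eta>"
    proof (rule smooth_bumpI)
      show "smooth_gen \<eta>" unfolding \<eta>_def by (intro smooth_gen_cutoff smooth_gen_inner_self)
      show "compact (cball (0::'a) r)" "cball (0::'a) r \<subseteq> ball 0 R" using sr by auto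
      show "\<eta> x = 0" if "x \<notin> cball 0 r" for x unfolding \<eta>X using that by (intro Xout[OF j]) auto
    qed
    have g\<eta>: "grad \<eta> x = D j (norm x) *\<^sub>R sgn x" for x
    proof (cases "x = 0")
      case False
      have "GDERIV (\<lambda>x. X j (norm x)) x :> D j (norm x) *\<^sub>R sgn x"
        by (rule GDERIV_DERIV_compose[OF GDERIV_norm[OF False] XD])
      then show ?thesis using \<eta>X by (intro grad_eqI) (simp add: \<eta>X[abs_def])
    next
      case True
      have "((\<lambda>_. 0) has_derivative (\<lambda>h. 0)) (at x)" by simp
      then have "(\<eta> has_derivative (\<lambda>h. 0)) (at x)"
        by (rule has_derivative_transform_within_open[of _ _ _ _ "ball 0 s"])
           (use True sr Xout[OF j] \<eta>X in auto)
      then have "GDERIV \<eta> x :> 0" by (simp add: gderiv_def)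
      then show ?thesis using True by (simp add: grad_eqI)
    qed
    define L where "L t = indicator {s..r} t * (D j t * k t)" for t
    define P where "P t = indicator {s..r} t * (X j t * f t)" for t
    have ck: "continuous_on {s..r} (\<lambda>t. D j t * k t)"
      by (intro continuous_intros cD k)
    have Lm: "L \<in> borel_measurable lebesgue"
      using absolutely_integrable_continuous_real[OF ck] unfolding set_integrable_def L_def[abs_def] by auto
    have Pm: "P \<in> borel_measurable lebesgue"
    proof -
      have "continuous_on {s..r} (\<lambda>t. X j t / t ^ m)" using sr by (intro continuous_intros cX) auto
      from absolutely_integrable_continuous_mult[OF this Fi]
      have "(\<lambda>t. indicator {s..r} t *\<^sub>R (X j t / t ^ m * F t)) \<in> borel_measurable lebesgue"
        unfolding set_integrable_def by auto
      also have "(\<lambda>t. indicator {s..r} t *\<^sub>R (X j t / t ^ m * F t)) = P"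
        using sr by (auto simp: P_def F_def indicator_def)
      finally show ?thesis .
    qed
    have "(LINT x:ball 0 R|lebesgue. (k (norm x) *\<^sub>R sgn x) \<bullet> grad \<eta> x) = (LINT x|lebesgue. L (norm (x::'a)))"
      unfolding set_lebesgue_integral_def
    proof (rule Bochner_Integration.integral_cong[OF refl])
      fix x :: 'a
      have "sgn x \<bullet> sgn x = (if x = 0 then 0 else 1)"
        by (simp add: sgn_div_norm dot_square_norm power2_eq_square)
      then show "indicat_real (ball 0 R) x *\<^sub>R ((k (norm x) *\<^sub>R sgn x) \<bullet> grad \<eta> x) = L (norm x)"
        unfolding g\<eta> L_def using sr Dout[OF j, of "norm x"] by (auto simp: indicator_def)
    qed
    moreover have "(LINT x:ball 0 R|lebesgue. f (norm x) * \<eta> x) = (LINT x|lebesgue. P (norm (x::'a)))"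
      unfolding set_lebesgue_integral_def
    proof (rule Bochner_Integration.integral_cong[OF refl])
      fix x :: 'a
      show "indicat_real (ball 0 R) x *\<^sub>R (f (norm x) * \<eta> x) = P (norm x)"
        unfolding \<eta>X P_def using sr Xout[OF j, of "norm x"] by (auto simp: indicator_def)
    qed
    ultimately have "(LINT x|lebesgue. L (norm (x::'a))) = - (LINT x|lebesgue. P (norm (x::'a)))"
      using eq[OF bump] by simp
    then have "sphere_area TYPE('a) * (LINT t|lebesgue. indicator {0<..} t * (t ^ m * L t)) =
        sphere_area TYPE('a) * (- (LINT t|lebesgue. indicator {0<..} t * (t ^ m * P t)))"
      by (simp add: integral_norm[OF Lm] integral_norm[OF Pm] m_def)
    then have "(LINT t|lebesgue. indicator {0<..} t * (t ^ m * L t)) =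
        - (LINT t|lebesgue. indicator {0<..} t * (t ^ m * P t))"
      using sphere_area_pos[where 'a='a] by (simp only: mult_cancel_left) auto
    moreover have "(LINT t|lebesgue. indicator {0<..} t * (t ^ m * L t)) = (LINT t:{s..r}|lebesgue. D j t * \<kappa> t)"
      unfolding set_lebesgue_integral_def
      by (intro Bochner_Integration.integral_cong) (use sr in \<open>auto simp: L_def \<kappa>_def indicator_def\<close>)
    moreover have "(LINT t|lebesgue. indicator {0<..} t * (t ^ m * P t)) = (LINT t:{s..r}|lebesgue. X j t * F t)"
      unfolding set_lebesgue_integral_def
      by (intro Bochner_Integration.integral_cong) (use sr in \<open>auto simp: P_def F_def indicator_def\<close>)
    moreover have "(LINT t:{s..r}|lebesgue. D j t * \<kappa> t) = integral {s..r} (\<lambda>t. D j t * \<kappa> t)"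
      by (intro set_lebesgue_integral_eq_integral absolutely_integrable_continuous_real continuous_on_mult cD c\<kappa>)
    moreover have "(LINT t:{s..r}|lebesgue. X j t * F t) = integral {s..r} (\<lambda>t. X j t * F t)"
      by (intro set_lebesgue_integral_eq_integral absolutely_integrable_continuous_mult cX Fi)
    ultimately show ?thesis by simp
  qed
  have "(\<lambda>j. integral {s..r} (\<lambda>t. D j t * \<kappa> t)) \<longlonglongrightarrow> \<kappa> s - \<kappa> r"
  proof -
    have "integral {s..r} (\<lambda>t. D j t * \<kappa> t) =
      integral {s..r} (\<lambda>t. ramp_deriv j (s\<^sup>2) 0 t * \<kappa> t) - integral {s..r} (\<lambda>t. ramp_deriv j (r\<^sup>2) 1 t * \<kappa> t)" for j
      unfolding D_def left_diff_distrib
      by (intro Henstock_Kurzweil_Integration.integral_diff integrable_continuous_real continuous_on_mult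
          continuous_ramp_deriv c\<kappa>)
    then show ?thesis using tendsto_diff[OF ramp_deriv_tendsto[OF sr(1,2) c\<kappa>]] by simp
  qed
  moreover have "(\<lambda>j. integral {s..r} (\<lambda>t. X j t * F t)) \<longlonglongrightarrow> integral {s..r} (\<lambda>t. indicator {s<..<r} t * F t)"
  proof (rule dominated_convergence(2))
    show "(\<lambda>t. X j t * F t) integrable_on {s..r}" for j
      using absolutely_integrable_continuous_mult[OF cX Fi] by (rule set_lebesgue_integral_eq_integral)
    show "(\<lambda>t. \<bar>F t\<bar>) integrable_on {s..r}" using abs_int_sub(3)[OF Fi] by simp
    show "norm (X j t * F t) \<le> \<bar>F t\<bar>" for j t
      using cutoff_bound[of j "s\<^sup>2" "r\<^sup>2" "t\<^sup>2"] by (simp add: X_def abs_mult mult_left_le_one_le)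
    show "(\<lambda>j. X j t * F t) \<longlonglongrightarrow> indicator {s<..<r} t * F t" if t: "t \<in> {s..r}" for t
    proof -
      have "s\<^sup>2 < t\<^sup>2 \<longleftrightarrow> s < t" "t\<^sup>2 < r\<^sup>2 \<longleftrightarrow> t < r" using t sr by (auto intro: power_strict_mono power2_less_imp_less)
      then have "indicator {s\<^sup>2<..<r\<^sup>2} (t\<^sup>2) = (indicator {s<..<r} t :: real)" by (auto simp: indicator_def)
      then show ?thesis
        using cutoff_tendsto[OF sq, of "t\<^sup>2"] unfolding X_def by (intro tendsto_mult tendsto_const) simp
    qed
  qed
  moreover have ind: "integral {s..r} (\<lambda>t. indicator {s<..<r} t * F t) = integral {s..r} F"
    by (rule integral_spike[of "{s, r}"]) (auto simp: indicator_def)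
  ultimately have limD: "(\<lambda>j. integral {s..r} (\<lambda>t. D j t * \<kappa> t)) \<longlonglongrightarrow> \<kappa> s - \<kappa> r"
    and limX: "(\<lambda>j. integral {s..r} (\<lambda>t. X j t * F t)) \<longlonglongrightarrow> integral {s..r} F"
    by simp_all
  have "\<forall>\<^sub>F j in sequentially. integral {s..r} (\<lambda>t. D j t * \<kappa> t) = - integral {s..r} (\<lambda>t. X j t * F t)"
    using main by (auto simp: eventually_sequentially)
  from LIMSEQ_unique[OF Lim_transform_eventually[OF limD this] tendsto_minus[OF limX]]
  have "\<kappa> s - \<kappa> r = - integral {s..r} F" .
  then show ?thesis by (simp add: \<kappa>_def F_def[abs_def] m_def)
qed

lemma radial_weak_imp_ac_deriv:
  fixes k f :: "real \<Rightarrow> real"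
  assumes k: "continuous_on {s..r} k" and sr: "0 < s" "r < R"
    and f: "(\<lambda>t. t ^ (DIM('a::euclidean_space) - 1) * f t) absolutely_integrable_on {s..r}"
    and eq: "\<And>\<eta>. smooth_bump (ball (0::'a) R) \<eta> \<Longrightarrow>
        (LINT x:ball 0 R|lebesgue. (k (norm x) *\<^sub>R sgn x) \<bullet> grad \<eta> x) = - (LINT x:ball 0 R|lebesgue. f (norm x) * \<eta> x)"
  shows "ac_deriv s r (\<lambda>t. t ^ (DIM('a) - 1) * k t) (\<lambda>t. t ^ (DIM('a) - 1) * f t)"
proof (rule ac_derivI[OF f])
  fix x assume x: "s \<le> x" "x \<le> r"
  show "x ^ (DIM('a) - 1) * k x - s ^ (DIM('a) - 1) * k s = integral {s..x} (\<lambda>t. t ^ (DIM('a) - 1) * f t)"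
  proof (cases "s = x")
    case False
    then show ?thesis
      using x sr by (intro radial_weak_increment[OF continuous_on_subset[OF k] _ _ _ abs_int_sub(1)[OF f] eq]) auto
  qed simp
qed

section \<open>The energy argument on an interval\<close>

lemma continuous_on_abs_powr:
  fixes f :: "real \<Rightarrow> real"
  assumes "continuous_on S f" "s > 0"
  shows "continuous_on S (\<lambda>x. \<bar>f x\<bar> powr s)"
  using assms by (intro continuous_on_powr' continuous_intros) auto

lemma isCont_abs_powr: "s > 0 \<Longrightarrow> isCont (\<lambda>y::real. \<bar>y\<bar> powr s) y"
  using continuous_on_abs_powr[OF continuous_on_id, of s UNIV] by (simp add: continuous_on_eq_continuous_at)

lemma DERIV_abs_powr:
  assumes s: "s > 1"
  shows "DERIV (\<lambda>y::real. \<bar>y\<bar> powr s) y :> s * (sgn y * \<bar>y\<bar> powr (s - 1))"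
proof (cases y "0 :: real" rule: linorder_cases)
  case greater
  have "DERIV (\<lambda>y::real. y powr s) y :> s * y powr (s - 1)"
    using greater by (rule has_real_derivative_powr)
  then have "DERIV (\<lambda>y::real. \<bar>y\<bar> powr s) y :> s * y powr (s - 1)"
    by (rule has_field_derivative_transform_within_open[of _ _ _ "{0<..}"]) (use greater in auto)
  then show ?thesis using greater by simp
next
  case less
  have "DERIV (\<lambda>y::real. (- y) powr s) y :> s * (- y) powr (s - 1) * (- 1)"
    using less by (intro DERIV_chain2[OF has_real_derivative_powr]) (auto intro!: derivative_eq_intros)
  then have "DERIV (\<lambda>y::real. \<bar>y\<bar> powr s) y :> s * (- y) powr (s - 1) * (- 1)"
    by (rule has_field_derivative_transform_within_open[of _ _ _ "{..<0}"]) (use less in auto)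
  then show ?thesis using less by simp
next
  case equal
  have "(\<lambda>h::real. \<bar>h\<bar> powr s / h) \<midarrow>0\<rightarrow> 0"
  proof (rule Lim_null_comparison)
    have "\<bar>h\<bar> powr s / \<bar>h\<bar> = \<bar>h\<bar> powr (s - 1)" if "h \<noteq> 0" for h :: real
      using that by (simp add: powr_diff)
    then show "\<forall>\<^sub>F h::real in at 0. norm (\<bar>h\<bar> powr s / h) \<le> \<bar>h\<bar> powr (s - 1)"
      by (auto simp: eventually_at_filter)
    have "isCont (\<lambda>h::real. \<bar>h\<bar> powr (s - 1)) 0"
      using s by (intro isCont_abs_powr) auto
    then show "(\<lambda>h::real. \<bar>h\<bar> powr (s - 1)) \<midarrow>0\<rightarrow> 0" using s by (simp add: isCont_def)
  qed
  then show ?thesis using equal s by (simp add: DERIV_def)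
qed

lemma Phi_real: "Phi p (y::real) = sgn y * \<bar>y\<bar> powr (p - 1)"
proof (cases "y = 0")
  case False
  have "\<bar>y\<bar> powr (p - 1) = \<bar>y\<bar> powr (p - 2) * \<bar>y\<bar>"
    using False powr_add[of "\<bar>y\<bar>" "p - 2" 1] by simp
  then show ?thesis by (simp add: Phi_def sgn_if)
qed (simp add: Phi_def)

lemma abs_Phi: "\<bar>Phi p (y::real)\<bar> = \<bar>y\<bar> powr (p - 1)"
  by (cases "y = 0") (auto simp: Phi_real abs_mult abs_sgn_eq)

lemma Phi_mult_self: "Phi p y * y = \<bar>y::real\<bar> powr p"
proof (cases "y = 0")
  case False
  have "\<bar>y\<bar> powr p = \<bar>y\<bar> powr (p - 1) * \<bar>y\<bar>"
    using False powr_add[of "\<bar>y\<bar>" "p - 1" 1] by simp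
  then show ?thesis by (simp add: Phi_real sgn_if)
qed (simp add: Phi_def)

text \<open>\<open>Phi p\<close> is inverted by \<open>Phi p'\<close> with the conjugate exponent \<open>p' = p/(p-1)\<close>, for which \<open>(p-1)(p'-1) = 1\<close>.\<close>

lemma Phi_conjugate:
  assumes "p > 1"
  shows "\<bar>Phi p (y::real)\<bar> powr (p / (p - 1)) = \<bar>y\<bar> powr p"
    "sgn (Phi p y) * \<bar>Phi p y\<bar> powr (p / (p - 1) - 1) = y"
proof -
  show "\<bar>Phi p y\<bar> powr (p / (p - 1)) = \<bar>y\<bar> powr p"
    using assms by (simp add: abs_Phi powr_powr)
  have "p / (p - 1) - 1 = 1 / (p - 1)" using assms by (simp add: field_simps)
  then have "\<bar>Phi p y\<bar> powr (p / (p - 1) - 1) = \<bar>y\<bar>"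
    using assms by (simp add: abs_Phi powr_powr)
  moreover have "sgn (Phi p y) = sgn y" by (cases "y = 0") (auto simp: Phi_real sgn_mult)
  ultimately show "sgn (Phi p y) * \<bar>Phi p y\<bar> powr (p / (p - 1) - 1) = y" by (simp add: sgn_mult_abs)
qed

lemma continuous_on_Phi:
  assumes "continuous_on S f" "p > 1"
  shows "continuous_on S (\<lambda>x. Phi p (f x :: real))"
proof -
  have "DERIV (\<lambda>y::real. \<bar>y\<bar> powr p) y :> p * Phi p y" for y
    using DERIV_abs_powr[OF assms(2)] by (simp add: Phi_real)
  have "isCont (\<lambda>y::real. Phi p y) y" for y
  proof (cases "y = 0")
    case False
    then show ?thesis unfolding Phi_def by (intro continuous_intros) auto
  next
    case True
    have "isCont (\<lambda>y::real. \<bar>y\<bar> powr (p - 1)) y"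
      using assms(2) by (intro isCont_abs_powr) auto
    then have "(\<lambda>y::real. \<bar>y\<bar> powr (p - 1)) \<midarrow>0\<rightarrow> 0" using True assms(2) by (simp add: isCont_def)
    then have "(\<lambda>y::real. Phi p y) \<midarrow>0\<rightarrow> 0"
      by (rule Lim_null_comparison[rotated]) (auto simp: abs_Phi)
    then show ?thesis using True by (simp add: isCont_def Phi_def)
  qed
  then have "continuous_on UNIV (Phi p :: real \<Rightarrow> real)" by (simp add: continuous_at_imp_continuous_on)
  from continuous_on_compose2[OF this assms(1)] show ?thesis by simp
qed

lemma integral_mono_AE_Icc:
  fixes f g :: "real \<Rightarrow> real"
  assumes "f absolutely_integrable_on {x..y}" "g absolutely_integrable_on {x..y}"
    "AE t in lebesgue. t \<in> {x..y} \<longrightarrow> f t \<le> g t"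
  shows "integral {x..y} f \<le> integral {x..y} g"
proof -
  have "(LINT t:{x..y}|lebesgue. f t) \<le> (LINT t:{x..y}|lebesgue. g t)"
    using assms by (intro set_integral_mono_AE) auto
  then show ?thesis using assms by (simp add: set_lebesgue_integral_eq_integral)
qed

lemma AE_lebesgue_ne: "AE t in lebesgue. t \<noteq> (c::real)"
  by (rule AE_completion[OF AE_lborel_singleton])

lemma AE_Ioo_ex:
  assumes "s < (r::real)" "AE t in lebesgue. t \<in> {s<..<r} \<longrightarrow> Q t"
  shows "\<exists>t\<in>{s<..<r}. Q t"
proof (rule ccontr)
  assume "\<not> ?thesis"
  with assms(2) have "AE t in lebesgue. t \<notin> {s<..<r}" by (auto elim!: eventually_mono)
  then have "{s<..<r} \<in> null_sets lebesgue" by (subst AE_iff_null_sets) auto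
  then have "negligible {s<..<r}" by (simp add: negligible_iff_null_sets)
  then show False using assms(1) negligible_interval(2)[of s r] by simp
qed

text \<open>The profile equation on \<open>[0,\<rho>]\<close>, with \<open>H\<close> in the role of \<open>h(t, u, u')\<close>. The weight \<open>v + (1 - 1/p) a'\<close>
in front of \<open>Phi p (u' t)\<close> is \<open>(n-1) a/t\<close> for the equation in nondivergence form and
\<open>(n-1) a/t + a'\<close> for the one in divergence form. The field \<open>Phi p (u' t)\<close> is only known to be absolutely
continuous away from \<open>0\<close>.\<close>

locale energy_setup =
  fixes p l \<theta> \<rho> :: real and A a' q v H \<phi> \<Psi> u u' \<psi>' :: "real \<Rightarrow> real"
  assumes p: "1 < p" and l: "0 < l" "l < p" and \<theta>: "0 < \<theta>" and \<rho>: "0 < \<rho>"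
    and A: "ac_deriv 0 \<rho> A a'" and A_nonneg: "\<And>t. t \<in> {0..\<rho>} \<Longrightarrow> 0 \<le> A t"
    and u: "\<And>t. t \<in> {0..\<rho>} \<Longrightarrow> DERIV u t :> u' t" and cu': "continuous_on {0..\<rho>} u'"
    and u0: "u 0 = 0" and u'0: "u' 0 = 0"
    and \<psi>: "\<And>s. 0 < s \<Longrightarrow> s \<le> \<rho> \<Longrightarrow> ac_deriv s \<rho> (\<lambda>t. Phi p (u' t)) \<psi>'"
    and \<Psi>: "\<And>y. DERIV \<Psi> y :> \<phi> y" and c\<phi>: "continuous_on UNIV \<phi>"
    and \<Psi>0: "\<Psi> 0 = 0" and \<Psi>_nonneg: "\<And>y. 0 \<le> \<Psi> y"
    and equation: "AE t in lebesgue. t \<in> {0<..<\<rho>} \<longrightarrow>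
      A t * \<psi>' t = H t - \<phi> (u t) - (v t + (1 - 1 / p) * a' t) * Phi p (u' t)"
    and H_bound: "AE t in lebesgue. t \<in> {0<..<\<rho>} \<longrightarrow>
      H t * u' t \<le> \<theta> * q t * \<bar>u t\<bar> powr l * \<bar>u' t\<bar> powr (p - l) + (1 - \<theta>) * v t * \<bar>u' t\<bar> powr p"
    and q: "q absolutely_integrable_on {0..\<rho>}" and q_nonneg: "\<And>t. t \<in> {0<..<\<rho>} \<Longrightarrow> 0 \<le> q t"
    and v: "v absolutely_integrable_on {0..\<rho>}" and v_pos: "AE t in lebesgue. t \<in> {0<..<\<rho>} \<longrightarrow> 0 < v t"
    and v_dual: "(\<lambda>t. v t powr (- (1 / (p - 1)))) absolutely_integrable_on {0..\<rho>}"
    and J: "(\<lambda>t. q t powr (p / l) * v t powr (- ((p - l) / l)) *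
        integral {0..t} (\<lambda>\<sigma>. v \<sigma> powr (- (1 / (p - 1)))) powr (p - 1)) absolutely_integrable_on {0..\<rho>}"
begin

text \<open>\<open>K\<close> is the integrand of \<open>K_const\<close>, \<open>W\<close> and \<open>V\<close> are the integrands on the two
  sides of the Opial inequality.\<close>

definition "P t = integral {0..t} (\<lambda>\<sigma>. v \<sigma> powr (- (1 / (p - 1))))"
definition "K t = q t powr (p / l) * v t powr (- ((p - l) / l)) * P t powr (p - 1)"
definition "W t = \<bar>u t\<bar> powr l * \<bar>u' t\<bar> powr (p - l) * q t"
definition "V t = \<bar>u' t\<bar> powr p * v t"
definition "energy t = (1 - 1 / p) * (A t * \<bar>u' t\<bar> powr p) + \<Psi> (u t)"

lemma cu: "continuous_on {0..\<rho>} u"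
  using u by (intro DERIV_continuous_on) (auto intro: DERIV_subset)

lemma ac_u: "ac_deriv 0 \<rho> u u'"
  using u cu' by (rule ac_deriv_C1)

lemma K_int: "K absolutely_integrable_on {0..\<rho>}"
  using J by (simp add: K_def[abs_def] P_def)

lemma W_int: "W absolutely_integrable_on {0..\<rho>}"
  unfolding W_def using l p
  by (intro absolutely_integrable_continuous_mult continuous_on_mult continuous_on_abs_powr cu cu' q) auto

lemma V_int: "V absolutely_integrable_on {0..\<rho>}"
  unfolding V_def using p by (intro absolutely_integrable_continuous_mult continuous_on_abs_powr cu' v) auto

lemma energy_nonneg: "t \<in> {0..\<rho>} \<Longrightarrow> 0 \<le> energy t"
  using A_nonneg[of t] \<Psi>_nonneg[of "u t"] p by (simp add: energy_def)

lemma continuous_energy: "continuous_on {0..\<rho>} energy"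
proof -
  have "continuous_on {0..\<rho>} (\<lambda>t. \<Psi> (u t))"
    by (rule continuous_on_compose2[OF DERIV_continuous_on cu, of UNIV _ \<phi>]) (auto intro: DERIV_subset \<Psi>)
  then show ?thesis unfolding energy_def[abs_def] using p
    by (intro continuous_on_add continuous_on_mult continuous_on_const ac_deriv_continuous[OF A]
        continuous_on_abs_powr cu') auto
qed

text \<open>Differentiate \<open>|u'|\<^sup>p = |Phi p u'|\<^sup>p\<^sup>'\<close> by the chain rule; the derivative is \<open>p' u' \<psi>'\<close>, since
\<open>Phi p\<close> and \<open>Phi p'\<close> are inverse to each other. After multiplication by \<open>A\<close> the profile equation can be
inserted.\<close>

lemma energy_decay:
  assumes sr: "0 < s" "s \<le> r" "r \<le> \<rho>"
  shows "energy r - energy s \<le> \<theta> * integral {s..r} (\<lambda>t. W t - V t)"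
proof -
  define p' where "p' = p / (p - 1)"
  have p': "p' > 1" "(1 - 1 / p) * p' = 1" using p by (auto simp: p'_def field_simps)
  have \<psi>s: "ac_deriv s \<rho> (\<lambda>t. Phi p (u' t)) \<psi>'" using \<psi> sr by simp
  have cu's: "continuous_on {s..\<rho>} u'" using cu' sr by (auto intro: continuous_on_subset)
  have "ac_deriv s \<rho> (\<lambda>t. \<bar>Phi p (u' t)\<bar> powr p')
      (\<lambda>t. p' * (sgn (Phi p (u' t)) * \<bar>Phi p (u' t)\<bar> powr (p' - 1)) * \<psi>' t)"
  proof (rule ac_deriv_chain[OF \<psi>s])
    show "DERIV (\<lambda>y. \<bar>y\<bar> powr p') (Phi p (u' t)) :> p' * (sgn (Phi p (u' t)) * \<bar>Phi p (u' t)\<bar> powr (p' - 1))" for t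
      by (rule DERIV_abs_powr[OF p'(1)])
    show "continuous_on {s..\<rho>} (\<lambda>t. p' * (sgn (Phi p (u' t)) * \<bar>Phi p (u' t)\<bar> powr (p' - 1)))"
      unfolding p'_def Phi_conjugate(2)[OF p] by (intro continuous_intros cu's)
  qed
  then have 1: "ac_deriv s \<rho> (\<lambda>t. \<bar>u' t\<bar> powr p) (\<lambda>t. p' * u' t * \<psi>' t)"
    unfolding p'_def Phi_conjugate[OF p] .
  have "ac_deriv s \<rho> A a'" using A sr by (intro ac_deriv_subinterval[OF A]) auto
  from ac_deriv_mult[OF this 1]
  have 2: "ac_deriv s \<rho> (\<lambda>t. A t * \<bar>u' t\<bar> powr p) (\<lambda>t. \<bar>u' t\<bar> powr p * a' t + A t * (p' * u' t * \<psi>' t))" .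
  have "ac_deriv s \<rho> (\<lambda>t. 1 - 1 / p) (\<lambda>t. 0)"
    by (rule ac_deriv_C1) auto
  from ac_deriv_mult[OF this 2]
  have 3: "ac_deriv s \<rho> (\<lambda>t. (1 - 1 / p) * (A t * \<bar>u' t\<bar> powr p))
      (\<lambda>t. (1 - 1 / p) * (\<bar>u' t\<bar> powr p * a' t + A t * (p' * u' t * \<psi>' t)))" by simp
  have "ac_deriv s \<rho> u u'" using sr by (intro ac_deriv_subinterval[OF ac_u]) auto
  then have 4: "ac_deriv s \<rho> (\<lambda>t. \<Psi> (u t)) (\<lambda>t. \<phi> (u t) * u' t)"
  proof (rule ac_deriv_chain[OF _ \<Psi>])
    show "continuous_on {s..\<rho>} (\<lambda>t. \<phi> (u t))"
      using sr by (intro continuous_on_compose2[OF c\<phi>] continuous_on_subset[OF cu]) auto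
  qed
  define E where "E t = (1 - 1 / p) * (\<bar>u' t\<bar> powr p * a' t + A t * (p' * u' t * \<psi>' t)) + \<phi> (u t) * u' t" for t
  have ac: "ac_deriv s \<rho> energy E"
    unfolding energy_def[abs_def] E_def[abs_def] by (rule ac_deriv_add[OF 3 4])
  \<comment> \<open>Taking the minimum with the bound turns an inequality almost everywhere into one that
    holds at every point.\<close>
  have "AE t in lebesgue. t \<in> {s..\<rho>} \<longrightarrow> E t = min (E t) (\<theta> * (W t - V t))"
    using equation H_bound AE_lebesgue_ne[of \<rho>]
  proof eventually_elim
    case (elim t)
    show ?case
    proof
      assume "t \<in> {s..\<rho>}"
      then have t: "t \<in> {0<..<\<rho>}" using elim(3) sr by auto
      have "(1 - 1 / p) * (A t * (p' * u' t * \<psi>' t)) = ((1 - 1 / p) * p') * (u' t * (A t * \<psi>' t))"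
        by (simp only: mult_ac)
      also have "\<dots> = u' t * (H t - \<phi> (u t) - (v t + (1 - 1 / p) * a' t) * Phi p (u' t))"
        using elim(1) t p'(2) by simp
      also have "\<dots> = H t * u' t - \<phi> (u t) * u' t - (v t + (1 - 1 / p) * a' t) * (Phi p (u' t) * u' t)"
        by (simp only: algebra_simps)
      finally have "E t = H t * u' t - v t * \<bar>u' t\<bar> powr p"
        unfolding E_def Phi_mult_self by (simp only: distrib_left) (simp add: algebra_simps)
      also have "\<dots> \<le> \<theta> * (W t - V t)"
        using elim(2) t unfolding W_def V_def by (simp add: algebra_simps)
      finally show "E t = min (E t) (\<theta> * (W t - V t))" by simp
    qed
  qed
  from ac_deriv_cong[OF ac refl this]
  have ac': "ac_deriv s \<rho> energy (\<lambda>t. min (E t) (\<theta> * (W t - V t)))" .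
  have "energy r - energy s = integral {s..r} (\<lambda>t. min (E t) (\<theta> * (W t - V t)))"
    using sr by (intro ac_deriv_diff[OF ac']) auto
  also have "\<dots> \<le> integral {s..r} (\<lambda>t. \<theta> * (W t - V t))"
  proof (rule Henstock_Kurzweil_Integration.integral_le)
    show "(\<lambda>t. min (E t) (\<theta> * (W t - V t))) integrable_on {s..r}"
      using abs_int_sub(2)[OF ac_deriv_abs_int[OF ac'], of s r] sr by simp
    show "(\<lambda>t. \<theta> * (W t - V t)) integrable_on {s..r}"
      using abs_int_sub(2)[OF W_int, of s r] abs_int_sub(2)[OF V_int, of s r] sr
      by (intro integrable_on_mult_right integrable_diff) auto
  qed simp
  also have "\<dots> = \<theta> * integral {s..r} (\<lambda>t. W t - V t)" by simp
  finally show ?thesis .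
qed

lemma WV_int: "(\<lambda>t. W t - V t) absolutely_integrable_on {0..\<rho>}"
  by (rule set_integral_diff[OF W_int V_int])

text \<open>Let \<open>s\<close> tend to \<open>0\<close> in \<open>energy_decay\<close>; the energy is continuous and vanishes at \<open>0\<close>.\<close>

lemma energy_bound:
  assumes r: "0 < r" "r \<le> \<rho>"
  shows "energy r \<le> \<theta> * integral {0..r} (\<lambda>t. W t - V t)"
proof -
  define m where "m t = energy t - \<theta> * integral {0..t} (\<lambda>t. W t - V t)" for t
  have le: "m r \<le> m s" if s: "0 < s" "s \<le> r" for s
  proof -
    have "integral {0..s} (\<lambda>t. W t - V t) + integral {s..r} (\<lambda>t. W t - V t) = integral {0..r} (\<lambda>t. W t - V t)"
      using s r by (intro Henstock_Kurzweil_Integration.integral_combine abs_int_sub(2)[OF WV_int]) auto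
    then have "\<theta> * integral {0..r} (\<lambda>t. W t - V t) =
        \<theta> * integral {0..s} (\<lambda>t. W t - V t) + \<theta> * integral {s..r} (\<lambda>t. W t - V t)"
      by (metis distrib_left)
    then show ?thesis using energy_decay[OF s r(2)] by (simp add: m_def)
  qed
  have "continuous_on {0..\<rho>} m"
    unfolding m_def[abs_def]
    by (intro continuous_on_diff continuous_on_mult continuous_on_const continuous_energy
        indefinite_integral_continuous_1 abs_int_sub(2)[OF WV_int]) auto
  then have "(m \<longlongrightarrow> m 0) (at 0 within {0..\<rho>})" using \<rho> by (simp add: continuous_on_def)
  then have "(m \<longlongrightarrow> m 0) (at 0 within {0..r})"
    by (rule tendsto_within_subset) (use r in auto)
  then have "(m \<longlongrightarrow> m 0) (at_right 0)" using r by (simp add: at_within_Icc_at_right)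
  moreover have "\<forall>\<^sub>F s in at_right 0. m r \<le> m s"
    using le r by (auto simp: eventually_at_right_field)
  ultimately have "m r \<le> m 0"
    by (rule tendsto_lowerbound) simp
  moreover have "m 0 = 0" using u0 u'0 \<Psi>0 p by (simp add: m_def energy_def)
  ultimately show ?thesis by (simp add: m_def)
qed

lemma P_pos: assumes "0 < t" "t \<le> \<rho>" shows "0 < P t"
proof -
  have i: "(\<lambda>\<sigma>. v \<sigma> powr (- (1 / (p - 1)))) absolutely_integrable_on {0..t}"
    using abs_int_sub(1)[OF v_dual, of 0 t] assms by simp
  have "P t \<ge> 0" unfolding P_def
    by (intro integral_nonneg set_lebesgue_integral_eq_integral[OF i]) simp
  moreover have "P t \<noteq> 0"
  proof
    assume "P t = 0"
    then have "(LINT \<sigma>|lebesgue. indicator {0..t} \<sigma> *\<^sub>R v \<sigma> powr (- (1 / (p - 1)))) = 0"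
      using set_lebesgue_integral_eq_integral(2)[OF i] by (simp add: P_def set_lebesgue_integral_def)
    then have "AE \<sigma> in lebesgue. indicator {0..t} \<sigma> *\<^sub>R v \<sigma> powr (- (1 / (p - 1))) = 0"
      using i by (subst (asm) integral_nonneg_eq_0_iff_AE) (auto simp: set_integrable_def)
    with v_pos have "AE \<sigma> in lebesgue. \<sigma> \<in> {0<..<t} \<longrightarrow> False"
      by eventually_elim (use assms in \<open>auto simp: indicator_def split: if_splits\<close>)
    from AE_Ioo_ex[OF assms(1) this] show False by blast
  qed
  ultimately show ?thesis by simp
qed

lemma V_nonneg: "AE t in lebesgue. t \<in> {0..\<rho>} \<longrightarrow> 0 \<le> V t"
  using v_pos AE_lebesgue_ne[of 0] AE_lebesgue_ne[of \<rho>]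
  by eventually_elim (auto simp: V_def)

text \<open>Hoelder's inequality for \<open>|u(t)| \<le> \<integral>\<^sub>s\<^sup>t v\<^sup>1\<^sup>/\<^sup>p |u'| v\<^sup>-\<^sup>1\<^sup>/\<^sup>p\<close>, obtained from Young's inequality with an
optimal parameter.\<close>

lemma u_Holder:
  assumes sr: "0 \<le> s" "s < r" "r \<le> \<rho>" and us: "u s = 0" and G: "0 < integral {s..r} V"
    and t: "s < t" "t \<le> r"
  shows "\<bar>u t\<bar> powr p \<le> P t powr (p - 1) * integral {s..r} V"
proof -
  define g where "g = integral {s..r} V"
  define p' where "p' = p / (p - 1)"
  have p': "p' > 1" "1 / p + 1 / p' = 1" using p by (auto simp: p'_def field_simps)
  define N where "N = P t powr ((p - 1) / p) * g powr (1 / p)"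
  \<comment> \<open>The parameter for which both terms in Young's inequality are multiples of \<open>N\<close>.\<close>
  define \<mu> where "\<mu> = (P t / g) powr ((p - 1) / p)"
  have Pt: "P t > 0" using P_pos t sr by auto
  have \<mu>: "\<mu> > 0" using Pt G by (simp add: \<mu>_def g_def)
  have \<mu>1: "\<mu> * g = N"
  proof -
    have "\<mu> * g = P t powr ((p - 1) / p) * (g / g powr ((p - 1) / p))"
      using Pt G by (simp add: \<mu>_def g_def powr_divide)
    also have "g / g powr ((p - 1) / p) = g powr (1 - (p - 1) / p)"
      using G by (simp add: g_def powr_diff)
    also have "1 - (p - 1) / p = 1 / p" using p by (simp add: field_simps)
    finally show ?thesis by (simp add: N_def)
  qed
  have \<mu>2: "\<mu> powr (- (1 / (p - 1))) * P t = N"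
  proof -
    have "((p - 1) / p) * (- (1 / (p - 1))) = - (1 / p)" using p by (simp add: field_simps)
    then have "\<mu> powr (- (1 / (p - 1))) * P t = (P t / g) powr (- (1 / p)) * P t"
      by (simp only: \<mu>_def powr_powr)
    also have "\<dots> = g powr (1 / p) * (P t / P t powr (1 / p))"
      using Pt G by (simp add: g_def powr_divide powr_minus divide_simps)
    also have "P t / P t powr (1 / p) = P t powr (1 - 1 / p)" using Pt by (simp add: powr_diff)
    also have "1 - 1 / p = (p - 1) / p" using p by (simp add: field_simps)
    finally show ?thesis by (simp add: N_def)
  qed
  let ?w = "\<lambda>\<sigma>. v \<sigma> powr (- (1 / (p - 1)))"
  have young: "AE \<sigma> in lebesgue. \<sigma> \<in> {s..t} \<longrightarrow> \<bar>u' \<sigma>\<bar> \<le> \<mu> / p * V \<sigma> + \<mu> powr (- (1 / (p - 1))) / p' * ?w \<sigma>"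
    using v_pos AE_lebesgue_ne[of 0] AE_lebesgue_ne[of \<rho>]
  proof eventually_elim
    case (elim \<sigma>)
    show ?case
    proof
      assume "\<sigma> \<in> {s..t}"
      then have vp: "v \<sigma> > 0" using elim sr t by auto
      define x where "x = (\<mu> * v \<sigma>) powr (1 / p)"
      have xp: "x > 0" using vp \<mu> by (simp add: x_def)
      have "\<bar>u' \<sigma>\<bar> = (x * \<bar>u' \<sigma>\<bar>) * (1 / x)" using xp by simp
      also have "\<dots> \<le> (x * \<bar>u' \<sigma>\<bar>) powr p / p + (1 / x) powr p' / p'"
        by (rule Youngs_inequality[OF p p'(1,2)]) (use xp in auto)
      also have "(x * \<bar>u' \<sigma>\<bar>) powr p = \<mu> * V \<sigma>"
        using xp vp \<mu> p by (simp add: powr_mult x_def powr_powr V_def)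
      also have "(1 / x) powr p' = \<mu> powr (- (1 / (p - 1))) * ?w \<sigma>"
      proof -
        have "(1 / x) powr p' = x powr (- p')" using xp by (simp add: powr_divide powr_minus_divide)
        also have "\<dots> = (\<mu> * v \<sigma>) powr (1 / p * (- p'))" by (simp add: x_def powr_powr)
        also have "1 / p * (- p') = - (1 / (p - 1))" using p by (simp add: p'_def)
        finally show ?thesis using vp \<mu> by (simp add: powr_mult)
      qed
      finally show "\<bar>u' \<sigma>\<bar> \<le> \<mu> / p * V \<sigma> + \<mu> powr (- (1 / (p - 1))) / p' * ?w \<sigma>" by simp
    qed
  qed
  have cu't: "continuous_on {s..t} u'" using cu' sr t by (auto intro: continuous_on_subset)
  have Vt: "V absolutely_integrable_on {s..t}" using abs_int_sub(1)[OF V_int, of s t] sr t by simp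
  have wt: "?w absolutely_integrable_on {s..t}" using abs_int_sub(1)[OF v_dual, of s t] sr t by simp
  have Vle: "integral {s..t} V \<le> g"
  proof -
    have "integral {s..t} V + integral {t..r} V = g"
      unfolding g_def using sr t
      by (intro Henstock_Kurzweil_Integration.integral_combine abs_int_sub(2)[OF V_int]) auto
    moreover have "integral {t..r} (\<lambda>_. 0) \<le> integral {t..r} V"
      using V_nonneg sr t by (intro integral_mono_AE_Icc abs_int_sub(1)[OF V_int]) (auto elim!: eventually_mono)
    ultimately show ?thesis by simp
  qed
  have wle: "integral {s..t} ?w \<le> P t"
  proof -
    have "integral {0..s} ?w + integral {s..t} ?w = P t"
      unfolding P_def using sr t
      by (intro Henstock_Kurzweil_Integration.integral_combine abs_int_sub(2)[OF v_dual]) auto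
    moreover have "integral {0..s} (\<lambda>_. 0) \<le> integral {0..s} ?w"
      using sr by (intro integral_mono_AE_Icc abs_int_sub(1)[OF v_dual]) auto
    ultimately show ?thesis by simp
  qed
  have "\<bar>u t\<bar> = \<bar>integral {s..t} u'\<bar>"
    using ac_deriv_diff[OF ac_u, of s t] sr t us by simp
  also have "\<dots> \<le> integral {s..t} (\<lambda>\<sigma>. \<bar>u' \<sigma>\<bar>)"
    using Henstock_Kurzweil_Integration.integral_norm_bound_integral[of u' "{s..t}" "\<lambda>\<sigma>. \<bar>u' \<sigma>\<bar>"]
      integrable_continuous_real[OF cu't] integrable_continuous_real[OF continuous_on_rabs[OF cu't]] by simp
  also have "\<dots> \<le> integral {s..t} (\<lambda>\<sigma>. \<mu> / p * V \<sigma> + \<mu> powr (- (1 / (p - 1))) / p' * ?w \<sigma>)"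
    by (intro integral_mono_AE_Icc young absolutely_integrable_continuous_real continuous_on_rabs cu't
        set_integral_add set_integrable_mult_right Vt wt)
  also have "\<dots> = \<mu> / p * integral {s..t} V + \<mu> powr (- (1 / (p - 1))) / p' * integral {s..t} ?w"
    using Henstock_Kurzweil_Integration.integral_add[OF
        integrable_on_mult_right[OF set_lebesgue_integral_eq_integral(1)[OF Vt], of "\<mu> / p"]
        integrable_on_mult_right[OF set_lebesgue_integral_eq_integral(1)[OF wt], of "\<mu> powr (- (1 / (p - 1))) / p'"]]
    by (simp only: integral_mult_right)
  also have "\<dots> \<le> \<mu> / p * g + \<mu> powr (- (1 / (p - 1))) / p' * P t"
    using Vle wle \<mu> p p' by (intro add_mono mult_left_mono) auto
  also have "\<dots> = N * (1 / p + 1 / p')"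
    using \<mu>1 \<mu>2 by (simp add: distrib_left)
  finally have "\<bar>u t\<bar> \<le> N" using p'(2) by simp
  then have "\<bar>u t\<bar> powr p \<le> N powr p" using p by (intro powr_mono2) auto
  also have "\<dots> = P t powr (p - 1) * g"
    using Pt G p by (simp add: N_def g_def powr_mult powr_powr)
  finally show ?thesis by (simp add: g_def)
qed

text \<open>Young's inequality with the exponents \<open>p/l\<close> and \<open>p/(p-l)\<close> for the factors
\<open>q |u|\<^sup>l v\<^sup>-\<^sup>(\<^sup>p\<^sup>-\<^sup>l\<^sup>)\<^sup>/\<^sup>p\<close> and \<open>v\<^sup>(\<^sup>p\<^sup>-\<^sup>l\<^sup>)\<^sup>/\<^sup>p |u'|\<^sup>p\<^sup>-\<^sup>l\<close>, and then \<open>u_Holder\<close> for \<open>|u|\<^sup>p\<close>.\<close>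

lemma W_Young:
  assumes sr: "0 \<le> s" "s < r" "r \<le> \<rho>" and us: "u s = 0" and G: "0 < integral {s..r} V"
  shows "AE t in lebesgue. t \<in> {s..r} \<longrightarrow> W t \<le> l / p * integral {s..r} V * K t + (p - l) / p * V t"
  using v_pos AE_lebesgue_ne[of s] AE_lebesgue_ne[of \<rho>]
proof eventually_elim
  case (elim t)
  show ?case
  proof
    assume "t \<in> {s..r}"
    then have t: "s < t" "t \<le> r" "t \<in> {0<..<\<rho>}" using elim sr by auto
    then have vp: "v t > 0" using elim by auto
    have qt: "q t \<ge> 0" using q_nonneg t by auto
    define x where "x = q t * \<bar>u t\<bar> powr l * v t powr (- ((p - l) / p))"
    define y where "y = v t powr ((p - l) / p) * \<bar>u' t\<bar> powr (p - l)"
    have "W t = x * y" using vp by (simp add: W_def x_def y_def powr_minus field_simps)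
    also have "\<dots> \<le> x powr (p / l) / (p / l) + y powr (p / (p - l)) / (p / (p - l))"
    proof (rule Youngs_inequality)
      show "1 / (p / l) + 1 / (p / (p - l)) = 1" using p l by (simp add: field_simps)
    qed (use p l qt in \<open>auto simp: x_def y_def\<close>)
    also have "x powr (p / l) = q t powr (p / l) * v t powr (- ((p - l) / l)) * \<bar>u t\<bar> powr p"
    proof -
      have "(l - p) / l = - ((p - l) / l)" by (simp add: diff_divide_distrib)
      then show ?thesis using qt l p by (simp add: x_def powr_mult powr_powr)
    qed
    also have "y powr (p / (p - l)) = V t"
      using vp l p by (simp add: y_def V_def powr_mult powr_powr)
    also have "q t powr (p / l) * v t powr (- ((p - l) / l)) * \<bar>u t\<bar> powr p / (p / l) + V t / (p / (p - l))
        \<le> q t powr (p / l) * v t powr (- ((p - l) / l)) * (P t powr (p - 1) * integral {s..r} V) / (p / l)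
          + V t / (p / (p - l))"
      using u_Holder[OF sr us G t(1,2)] p l
      by (intro add_right_mono divide_right_mono mult_left_mono) auto
    also have "\<dots> = l / p * integral {s..r} V * K t + (p - l) / p * V t"
      by (simp add: K_def mult_ac)
    finally show "W t \<le> l / p * integral {s..r} V * K t + (p - l) / p * V t" .
  qed
qed

text \<open>If \<open>G = \<integral>\<^sub>s\<^sup>r V\<close> were positive, \<open>W_Young\<close> would give \<open>\<integral>\<^sub>s\<^sup>r W < (l/p) G + ((p-l)/p) G = G\<close>, whereas
the energy bound says \<open>G \<le> \<integral>\<^sub>s\<^sup>r W\<close>.\<close>

lemma vanishing_step:
  assumes sr: "0 \<le> s" "s < r" "r \<le> \<rho>" and us: "\<And>t. t \<in> {0..s} \<Longrightarrow> u t = 0"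
    and small: "integral {s..r} K < 1"
  shows "\<forall>t\<in>{0..r}. u t = 0"
proof -
  define G where "G = integral {s..r} V"
  have Wi: "W integrable_on {s..r}" and Vi: "V absolutely_integrable_on {s..r}" "V integrable_on {s..r}"
    and Ki: "K integrable_on {s..r}" and Wa: "W absolutely_integrable_on {s..r}"
    and Ka: "K absolutely_integrable_on {s..r}"
    using abs_int_sub[OF W_int, of s r] abs_int_sub[OF V_int, of s r] abs_int_sub[OF K_int, of s r] sr by auto
  have "integral {0..s} (\<lambda>t. W t - V t) = integral {0..s} (\<lambda>t. 0)"
  proof (rule integral_spike[of "{s}"])
    fix t assume t: "t \<in> {0..s} - {s}"
    have "u' t = 0"
    proof (cases "t = 0")
      case False
      have "DERIV u t :> 0"
        by (rule has_field_derivative_transform_within_open[of "\<lambda>_. 0" _ _ "{0<..<s}"])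
           (use False t us in auto)
      moreover have "DERIV u t :> u' t" using u t sr by auto
      ultimately show ?thesis by (rule DERIV_unique[symmetric])
    qed (simp add: u'0)
    then show "0 = W t - V t" using l p by (simp add: W_def V_def)
  qed simp
  then have "integral {0..r} (\<lambda>t. W t - V t) = integral {s..r} (\<lambda>t. W t - V t)"
    using Henstock_Kurzweil_Integration.integral_combine[of 0 s r "\<lambda>t. W t - V t"]
      abs_int_sub(2)[OF WV_int, of 0 r] sr by simp
  also have "\<dots> = integral {s..r} W - G"
    unfolding G_def by (rule Henstock_Kurzweil_Integration.integral_diff[OF Wi Vi(2)])
  finally have "0 \<le> \<theta> * (integral {s..r} W - G)"
    using energy_bound[of r] energy_nonneg[of r] sr by simp
  then have WG: "G \<le> integral {s..r} W" using \<theta> by (simp add: zero_le_mult_iff)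
  have "integral {s..r} (\<lambda>t. 0) \<le> G"
    unfolding G_def using V_nonneg sr
    by (intro integral_mono_AE_Icc Vi) (auto elim!: eventually_mono)
  then have G_nn: "0 \<le> G" by simp
  have "\<not> 0 < G"
  proof
    assume Gp: "0 < G"
    have "integral {s..r} W \<le> integral {s..r} (\<lambda>t. l / p * G * K t + (p - l) / p * V t)"
      unfolding G_def using W_Young[OF sr us] Gp sr
      by (intro integral_mono_AE_Icc Wa set_integral_add set_integrable_mult_right Ka Vi) (auto simp: G_def)
    also have "\<dots> = l / p * G * integral {s..r} K + (p - l) / p * G"
      unfolding G_def
      using Henstock_Kurzweil_Integration.integral_add[OF
        integrable_on_mult_right[OF Ki, of "l / p * integral {s..r} V"]
        integrable_on_mult_right[OF Vi(2), of "(p - l) / p"]]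
      by (simp only: integral_mult_right)
    also have "\<dots> < l / p * G * 1 + (p - l) / p * G"
      using small Gp l p by (intro add_strict_right_mono mult_strict_left_mono) auto
    also have "\<dots> = G" using p by (simp add: field_simps)
    finally show False using WG by simp
  qed
  then have "G = 0" using G_nn by simp
  then have "(LINT t|lebesgue. indicator {s..r} t *\<^sub>R V t) = 0"
    using set_lebesgue_integral_eq_integral(2)[OF Vi(1)] by (simp add: G_def set_lebesgue_integral_def)
  moreover have "AE t in lebesgue. 0 \<le> indicator {s..r} t *\<^sub>R V t"
    using V_nonneg by eventually_elim (use sr in \<open>auto simp: indicator_def\<close>)
  ultimately have "AE t in lebesgue. indicator {s..r} t *\<^sub>R V t = 0"
    using Vi(1) by (subst (asm) integral_nonneg_eq_0_iff_AE) (auto simp: set_integrable_def)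
  then have "AE t in lebesgue. t \<in> {s..r} \<longrightarrow> u' t = 0"
    using v_pos AE_lebesgue_ne[of 0] AE_lebesgue_ne[of \<rho>]
    by eventually_elim (use sr in \<open>auto simp: V_def indicator_def split: if_splits\<close>)
  then have "ac_deriv s r u (\<lambda>_. 0)"
    using sr by (intro ac_deriv_cong[OF ac_deriv_subinterval[OF ac_u]]) auto
  then have "u t = u s" if "t \<in> {s..r}" for t
    using ac_deriv_diff[of s r u "\<lambda>_. 0" s t] that by simp
  then show ?thesis using us sr by (metis atLeastAtMost_iff linear order_refl)
qed

text \<open>The integral of \<open>K\<close> is uniformly continuous in its upper end, so \<open>vanishing_step\<close> applies with steps of
one length.\<close>

theorem profile_vanishes: "t \<in> {0..\<rho>} \<Longrightarrow> u t = 0"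
proof -
  have "continuous_on {0..\<rho>} (\<lambda>t. integral {0..t} K)"
    using abs_int_sub(2)[OF K_int] by (intro indefinite_integral_continuous_1) auto
  from uniform_oscillation[OF this, of "1 / 2"]
  obtain d where d: "d > 0" "\<And>x y t s. 0 \<le> x \<Longrightarrow> y \<le> \<rho> \<Longrightarrow> y - x < d \<Longrightarrow> t \<in> {x..y} \<Longrightarrow> s \<in> {x..y} \<Longrightarrow>
      \<bar>integral {0..t} K - integral {0..s} K\<bar> \<le> 1 / 2" by force
  have "\<forall>t\<in>{0..min \<rho> (real n * (d / 2))}. u t = 0" for n
  proof (induction n)
    case 0
    then show ?case using u0 \<rho> by auto
  next
    case (Suc n)
    define s where "s = min \<rho> (real n * (d / 2))"
    define r where "r = min \<rho> (real (Suc n) * (d / 2))"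
    have Suc_eq: "real (Suc n) * (d / 2) = real n * (d / 2) + d / 2" by (simp add: algebra_simps)
    have sr: "0 \<le> s" "s \<le> r" "r \<le> \<rho>" "r - s < d"
      using d(1) \<rho> unfolding s_def r_def Suc_eq by auto
    show ?case
    proof (cases "s = r")
      case False
      then have "s < r" using sr by simp
      have "integral {0..s} K + integral {s..r} K = integral {0..r} K"
        using sr by (intro Henstock_Kurzweil_Integration.integral_combine abs_int_sub(2)[OF K_int]) auto
      moreover have "\<bar>integral {0..r} K - integral {0..s} K\<bar> \<le> 1 / 2" using sr by (intro d(2)[of s r]) auto
      ultimately have "integral {s..r} K < 1" by linarith
      then have "\<forall>t\<in>{0..r}. u t = 0"
        using Suc \<open>s < r\<close> sr unfolding s_def[symmetric] by (intro vanishing_step) auto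
      then show ?thesis unfolding r_def .
    qed (use Suc in \<open>simp only: s_def[symmetric] r_def[symmetric]\<close>)
  qed
  moreover assume t: "t \<in> {0..\<rho>}"
  moreover obtain n where "t / (d / 2) < real n" using reals_Archimedean2 by blast
  then have "t \<le> real n * (d / 2)" using d(1) by (simp add: field_simps)
  ultimately show ?thesis by auto
qed

end

section \<open>Integrability and almost everywhere identities\<close>

text \<open>For nonnegative integrands the extended integrals in \<open>K_const\<close> are ordinary integrals once they are
finite.\<close>

lemma K_const_finite_imp:
  assumes p: "1 < p" and l: "0 < l" "l < p"
    and q: "q absolutely_integrable_on {0..\<rho>}" and v: "v absolutely_integrable_on {0..\<rho>}"
    and w: "(\<lambda>t. v t powr (- (1 / (p - 1)))) absolutely_integrable_on {0..\<rho>}"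
    and K: "K_const p l 0 \<rho> q v < \<infinity>"
  shows "(\<lambda>t. q t powr (p / l) * v t powr (- ((p - l) / l)) *
      integral {0..t} (\<lambda>\<sigma>. v \<sigma> powr (- (1 / (p - 1)))) powr (p - 1)) absolutely_integrable_on {0..\<rho>}"
    (is "?K absolutely_integrable_on _")
proof -
  let ?w = "\<lambda>\<sigma>. v \<sigma> powr (- (1 / (p - 1)))"
  let ?P = "\<lambda>t. integral {0..t} ?w"
  have P: "(\<integral>\<^sup>+\<sigma>\<in>{0<..<t}. ennreal (?w \<sigma>) \<partial>lebesgue) = ennreal (?P t)" if "t \<in> {0..\<rho>}" for t
  proof -
    have i: "?w absolutely_integrable_on {0<..<t}"
      using abs_int_sub(1)[OF w, of 0 t] that by (simp add: absolutely_integrable_on_Icc_iff_Ioo)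
    have "(\<integral>\<^sup>+\<sigma>\<in>{0<..<t}. ennreal (?w \<sigma>) \<partial>lebesgue) = (\<integral>\<^sup>+\<sigma>. ennreal (indicator {0<..<t} \<sigma> *\<^sub>R ?w \<sigma>) \<partial>lebesgue)"
      by (intro nn_integral_cong) (auto simp: indicator_def)
    also have "\<dots> = ennreal (LINT \<sigma>|lebesgue. indicator {0<..<t} \<sigma> *\<^sub>R ?w \<sigma>)"
      using i unfolding set_integrable_def by (rule nn_integral_eq_integral) auto
    also have "(LINT \<sigma>|lebesgue. indicator {0<..<t} \<sigma> *\<^sub>R ?w \<sigma>) = ?P t"
      using set_lebesgue_integral_eq_integral(2)[OF i]
      by (simp add: set_lebesgue_integral_def integral_open_interval_real)
    finally show ?thesis .
  qed
  define I where "I = (\<integral>\<^sup>+t\<in>{0<..<\<rho>}. ennreal (q t powr (p / l) * v t powr (- ((p - l) / l))) *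
      ennreal_pow (\<integral>\<^sup>+\<sigma>\<in>{0<..<t}. ennreal (?w \<sigma>) \<partial>lebesgue) (p - 1) \<partial>lebesgue)"
  have P_nn: "?P t \<ge> 0" if "t \<in> {0..\<rho>}" for t
    using abs_int_sub(2)[OF w, of 0 t] that by (intro integral_nonneg) auto
  have "I = (\<integral>\<^sup>+t. ennreal (norm (indicator {0<..<\<rho>} t *\<^sub>R ?K t)) \<partial>lebesgue)"
    unfolding I_def
  proof (rule nn_integral_cong)
    fix t :: real
    show "ennreal (q t powr (p / l) * v t powr (- ((p - l) / l))) *
      ennreal_pow (\<integral>\<^sup>+\<sigma>\<in>{0<..<t}. ennreal (?w \<sigma>) \<partial>lebesgue) (p - 1) * indicator {0<..<\<rho>} t =
      ennreal (norm (indicator {0<..<\<rho>} t *\<^sub>R ?K t))"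
    proof (cases "t \<in> {0<..<\<rho>}")
      case True
      then have "t \<in> {0..\<rho>}" by auto
      then show ?thesis
        unfolding P[OF \<open>t \<in> {0..\<rho>}\<close>] using True P_nn[of t]
        by (simp add: ennreal_pow_def ennreal_mult abs_mult)
    qed simp
  qed
  moreover have "I < \<infinity>"
  proof -
    have "ennreal (((p - l) / p) powr ((p - l) / p)) * ennreal_pow I (l / p) < \<infinity>"
      using K unfolding K_const_def I_def .
    moreover have "ennreal (((p - l) / p) powr ((p - l) / p)) \<noteq> 0" using p l by (simp add: ennreal_eq_0_iff)
    ultimately have "ennreal_pow I (l / p) \<noteq> \<infinity>" by (auto simp: ennreal_mult_eq_top_iff)
    then show ?thesis by (auto simp: ennreal_pow_def less_top split: if_splits)
  qed
  moreover have "(\<lambda>t. indicator {0<..<\<rho>} t *\<^sub>R ?K t) \<in> borel_measurable lebesgue"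
  proof -
    have m: "f \<in> borel_measurable (lebesgue_on {0<..<\<rho>})" if "f absolutely_integrable_on {0..\<rho>}" for f :: "real \<Rightarrow> real"
      using that by (intro absolutely_integrable_imp_borel_measurable)
        (simp_all add: absolutely_integrable_on_Icc_iff_Ioo)
    have "continuous_on {0..\<rho>} ?P"
      using abs_int_sub(2)[OF w] by (intro indefinite_integral_continuous_1) auto
    then have "?P \<in> borel_measurable (lebesgue_on {0<..<\<rho>})"
      by (intro m absolutely_integrable_continuous_real)
    then have "?K \<in> borel_measurable (lebesgue_on {0<..<\<rho>})"
      using m[OF q] m[OF v] by measurable
    then show ?thesis by (subst (asm) borel_measurable_restrict_space_iff) auto
  qed
  ultimately have "?K absolutely_integrable_on {0<..<\<rho>}"
    unfolding set_integrable_def by (intro integrableI_bounded) auto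
  then show ?thesis by (simp add: absolutely_integrable_on_Icc_iff_Ioo)
qed

lemma smooth_bump_continuous: "smooth_bump U \<eta> \<Longrightarrow> continuous_on S \<eta>"
  by (auto simp: smooth_bump_def intro: smooth_gen_continuous)

lemma smooth_bump_mult_integrable:
  fixes f :: "'a::euclidean_space \<Rightarrow> real"
  assumes \<eta>: "smooth_bump U \<eta>" and f: "loc_integrable U f"
  shows "integrable lebesgue (\<lambda>x. indicator U x *\<^sub>R (f x * \<eta> x))"
proof -
  obtain K where K: "compact K" "K \<subseteq> U" "\<And>x. x \<notin> K \<Longrightarrow> \<eta> x = 0"
    using \<eta> by (auto simp: smooth_bump_def)
  have fK: "integrable lebesgue (\<lambda>x. indicator K x *\<^sub>R f x)"
    using f K by (auto simp: loc_integrable_def set_integrable_def)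
  have "bounded (\<eta> ` K)"
    using K(1) smooth_bump_continuous[OF \<eta>] by (intro compact_imp_bounded compact_continuous_image)
  then obtain B where B: "\<And>x. x \<in> K \<Longrightarrow> \<bar>\<eta> x\<bar> \<le> B" by (auto simp: bounded_iff)
  have \<eta>m: "\<eta> \<in> borel_measurable lebesgue"
    using smooth_bump_continuous[OF \<eta>] by (intro measurable_completion) (simp add: borel_measurable_continuous_onI)
  have "integrable lebesgue (\<lambda>x. (indicator K x *\<^sub>R f x) * \<eta> x)"
  proof (rule Bochner_Integration.integrable_bound)
    show "integrable lebesgue (\<lambda>x. B * (indicator K x *\<^sub>R f x))" using fK by (rule integrable_mult_right)
    show "(\<lambda>x. (indicator K x *\<^sub>R f x) * \<eta> x) \<in> borel_measurable lebesgue"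
      using fK \<eta>m by (intro borel_measurable_times) auto
    show "AE x in lebesgue. norm ((indicator K x *\<^sub>R f x) * \<eta> x) \<le> norm (B * (indicator K x *\<^sub>R f x))"
    proof (rule AE_I2)
      fix x
      show "norm ((indicator K x *\<^sub>R f x) * \<eta> x) \<le> norm (B * (indicator K x *\<^sub>R f x))"
        using B[of x] by (cases "x \<in> K") (auto simp: abs_mult mult.commute[of "\<bar>f x\<bar>"] intro!: mult_right_mono)
    qed
  qed
  moreover have "(\<lambda>x. (indicator K x *\<^sub>R f x) * \<eta> x) = (\<lambda>x. indicator U x *\<^sub>R (f x * \<eta> x))"
    using K by (auto simp: fun_eq_iff indicator_def)
  ultimately show ?thesis by simp
qed

lemma loc_integrable_diff:
  fixes f g :: "'a::euclidean_space \<Rightarrow> real"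
  shows "loc_integrable U f \<Longrightarrow> loc_integrable U g \<Longrightarrow> loc_integrable U (\<lambda>x. f x - g x)"
  by (auto simp: loc_integrable_def)

lemma bump_integral_diff:
  fixes f g :: "'a::euclidean_space \<Rightarrow> real"
  assumes "smooth_bump U \<eta>" "loc_integrable U f" "loc_integrable U g"
  shows "(LINT x:U|lebesgue. (f x - g x) * \<eta> x) = (LINT x:U|lebesgue. f x * \<eta> x) - (LINT x:U|lebesgue. g x * \<eta> x)"
proof -
  have "(LINT x:U|lebesgue. (f x - g x) * \<eta> x) = (LINT x:U|lebesgue. f x * \<eta> x - g x * \<eta> x)"
    by (simp add: left_diff_distrib)
  also have "\<dots> = (LINT x:U|lebesgue. f x * \<eta> x) - (LINT x:U|lebesgue. g x * \<eta> x)"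
    using smooth_bump_mult_integrable[OF assms(1)] assms(2,3)
    by (intro set_integral_diff) (auto simp: set_integrable_def)
  finally show ?thesis .
qed

lemma smooth_bump_grad_measurable:
  fixes F :: "'a::euclidean_space \<Rightarrow> 'a"
  assumes \<eta>: "smooth_bump U \<eta>" and F: "loc_integrable U F"
  shows "(\<lambda>x. indicator U x *\<^sub>R (F x \<bullet> grad \<eta> x)) \<in> borel_measurable lebesgue"
proof -
  obtain K where K: "compact K" "K \<subseteq> U" "\<And>x. x \<notin> K \<Longrightarrow> \<eta> x = 0"
    using \<eta> by (auto simp: smooth_bump_def)
  have g0: "grad \<eta> x = 0" if "x \<notin> K" for x
  proof (rule grad_eqI)
    have "((\<lambda>_. 0) has_derivative (\<lambda>h. 0)) (at x)" by simp
    then have "(\<eta> has_derivative (\<lambda>h. 0)) (at x)"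
      by (rule has_derivative_transform_within_open[of _ _ _ _ "- K"])
         (use that K in \<open>auto simp: open_Compl compact_imp_closed\<close>)
    then show "GDERIV \<eta> x :> 0" by (simp add: gderiv_def)
  qed
  have FK: "(\<lambda>x. indicator K x *\<^sub>R F x) \<in> borel_measurable lebesgue"
    using F K by (auto simp: loc_integrable_def set_integrable_def)
  have "grad \<eta> \<in> borel_measurable lebesgue"
  proof (subst borel_measurable_euclidean_space, rule ballI)
    fix b :: 'a
    have "smooth_gen (\<lambda>x. grad \<eta> x \<bullet> b)" using \<eta> smooth_gen_grad by (auto simp: smooth_bump_def)
    then show "(\<lambda>x. grad \<eta> x \<bullet> b) \<in> borel_measurable lebesgue"
      by (intro measurable_completion) (simp add: borel_measurable_continuous_onI smooth_gen_continuous)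
  qed
  with FK have "(\<lambda>x. (indicator K x *\<^sub>R F x) \<bullet> grad \<eta> x) \<in> borel_measurable lebesgue"
    by (rule borel_measurable_inner)
  moreover have "(\<lambda>x. (indicator K x *\<^sub>R F x) \<bullet> grad \<eta> x) = (\<lambda>x. indicator U x *\<^sub>R (F x \<bullet> grad \<eta> x))"
    using K g0 by (auto simp: fun_eq_iff indicator_def)
  ultimately show ?thesis by simp
qed

lemma LINT_cong_AE:
  fixes f g :: "'a::euclidean_space \<Rightarrow> real"
  assumes "(\<lambda>x. indicator U x *\<^sub>R f x) \<in> borel_measurable lebesgue" "AE x in lebesgue. x \<in> U \<longrightarrow> f x = g x"
  shows "(LINT x:U|lebesgue. f x) = (LINT x:U|lebesgue. g x)"
proof -
  have eq: "AE x in lebesgue. indicator U x *\<^sub>R f x = indicator U x *\<^sub>R g x"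
    using assms(2) by eventually_elim (auto simp: indicator_def)
  show ?thesis
    unfolding set_lebesgue_integral_def
    using borel_measurable_AE[OF assms(1) eq] by (rule integral_cong_AE[OF assms(1) _ eq])
qed

text \<open>In a shell away from the origin, local integrability of a radial function becomes local
integrability of its profile.\<close>

lemma radial_profile_integrable:
  fixes f :: "'a::euclidean_space \<Rightarrow> real" and g :: "real \<Rightarrow> real"
  assumes sr: "0 < s" "r < R" and f: "loc_integrable (ball 0 R) f"
    and g: "g \<in> borel_measurable (lebesgue_on {s..r})"
    and eq: "AE x in lebesgue. x \<in> ball 0 R \<longrightarrow> f x = g (norm x)"
  shows "(\<lambda>t. t ^ (DIM('a) - 1) * g t) absolutely_integrable_on {s..r}"
proof -
  define k where "k t = indicator {s..r} t * g t" for t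
  have km: "k \<in> borel_measurable lebesgue"
    using g unfolding k_def[abs_def] by (subst (asm) borel_measurable_restrict_space_iff) auto
  \<comment> \<open>A compact shell, on which \<open>f\<close> is integrable.\<close>
  define C where "C = cball 0 r - ball (0::'a) s"
  have "compact C" unfolding C_def by (intro compact_diff) auto
  moreover have "C \<subseteq> ball 0 R" using sr by (auto simp: C_def)
  ultimately have fC: "integrable lebesgue (\<lambda>x. indicator C x *\<^sub>R f x)"
    using f by (auto simp: loc_integrable_def set_integrable_def)
  have "AE x in lebesgue. indicator C x *\<^sub>R f x = k (norm x)"
    using eq by eventually_elim (use sr in \<open>auto simp: C_def k_def indicator_def\<close>)
  from integrable_cong_AE[OF borel_measurable_integrable[OF fC] borel_measurable_compose_norm[OF km] this] fC
  have "integrable lebesgue (\<lambda>x::'a. k (norm x))" by simp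
  then have "integrable lebesgue (\<lambda>t. indicator {0<..} t * (t ^ (DIM('a) - 1) * k t))"
    by (subst (asm) integrable_norm_iff[OF km])
  moreover have "(\<lambda>t. indicator {0<..} t * (t ^ (DIM('a) - 1) * k t)) =
      (\<lambda>t. indicator {s..r} t *\<^sub>R (t ^ (DIM('a) - 1) * g t))"
    using sr by (auto simp: fun_eq_iff indicator_def k_def)
  ultimately show ?thesis by (simp add: set_integrable_def)
qed

lemma AE_nonneg_imp_nonneg:
  fixes f :: "'a::euclidean_space \<Rightarrow> real"
  assumes U: "open U" and f: "continuous_on U f" and ae: "AE x in lebesgue. x \<in> U \<longrightarrow> 0 \<le> f x"
  shows "x \<in> U \<Longrightarrow> 0 \<le> f x"
proof (rule ccontr)
  assume x: "x \<in> U" "\<not> 0 \<le> f x"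
  define N where "N = {x \<in> U. f x < 0}"
  have "open N"
  proof -
    have "N = U \<inter> f -` {..<0}" by (auto simp: N_def)
    then show ?thesis using continuous_open_preimage[OF f U, of "{..<0}"] by simp
  qed
  moreover have "negligible N"
  proof -
    have "AE x in lebesgue. x \<notin> N" using ae by eventually_elim (auto simp: N_def)
    moreover have "N \<in> sets lebesgue" using \<open>open N\<close> by simp
    ultimately show ?thesis
      unfolding negligible_iff_null_sets by (subst (asm) AE_iff_null_sets[symmetric]) auto
  qed
  ultimately have "N = {}" using open_not_negligible by blast
  then show False using x by (auto simp: N_def)
qed

text \<open>Integration by parts against a bump: the boundary terms carry the factor \<open>0\<close>.\<close>

lemma ac_deriv_zero_imp_AE_zero:
  assumes "ac_deriv s r (\<lambda>_. 0) f"
  shows "AE t in lebesgue. t \<in> {s<..<r} \<longrightarrow> f t = 0"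
proof (cases "s < r")
  case True
  have fi: "f absolutely_integrable_on {s..r}" by (rule ac_deriv_abs_int[OF assms])
  show ?thesis
  proof (rule fundamental_lemma)
    show "loc_integrable {s<..<r} f"
      using fi by (intro abs_int_imp_loc_integrable) (simp flip: absolutely_integrable_on_Icc_iff_Ioo)
    fix \<eta> assume \<eta>: "smooth_bump {s<..<r} \<eta>"
    have sm: "smooth_gen \<eta>" using \<eta> by (simp add: smooth_bump_def)
    have "smooth_gen (\<lambda>x. grad \<eta> x \<bullet> 1)" using smooth_gen_grad[OF sm] by blast
    then have "continuous_on {s..r} (grad \<eta>)" using smooth_gen_continuous by force
    moreover have "DERIV \<eta> t :> grad \<eta> t" for t using smooth_gen_grad[OF sm] by (metis gderiv_deriv)
    ultimately have "ac_deriv s r \<eta> (grad \<eta>)" by (intro ac_deriv_C1)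
    from ac_deriv_mult[OF assms this] have "ac_deriv s r (\<lambda>x. 0) (\<lambda>t. \<eta> t * f t)" by simp
    from ac_deriv_diff[OF this, of s r] True have "integral {s..r} (\<lambda>t. \<eta> t * f t) = 0" by simp
    then show "(LINT t:{s<..<r}|lebesgue. \<eta> t * f t) = 0"
      using absolutely_integrable_continuous_mult[OF smooth_bump_continuous[OF \<eta>] fi] by (simp add: LINT_Ioo)
  qed simp
qed simp

section \<open>The differential equation of the profile\<close>

text \<open>A radial function with its profile \<open>u\<close>, as provided by \<open>radial_C1_profile\<close>.\<close>

locale radial_profile =
  fixes R p :: real and \<phi> u u' :: "real \<Rightarrow> real" and h :: "real \<Rightarrow> real \<Rightarrow> real \<Rightarrow> real"
    and w :: "'a::euclidean_space \<Rightarrow> real"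
  assumes R: "0 < R" and p: "1 < p"
    and wu: "\<And>x. x \<in> ball 0 R \<Longrightarrow> w x = u (norm x)"
    and du: "\<And>t. \<bar>t\<bar> < R \<Longrightarrow> DERIV u t :> u' t" and cu': "continuous_on {-R<..<R} u'"
    and u'0: "u' 0 = 0"
    and gw: "\<And>x. x \<in> ball 0 R \<Longrightarrow> grad w x = u' (norm x) *\<^sub>R sgn x"
    and c\<phi>: "continuous_on UNIV \<phi>" and h: "caratheodory R h"
begin

definition "rhs t = h t (u t) (u' t) - \<phi> (u t)"

lemma cu: "continuous_on {-R<..<R} u"
  using du by (intro DERIV_continuous_on[of _ _ u']) (auto intro: has_field_derivative_at_within du)

lemma AE_rhs: "AE x in lebesgue. x \<in> ball 0 R \<longrightarrow> lower_order h w x - \<phi> (w x) = rhs (norm x)"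
proof -
  have "AE x in lebesgue. x \<noteq> (0::'a)" by (rule AE_completion[OF AE_lborel_singleton])
  then show ?thesis
  proof eventually_elim
    case (elim x)
    show ?case
    proof
      assume x: "x \<in> ball 0 R"
      have "grad w x \<bullet> (x /\<^sub>R norm x) = u' (norm x) * (sgn x \<bullet> sgn x)"
        unfolding gw[OF x] by (simp add: sgn_div_norm)
      also have "sgn x \<bullet> sgn x = 1" using elim by (simp add: dot_square_norm norm_sgn)
      finally show "lower_order h w x - \<phi> (w x) = rhs (norm x)"
        using wu[OF x] by (simp add: lower_order_def rhs_def)
    qed
  qed
qed

lemma rhs_measurable:
  assumes "0 < s" "r < R" shows "rhs \<in> borel_measurable (lebesgue_on {s..r})"
proof -
  have c: "f \<in> borel_measurable (lebesgue_on {0<..<R})" if "continuous_on {-R<..<R} f" for f :: "real \<Rightarrow> real"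
    using R by (intro continuous_imp_measurable_on_sets_lebesgue continuous_on_subset[OF that]) auto
  have "continuous_on {-R<..<R} (\<lambda>t. \<phi> (u t))" by (rule continuous_on_compose2[OF c\<phi> cu]) auto
  then have "rhs \<in> borel_measurable (lebesgue_on {0<..<R})"
    unfolding rhs_def[abs_def]
    by (intro borel_measurable_diff caratheodory_compose[OF h] c cu cu')
  then show ?thesis by (rule measurable_restrict_mono) (use assms in auto)
qed

lemma Phi_grad:
  assumes "x \<in> ball 0 R" shows "Phi p (grad w x) = Phi p (u' (norm x)) *\<^sub>R sgn x"
proof (cases "x = 0")
  case False
  then show ?thesis unfolding gw[OF assms] by (simp add: Phi_def norm_sgn)
next
  case True
  then show ?thesis using gw[OF assms] by (simp add: Phi_def)
qed

lemma continuous_Phi_u': "0 < s \<Longrightarrow> r < R \<Longrightarrow> continuous_on {s..r} (\<lambda>t. Phi p (u' t))"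
  by (intro continuous_on_Phi continuous_on_subset[OF cu'] p) auto

text \<open>A priori the weak divergence \<open>g\<close> need not be radial. But \<open>a g = h - \<phi>\<close> holds almost everywhere, and
\<open>a > 0\<close>, so \<open>g\<close> agrees with a radial function.\<close>

lemma nondivergence_profile:
  assumes sol: "solves_nondiv R p a h \<phi> w"
    and a: "\<And>r. 0 < r \<Longrightarrow> r < R \<Longrightarrow> a absolutely_integrable_on {0..r}"
    and a_pos: "AE t in lebesgue. t \<in> {0<..<R} \<longrightarrow> 0 < a t"
    and sr: "0 < s" "r < R"
  shows "ac_deriv s r (\<lambda>t. t ^ (DIM('a) - 1) * Phi p (u' t)) (\<lambda>t. t ^ (DIM('a) - 1) * (rhs t / a t))"
proof -
  obtain g where div: "weak_div (ball 0 R) (\<lambda>x. Phi p (grad w x)) g"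
    and ag: "loc_integrable (ball 0 R) (\<lambda>x. a (norm x) * g x)"
    and low: "loc_integrable (ball 0 R) (lower_order h w)"
    and ph: "loc_integrable (ball 0 R) (\<lambda>x. \<phi> (w x))"
    and eq: "\<And>\<eta>. test_function (ball 0 R) \<eta> \<Longrightarrow> - (LINT x:ball 0 R|lebesgue. a (norm x) * g x * \<eta> x)
        + (LINT x:ball 0 R|lebesgue. lower_order h w x * \<eta> x) = (LINT x:ball 0 R|lebesgue. \<phi> (w x) * \<eta> x)"
    using sol unfolding solves_nondiv_def by blast
  have gi: "loc_integrable (ball 0 R) g" using div by (simp add: weak_div_def)
  define f where "f x = lower_order h w x - \<phi> (w x)" for x
  have fi: "loc_integrable (ball 0 R) f" unfolding f_def by (rule loc_integrable_diff[OF low ph])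
  have "AE x in lebesgue. x \<in> ball 0 R \<longrightarrow> a (norm x) * g x - f x = 0"
  proof (rule fundamental_lemma[OF open_ball loc_integrable_diff[OF ag fi]])
    fix \<eta> :: "'a \<Rightarrow> real" assume \<eta>: "smooth_bump (ball 0 R) \<eta>"
    have "(LINT x:ball 0 R|lebesgue. f x * \<eta> x) = (LINT x:ball 0 R|lebesgue. a (norm x) * g x * \<eta> x)"
      unfolding f_def bump_integral_diff[OF \<eta> low ph] using eq[OF smooth_bump_test_function[OF \<eta>]] by simp
    then show "(LINT x:ball 0 R|lebesgue. \<eta> x * (a (norm x) * g x - f x)) = 0"
      using bump_integral_diff[OF \<eta> ag fi] by (simp add: mult.commute)
  qed
  moreover have "AE x in lebesgue. norm (x::'a) \<in> {0<..<R} \<longrightarrow> 0 < a (norm x)"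
    using a_pos by (intro AE_norm) (auto elim!: eventually_mono)
  moreover have "AE x in lebesgue. x \<noteq> (0::'a)" by (rule AE_completion[OF AE_lborel_singleton])
  ultimately have gG: "AE x in lebesgue. x \<in> ball 0 R \<longrightarrow> g x = rhs (norm x) / a (norm x)"
    using AE_rhs by eventually_elim (auto simp: f_def field_simps)
  show ?thesis
  proof (cases "s < r")
    case True
    have am: "a \<in> borel_measurable (lebesgue_on {s..r})"
      using sr True by (intro absolutely_integrable_imp_borel_measurable abs_int_sub(1)[OF a[of r]]) auto
    show ?thesis
    proof (rule radial_weak_imp_ac_deriv[where 'a = 'a, OF continuous_Phi_u'[OF sr] sr])
      show "(\<lambda>t. t ^ (DIM('a) - 1) * (rhs t / a t)) absolutely_integrable_on {s..r}"
        by (rule radial_profile_integrable[OF sr gi _ gG])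
           (intro borel_measurable_divide rhs_measurable sr am)
      fix \<eta> :: "'a \<Rightarrow> real" assume \<eta>: "smooth_bump (ball 0 R) \<eta>"
      have "(LINT x:ball 0 R|lebesgue. (Phi p (u' (norm x)) *\<^sub>R sgn x) \<bullet> grad \<eta> x) =
          (LINT x:ball 0 R|lebesgue. Phi p (grad w x) \<bullet> grad \<eta> x)"
        by (rule set_lebesgue_integral_cong) (auto simp: Phi_grad)
      also have "\<dots> = - (LINT x:ball 0 R|lebesgue. g x * \<eta> x)"
        using div smooth_bump_test_function[OF \<eta>] by (simp add: weak_div_def)
      also have "(LINT x:ball 0 R|lebesgue. g x * \<eta> x) = (LINT x:ball 0 R|lebesgue. rhs (norm x) / a (norm x) * \<eta> x)"
        using smooth_bump_mult_integrable[OF \<eta> gi] gG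
        by (intro LINT_cong_AE borel_measurable_integrable) (auto elim!: eventually_mono)
      finally show "(LINT x:ball 0 R|lebesgue. (Phi p (u' (norm x)) *\<^sub>R sgn x) \<bullet> grad \<eta> x) =
          - (LINT x:ball 0 R|lebesgue. rhs (norm x) / a (norm x) * \<eta> x)" .
    qed
  next
    case False
    then have "{s..r} \<subseteq> {s}" by auto
    then have "negligible {s..r}" using negligible_subset by blast
    then show ?thesis using \<open>{s..r} \<subseteq> {s}\<close>
      by (intro ac_derivI absolutely_integrable_negligible) auto
  qed
qed

text \<open>\<open>A\<close> may differ from \<open>a\<close> on a null set, which allows a representative that makes the flux continuous.\<close>

lemma divergence_profile:
  assumes sol: "solves_div R p a h \<phi> w"
    and A: "AE t in lebesgue. t \<in> {0<..<R} \<longrightarrow> A t = a t"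
    and sr: "0 < s" "r < R" and cA: "continuous_on {s..r} (\<lambda>t. A t * Phi p (u' t))"
  shows "ac_deriv s r (\<lambda>t. t ^ (DIM('a) - 1) * (A t * Phi p (u' t))) (\<lambda>t. t ^ (DIM('a) - 1) * rhs t)"
proof -
  have F: "loc_integrable (ball 0 R) (\<lambda>x. a (norm x) *\<^sub>R Phi p (grad w x))"
    and low: "loc_integrable (ball 0 R) (lower_order h w)"
    and ph: "loc_integrable (ball 0 R) (\<lambda>x. \<phi> (w x))"
    and eq: "\<And>\<eta>. test_function (ball 0 R) \<eta> \<Longrightarrow>
        (LINT x:ball 0 R|lebesgue. (a (norm x) *\<^sub>R Phi p (grad w x)) \<bullet> grad \<eta> x)
        + (LINT x:ball 0 R|lebesgue. lower_order h w x * \<eta> x) = (LINT x:ball 0 R|lebesgue. \<phi> (w x) * \<eta> x)"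
    using sol unfolding solves_div_def by blast+
  define f where "f x = lower_order h w x - \<phi> (w x)" for x
  have fi: "loc_integrable (ball 0 R) f" unfolding f_def by (rule loc_integrable_diff[OF low ph])
  have fr: "AE x in lebesgue. x \<in> ball 0 R \<longrightarrow> f x = rhs (norm x)" using AE_rhs by (simp add: f_def)
  have "AE x in lebesgue. norm (x::'a) \<in> {0<..<R} \<longrightarrow> A (norm x) = a (norm x)"
    using A by (intro AE_norm) (auto elim!: eventually_mono)
  then have Aa: "AE x in lebesgue. x \<in> ball 0 R \<longrightarrow>
      a (norm x) *\<^sub>R Phi p (grad w x) = (A (norm x) * Phi p (u' (norm x))) *\<^sub>R sgn x"
  proof eventually_elim
    case (elim x)
    then show ?case using Phi_grad[of x] by (cases "x = 0") auto
  qed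
  show ?thesis
  proof (rule radial_weak_imp_ac_deriv[where 'a = 'a, OF _ sr])
    show "continuous_on {s..r} (\<lambda>t. A t * Phi p (u' t))" by (rule cA)
    show "(\<lambda>t. t ^ (DIM('a) - 1) * rhs t) absolutely_integrable_on {s..r}"
      by (rule radial_profile_integrable[OF sr fi rhs_measurable[OF sr] fr])
    fix \<eta> :: "'a \<Rightarrow> real" assume \<eta>: "smooth_bump (ball 0 R) \<eta>"
    have "(LINT x:ball 0 R|lebesgue. ((A (norm x) * Phi p (u' (norm x))) *\<^sub>R sgn x) \<bullet> grad \<eta> x) =
        (LINT x:ball 0 R|lebesgue. (a (norm x) *\<^sub>R Phi p (grad w x)) \<bullet> grad \<eta> x)"
      using Aa by (intro LINT_cong_AE[symmetric] smooth_bump_grad_measurable[OF \<eta> F])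
        (auto elim!: eventually_mono simp del: inner_scaleR_left)
    also have "\<dots> = - (LINT x:ball 0 R|lebesgue. f x * \<eta> x)"
      unfolding f_def bump_integral_diff[OF \<eta> low ph] using eq[OF smooth_bump_test_function[OF \<eta>]] by simp
    also have "(LINT x:ball 0 R|lebesgue. f x * \<eta> x) = (LINT x:ball 0 R|lebesgue. rhs (norm x) * \<eta> x)"
      using smooth_bump_mult_integrable[OF \<eta> fi] fr
      by (intro LINT_cong_AE borel_measurable_integrable) (auto elim!: eventually_mono)
    finally show "(LINT x:ball 0 R|lebesgue. ((A (norm x) * Phi p (u' (norm x))) *\<^sub>R sgn x) \<bullet> grad \<eta> x) =
        - (LINT x:ball 0 R|lebesgue. rhs (norm x) * \<eta> x)" .
  qed
qed

end

section \<open>Uniqueness\<close>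

text \<open>The quotient rule in the form in which the derivative of \<open>\<psi>\<close> is read off from \<open>(\<kappa> \<psi>)' = \<kappa>' \<psi> + \<kappa> \<psi>'\<close>.\<close>

lemma ac_deriv_divide:
  assumes M: "ac_deriv s r M M'" and \<kappa>: "ac_deriv s r \<kappa> \<kappa>'"
    and nz: "\<And>t. t \<in> {s..r} \<Longrightarrow> \<kappa> t \<noteq> 0" and eq: "\<And>t. t \<in> {s..r} \<Longrightarrow> M t = \<kappa> t * \<psi> t"
  shows "ac_deriv s r \<psi> (\<lambda>t. (M' t - \<kappa>' t * \<psi> t) / \<kappa> t)"
proof -
  have "ac_deriv s r (\<lambda>t. inverse (\<kappa> t)) (\<lambda>t. - (inverse (\<kappa> t))\<^sup>2 * \<kappa>' t)"
  proof (rule ac_deriv_chain[OF \<kappa>])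
    show "DERIV inverse (\<kappa> t) :> - (inverse (\<kappa> t))\<^sup>2" if "t \<in> {s..r}" for t
      using DERIV_inverse[OF nz[OF that]] by (simp add: power2_eq_square)
    show "continuous_on {s..r} (\<lambda>t. - (inverse (\<kappa> t))\<^sup>2)"
      using nz by (intro continuous_intros ac_deriv_continuous[OF \<kappa>]) auto
  qed
  from ac_deriv_mult[OF M this] show ?thesis
  proof (rule ac_deriv_cong)
    show "M t * inverse (\<kappa> t) = \<psi> t" if "t \<in> {s..r}" for t using eq[OF that] nz[OF that] by simp
    show "AE t in lebesgue. t \<in> {s..r} \<longrightarrow>
        inverse (\<kappa> t) * M' t + M t * (- (inverse (\<kappa> t))\<^sup>2 * \<kappa>' t) = (M' t - \<kappa>' t * \<psi> t) / \<kappa> t"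
    proof (intro AE_I2 impI)
      fix t assume t: "t \<in> {s..r}"
      show "inverse (\<kappa> t) * M' t + M t * (- (inverse (\<kappa> t))\<^sup>2 * \<kappa>' t) = (M' t - \<kappa>' t * \<psi> t) / \<kappa> t"
        using nz[OF t] unfolding eq[OF t] by (simp add: field_simps power2_eq_square)
    qed
  qed
qed

lemma ac_deriv_power: "ac_deriv s r (\<lambda>t. t ^ m) (\<lambda>t. real m * t ^ (m - 1))"
  by (rule ac_deriv_C1) (auto intro!: derivative_eq_intros continuous_intros)

text \<open>The second almost everywhere condition says that the derivative of \<open>A(t) t\<^sup>p\<^sup>\<mu>\<close> is positive, and
\<open>A\<close> is positive at points arbitrarily close to \<open>0\<close>.\<close>

lemma positive_if_weighted_increasing:
  assumes A: "ac_deriv 0 \<rho> A a'" and p: "0 < p"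
    and A_pos: "AE t in lebesgue. t \<in> {0<..<\<rho>} \<longrightarrow> 0 < A t"
    and d: "AE t in lebesgue. t \<in> {0<..<\<rho>} \<longrightarrow> 0 < \<mu> * (A t / t) + 1 / p * a' t"
    and t: "0 < t" "t \<le> \<rho>"
  shows "0 < A t"
proof -
  define c where "c = p * \<mu>"
  obtain x where x: "0 < x" "x < t" "0 < A x"
  proof -
    have "AE x in lebesgue. x \<in> {0<..<t} \<longrightarrow> 0 < A x"
      using A_pos by eventually_elim (use t in auto)
    from AE_Ioo_ex[OF t(1) this] show ?thesis using that by auto
  qed
  have "ac_deriv x \<rho> (\<lambda>t. t powr c) (\<lambda>t. c * t powr (c - 1))"
    using x by (intro ac_deriv_C1 has_real_derivative_powr continuous_intros) auto
  from ac_deriv_mult[OF ac_deriv_subinterval[OF A, of x \<rho>] this] x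
  have B: "ac_deriv x \<rho> (\<lambda>t. A t * t powr c) (\<lambda>t. t powr c * a' t + A t * (c * t powr (c - 1)))" by simp
  have Bi: "(\<lambda>t. t powr c * a' t + A t * (c * t powr (c - 1))) absolutely_integrable_on {x..t}"
    by (rule abs_int_sub(1)[OF ac_deriv_abs_int[OF B]]) (use x t in auto)
  have "integral {x..t} (\<lambda>_. 0) \<le> integral {x..t} (\<lambda>t. t powr c * a' t + A t * (c * t powr (c - 1)))"
  proof (rule integral_mono_AE_Icc[OF _ Bi])
    show "AE s in lebesgue. s \<in> {x..t} \<longrightarrow> 0 \<le> s powr c * a' s + A s * (c * s powr (c - 1))"
      using d AE_lebesgue_ne[of \<rho>]
    proof eventually_elim
      case (elim s)
      show ?case
      proof
        assume "s \<in> {x..t}"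
        then have s: "s \<in> {0<..<\<rho>}" using elim x t by auto
        have "s powr (c - 1) = s powr c / s" using s by (simp add: powr_diff)
        then have "s powr c * a' s + A s * (c * s powr (c - 1)) = p * s powr c * (\<mu> * (A s / s) + 1 / p * a' s)"
          using p by (simp add: c_def field_simps)
        then show "0 \<le> s powr c * a' s + A s * (c * s powr (c - 1))"
          using elim(1) s p by simp
      qed
    qed
  qed simp
  then have "A x * x powr c \<le> A t * t powr c"
    using ac_deriv_diff[OF B, of x t] x t by simp
  moreover have "0 < A x * x powr c" using x by simp
  ultimately have "0 < A t * t powr c" by linarith
  then show ?thesis using t by (simp add: zero_less_mult_iff)
qed

text \<open>By continuity \<open>t \<phi>(t) \<ge> 0\<close> for every \<open>t\<close>, so the antiderivative that vanishes at \<open>0\<close> increases along every ray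
from \<open>0\<close>.\<close>

lemma nonneg_antiderivative:
  fixes \<phi> :: "real \<Rightarrow> real"
  assumes c: "continuous_on UNIV \<phi>" and sign: "AE t in lebesgue. t * \<phi> t > 0"
  obtains \<Psi> where "\<And>y. DERIV \<Psi> y :> \<phi> y" "\<Psi> 0 = 0" "\<And>y. 0 \<le> \<Psi> y"
proof -
  obtain F where F: "\<And>y. DERIV F y :> \<phi> y" using continuous_antiderivative[OF c] by blast
  have s: "0 \<le> t * \<phi> t" for t
    using sign c by (intro AE_nonneg_imp_nonneg[of UNIV "\<lambda>t. t * \<phi> t"] continuous_intros)
      (auto elim!: eventually_mono)
  have "0 \<le> F y - F 0" for y
  proof -
    have d: "DERIV (\<lambda>s. F (s * y)) s :> \<phi> (s * y) * y" for s
      by (rule DERIV_chain2[OF F]) (auto intro!: derivative_eq_intros)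
    have "0 \<le> \<phi> (s * y) * y" if "0 < s" for s
    proof (rule mult_left_le_imp_le[OF _ that])
      have e: "s * (\<phi> (s * y) * y) = s * y * \<phi> (s * y)" by (simp only: mult.assoc mult.commute[of y])
      show "s * 0 \<le> s * (\<phi> (s * y) * y)" unfolding e using s[of "s * y"] by simp
    qed
    then have "\<exists>z. DERIV (\<lambda>s. F (s * y)) s :> z \<and> 0 \<le> z" if "0 < s" for s using d that by blast
    moreover have "continuous_on {0..1} (\<lambda>s. F (s * y))"
      by (rule DERIV_continuous_on[OF has_field_derivative_at_within[OF d]])
    ultimately have "F (0 * y) \<le> F (1 * y)"
      by (intro DERIV_nonneg_imp_increasing_open[where f = "\<lambda>s. F (s * y)" and a = 0 and b = 1]) simp_all
    then show ?thesis by simp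
  qed
  moreover have "DERIV (\<lambda>y. F y - F 0) y :> \<phi> y" for y
    using DERIV_diff[OF F DERIV_const] by simp
  ultimately show ?thesis using that[of "\<lambda>y. F y - F 0"] by simp
qed

locale uniqueness_data =
  fixes R p l \<theta> :: real and \<phi> a a' q v :: "real \<Rightarrow> real" and h :: "real \<Rightarrow> real \<Rightarrow> real \<Rightarrow> real"
  assumes R: "0 < R" and p: "1 < p" and l: "0 < l" "l < p" and \<theta>: "0 < \<theta>"
    and c\<phi>: "continuous_on UNIV \<phi>" and odd\<phi>: "\<forall>t. \<phi> (- t) = - \<phi> t"
    and sign\<phi>: "AE t in lebesgue. t * \<phi> t > 0"
    and W11: "W11_loc R a a'"
    and a_pos: "AE \<tau> in lebesgue. \<tau> \<in> {0<..<R} \<longrightarrow> a \<tau> > 0"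
    and h: "caratheodory R h"
    and q_nonneg: "\<forall>\<tau>\<in>{0<..<R}. q \<tau> \<ge> 0" and q: "L1_loc R q"
    and v_pos: "AE \<tau> in lebesgue. \<tau> \<in> {0<..<R} \<longrightarrow> v \<tau> > 0"
    and v: "L1_loc R v" and v_dual: "L1_loc R (\<lambda>\<tau>. v \<tau> powr (- (1 / (p - 1))))"
    and h_bound: "AE \<tau> in lebesgue. \<tau> \<in> {0<..<R} \<longrightarrow> (\<forall>y z.
           h \<tau> y z * z \<le> \<theta> * q \<tau> * \<bar>y\<bar> powr l * \<bar>z\<bar> powr (p - l) + (1 - \<theta>) * v \<tau> * \<bar>z\<bar> powr p)"
    and K: "\<forall>r. 0 < r \<and> r < R \<longrightarrow> K_const p l 0 r q v < \<infinity>"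
begin

lemma L1_loc_Icc: "L1_loc R f \<Longrightarrow> 0 < r \<Longrightarrow> r < R \<Longrightarrow> f absolutely_integrable_on {0..r}"
  by (simp add: L1_loc_def absolutely_integrable_on_Icc_iff_Ioo)

lemma a_int: "0 < r \<Longrightarrow> r < R \<Longrightarrow> a absolutely_integrable_on {0..r}"
  using W11 by (simp add: W11_loc_def absolutely_integrable_on_Icc_iff_Ioo)

lemma continuous_coefficient:
  assumes \<rho>: "0 < \<rho>" "\<rho> < R"
  obtains A where "ac_deriv 0 \<rho> A a'" "AE t in lebesgue. t \<in> {0<..<\<rho>} \<longrightarrow> a t = A t"
    "\<And>t. t \<in> {0..\<rho>} \<Longrightarrow> 0 \<le> A t"
proof -
  have "a' absolutely_integrable_on {0..\<rho>}" "weak_partial {0<..<\<rho>} 1 a a'"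
    using W11 \<rho> by (auto simp: W11_loc_def absolutely_integrable_on_Icc_iff_Ioo)
  from weak_partial_imp_ac_deriv[OF \<rho>(1) this(2) a_int[OF \<rho>] this(1)]
  obtain A where A: "ac_deriv 0 \<rho> A a'" "AE t in lebesgue. t \<in> {0<..<\<rho>} \<longrightarrow> a t = A t" by blast
  have cA: "continuous_on {0..\<rho>} A" by (rule ac_deriv_continuous[OF A(1)])
  have "AE t in lebesgue. t \<in> {0<..<\<rho>} \<longrightarrow> 0 \<le> A t"
    using A(2) a_pos by eventually_elim (use \<rho> in auto)
  from AE_nonneg_imp_nonneg[OF _ continuous_on_subset[OF cA] this]
  have "0 \<le> A t" if "t \<in> {0<..<\<rho>}" for t using that by (simp add: subset_iff)
  moreover have "closure {0<..<\<rho>} = {0..\<rho>}" using \<rho> by simp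
  ultimately have "0 \<le> A t" if "t \<in> {0..\<rho>}" for t
    using continuous_ge_on_closure[of "{0<..<\<rho>}" A t 0] cA that by simp
  then show ?thesis by (rule that[OF A])
qed

text \<open>In both cases the flux \<open>t\<^sup>n\<^sup>-\<^sup>1 k(t)\<close> is a known absolutely continuous multiple \<open>\<kappa>\<close> of \<open>Phi p (u' t)\<close>, namely with
\<open>\<kappa> = t\<^sup>n\<^sup>-\<^sup>1\<close> or \<open>\<kappa> = t\<^sup>n\<^sup>-\<^sup>1 A(t)\<close>. Dividing by \<open>\<kappa>\<close> gives the derivative of \<open>Phi p (u' t)\<close>, and the definition of \<open>v\<close>
turns the result into the profile equation.\<close>

lemma profile_energy_setup:
  fixes w :: "'a::euclidean_space \<Rightarrow> real"
  assumes prof: "radial_profile R p \<phi> u u' h w" and u0: "u 0 = 0"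
    and sol: "(v = delta_coeff DIM('a) p a a' \<and> solves_nondiv R p a h \<phi> w) \<or>
      (v = d_coeff DIM('a) p a a' \<and> solves_div R p a h \<phi> w)"
    and \<rho>: "0 < \<rho>" "\<rho> < R"
    and \<Psi>: "\<And>y. DERIV \<Psi> y :> \<phi> y" "\<Psi> 0 = 0" "\<And>y. 0 \<le> \<Psi> y"
  shows "\<exists>A \<psi>'. energy_setup p l \<theta> \<rho> A a' q v (\<lambda>t. h t (u t) (u' t)) \<phi> \<Psi> u u' \<psi>'"
proof -
  interpret radial_profile R p \<phi> u u' h w by (rule prof)
  obtain A where A: "ac_deriv 0 \<rho> A a'" "AE t in lebesgue. t \<in> {0<..<\<rho>} \<longrightarrow> a t = A t"
    "\<And>t. t \<in> {0..\<rho>} \<Longrightarrow> 0 \<le> A t"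
    using continuous_coefficient[OF \<rho>] by blast
  define m where "m = DIM('a) - 1"
  have m: "real DIM('a) - 1 = real m" by (simp add: m_def of_nat_diff)
  have pow: "t ^ (m - 1) * real m = real m * t ^ m / t" if "0 < t" for t :: real
    using that by (cases m) auto
  have "\<exists>\<psi>'. (\<forall>s. 0 < s \<and> s \<le> \<rho> \<longrightarrow> ac_deriv s \<rho> (\<lambda>t. Phi p (u' t)) \<psi>') \<and>
      (AE t in lebesgue. t \<in> {0<..<\<rho>} \<longrightarrow>
        A t * \<psi>' t = rhs t - (v t + (1 - 1 / p) * a' t) * Phi p (u' t))"
    using sol
  proof (elim disjE conjE)
    assume v_eq: "v = delta_coeff DIM('a) p a a'" and nd: "solves_nondiv R p a h \<phi> w"
    define \<psi>' where "\<psi>' t = (t ^ m * (rhs t / a t) - real m * t ^ (m - 1) * Phi p (u' t)) / t ^ m" for t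
    have "ac_deriv s \<rho> (\<lambda>t. Phi p (u' t)) \<psi>'" if s: "0 < s" for s
      unfolding \<psi>'_def[abs_def] m_def
      by (rule ac_deriv_divide[OF nondivergence_profile[OF nd a_int a_pos s \<rho>(2)] ac_deriv_power])
         (use s in auto)
    moreover have "AE t in lebesgue. t \<in> {0<..<\<rho>} \<longrightarrow>
        A t * \<psi>' t = rhs t - (v t + (1 - 1 / p) * a' t) * Phi p (u' t)"
      using A(2) a_pos
    proof eventually_elim
      case (elim t)
      show ?case
      proof
        assume t: "t \<in> {0<..<\<rho>}"
        then have at: "a t > 0" "A t = a t" and tp: "t > 0" using elim \<rho> by auto
        have "\<psi>' t = rhs t / a t - real m / t * Phi p (u' t)"
          unfolding \<psi>'_def using tp pow[OF tp] by (simp add: diff_divide_distrib mult.commute[of "real m"])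
        then have "A t * \<psi>' t = rhs t - real m * (a t / t) * Phi p (u' t)"
          using at by (simp add: right_diff_distrib)
        then show "A t * \<psi>' t = rhs t - (v t + (1 - 1 / p) * a' t) * Phi p (u' t)"
          unfolding v_eq delta_coeff_def m by (simp add: algebra_simps)
      qed
    qed
    ultimately show ?thesis by blast
  next
    assume v_eq: "v = d_coeff DIM('a) p a a'" and dv: "solves_div R p a h \<phi> w"
    have A_pos: "0 < A t" if "0 < t" "t \<le> \<rho>" for t
    proof (rule positive_if_weighted_increasing[OF A(1) _ _ _ that])
      show "AE t in lebesgue. t \<in> {0<..<\<rho>} \<longrightarrow> 0 < A t"
        using A(2) a_pos by eventually_elim (use \<rho> in auto)
      show "AE t in lebesgue. t \<in> {0<..<\<rho>} \<longrightarrow> 0 < real m * (A t / t) + 1 / p * a' t"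
        using A(2) v_pos by eventually_elim (use \<rho> in \<open>auto simp: v_eq d_coeff_def m\<close>)
    qed (use p in simp)
    \<comment> \<open>\<open>A\<close> represents \<open>a\<close> on \<open>[0,\<rho>]\<close> only.\<close>
    define B where "B t = (if t \<le> \<rho> then A t else a t)" for t
    have Ba: "AE t in lebesgue. t \<in> {0<..<R} \<longrightarrow> B t = a t"
      using A(2) AE_lebesgue_ne[of \<rho>] by eventually_elim (auto simp: B_def)
    define \<psi>' where "\<psi>' t = (t ^ m * rhs t - (A t * (real m * t ^ (m - 1)) + t ^ m * a' t) * Phi p (u' t))
        / (t ^ m * A t)" for t
    have "ac_deriv s \<rho> (\<lambda>t. Phi p (u' t)) \<psi>'" if s: "0 < s" for s
    proof -
      have As: "ac_deriv s \<rho> A a'" using s by (intro ac_deriv_subinterval[OF A(1)]) auto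
      have "continuous_on {s..\<rho>} B"
        by (rule continuous_on_eq[OF ac_deriv_continuous[OF As]]) (simp add: B_def)
      then have cB: "continuous_on {s..\<rho>} (\<lambda>t. B t * Phi p (u' t))"
        by (rule continuous_on_mult[OF _ continuous_Phi_u'[OF s \<rho>(2)]])
      show ?thesis
        unfolding \<psi>'_def[abs_def]
        by (rule ac_deriv_divide[OF divergence_profile[OF dv Ba s \<rho>(2) cB, folded m_def]
              ac_deriv_mult[OF ac_deriv_power As]])
           (use s A_pos in \<open>auto simp: B_def less_imp_neq[symmetric]\<close>)
    qed
    moreover have "AE t in lebesgue. t \<in> {0<..<\<rho>} \<longrightarrow>
        A t * \<psi>' t = rhs t - (v t + (1 - 1 / p) * a' t) * Phi p (u' t)"
      using A(2)
    proof eventually_elim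
      case (elim t)
      show ?case
      proof
        assume t: "t \<in> {0<..<\<rho>}"
        then have at: "A t > 0" "a t = A t" and tp: "t > 0" using elim A_pos[of t] by auto
        have "A t * \<psi>' t = (t ^ m * rhs t - (A t * (real m * t ^ (m - 1)) + t ^ m * a' t) * Phi p (u' t)) / t ^ m"
          unfolding \<psi>'_def using at tp by simp
        also have "\<dots> = rhs t - (A t * (real m * t ^ (m - 1) / t ^ m) + a' t) * Phi p (u' t)"
          using tp by (simp add: field_simps)
        also have "real m * t ^ (m - 1) / t ^ m = real m / t"
          using tp pow[OF tp] by (simp add: mult.commute[of "real m"])
        finally show "A t * \<psi>' t = rhs t - (v t + (1 - 1 / p) * a' t) * Phi p (u' t)"
          unfolding v_eq d_coeff_def m at(2) by (simp add: algebra_simps)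
      qed
    qed
    ultimately show ?thesis by blast
  qed
  then obtain \<psi>' where \<psi>': "\<And>s. 0 < s \<Longrightarrow> s \<le> \<rho> \<Longrightarrow> ac_deriv s \<rho> (\<lambda>t. Phi p (u' t)) \<psi>'"
    "AE t in lebesgue. t \<in> {0<..<\<rho>} \<longrightarrow> A t * \<psi>' t = rhs t - (v t + (1 - 1 / p) * a' t) * Phi p (u' t)"
    by blast
  have "energy_setup p l \<theta> \<rho> A a' q v (\<lambda>t. h t (u t) (u' t)) \<phi> \<Psi> u u' \<psi>'"
  proof
    show "DERIV u t :> u' t" if "t \<in> {0..\<rho>}" for t using du that \<rho> by auto
    show "continuous_on {0..\<rho>} u'" using \<rho> by (intro continuous_on_subset[OF cu']) auto
    show "ac_deriv s \<rho> (\<lambda>t. Phi p (u' t)) \<psi>'" if "0 < s" "s \<le> \<rho>" for s using \<psi>'(1) that .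
    show "AE t in lebesgue. t \<in> {0<..<\<rho>} \<longrightarrow>
        A t * \<psi>' t = h t (u t) (u' t) - \<phi> (u t) - (v t + (1 - 1 / p) * a' t) * Phi p (u' t)"
      using \<psi>'(2) by (simp add: rhs_def)
    show "AE t in lebesgue. t \<in> {0<..<\<rho>} \<longrightarrow> h t (u t) (u' t) * u' t
        \<le> \<theta> * q t * \<bar>u t\<bar> powr l * \<bar>u' t\<bar> powr (p - l) + (1 - \<theta>) * v t * \<bar>u' t\<bar> powr p"
      using h_bound by eventually_elim (use \<rho> in auto)
    show "0 \<le> q t" if "t \<in> {0<..<\<rho>}" for t using q_nonneg that \<rho> by auto
    show "AE t in lebesgue. t \<in> {0<..<\<rho>} \<longrightarrow> 0 < v t" using v_pos by eventually_elim (use \<rho> in auto)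
    show "(\<lambda>t. q t powr (p / l) * v t powr (- ((p - l) / l)) *
        integral {0..t} (\<lambda>\<sigma>. v \<sigma> powr (- (1 / (p - 1)))) powr (p - 1)) absolutely_integrable_on {0..\<rho>}"
      using K \<rho> by (intro K_const_finite_imp p l L1_loc_Icc q v v_dual) auto
  qed (use p l \<theta> \<rho> A u0 u'0 \<Psi> c\<phi> L1_loc_Icc[OF q \<rho>] L1_loc_Icc[OF v \<rho>] L1_loc_Icc[OF v_dual \<rho>] in auto)
  then show ?thesis by blast
qed

lemma admissible_profile_zero:
  fixes w :: "'a::euclidean_space \<Rightarrow> real"
  assumes w: "admissible_solution R p a a' v h \<phi> w"
  obtains u u' where "radial_profile R p \<phi> u u' h w" "\<And>t. t \<in> {0..<R} \<Longrightarrow> u t = 0"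
proof -
  have C1: "C1_on (ball 0 R) w" and rad: "radial_on (ball 0 R) w" and w0: "w 0 = 0"
    and sol: "(v = delta_coeff DIM('a) p a a' \<and> solves_nondiv R p a h \<phi> w) \<or>
      (v = d_coeff DIM('a) p a a' \<and> solves_div R p a h \<phi> w)"
    using w by (auto simp: admissible_solution_def)
  obtain u u' where u: "\<And>x. x \<in> ball 0 R \<Longrightarrow> w x = u (norm x)"
    "\<And>t. \<bar>t\<bar> < R \<Longrightarrow> DERIV u t :> u' t" "continuous_on {-R<..<R} u'" "u' 0 = 0"
    "\<And>x. x \<in> ball 0 R \<Longrightarrow> grad w x = u' (norm x) *\<^sub>R sgn x"
    using radial_C1_profile[OF R C1 rad] by blast
  have prof: "radial_profile R p \<phi> u u' h w"
    by (unfold_locales) (use R p u c\<phi> h in auto)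
  have u0: "u 0 = 0" using u(1)[of 0] w0 R by simp
  obtain \<Psi> where \<Psi>: "\<And>y. DERIV \<Psi> y :> \<phi> y" "\<Psi> 0 = 0" "\<And>y. 0 \<le> \<Psi> y"
    using nonneg_antiderivative[OF c\<phi> sign\<phi>] by blast
  have "u t = 0" if t: "t \<in> {0..<R}" for t
  proof -
    \<comment> \<open>Any number between \<open>t\<close> and \<open>R\<close>.\<close>
    define \<rho> where "\<rho> = (t + R) / 2"
    have \<rho>: "0 < \<rho>" "\<rho> < R" "t \<in> {0..\<rho>}" using t R by (auto simp: \<rho>_def)
    obtain A \<psi>' where "energy_setup p l \<theta> \<rho> A a' q v (\<lambda>t. h t (u t) (u' t)) \<phi> \<Psi> u u' \<psi>'"
      using profile_energy_setup[OF prof u0 sol \<rho>(1,2) \<Psi>] by blast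
    then show ?thesis using \<rho>(3) by (rule energy_setup.profile_vanishes)
  qed
  with prof show ?thesis using that by blast
qed

lemma admissible_imp_zero:
  fixes w :: "'a::euclidean_space \<Rightarrow> real"
  assumes "admissible_solution R p a a' v h \<phi> w" "x \<in> ball 0 R"
  shows "w x = 0"
proof -
  obtain u u' where u: "radial_profile R p \<phi> u u' h w" "\<And>t. t \<in> {0..<R} \<Longrightarrow> u t = 0"
    using admissible_profile_zero[OF assms(1)] by blast
  show ?thesis using radial_profile.wu[OF u(1) assms(2)] u(2)[of "norm x"] assms(2) by simp
qed

text \<open>The flux of the zero solution vanishes, so \<open>ac_deriv_zero_imp_AE_zero\<close> kills the right-hand side of the
profile equation, which is \<open>h t 0 0\<close> because the odd function \<open>\<phi>\<close> vanishes at \<open>0\<close>.\<close>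

lemma admissible_imp_source_zero:
  fixes w :: "'a::euclidean_space \<Rightarrow> real"
  assumes w: "admissible_solution R p a a' v h \<phi> w"
  shows "AE t in lebesgue. t \<in> {0<..<R} \<longrightarrow> h t 0 0 = 0"
proof -
  obtain u u' where prof: "radial_profile R p \<phi> u u' h w" and u: "\<And>t. t \<in> {0..<R} \<Longrightarrow> u t = 0"
    using admissible_profile_zero[OF w] by blast
  interpret radial_profile R p \<phi> u u' h w by (rule prof)
  have u'0: "u' t = 0" if t: "t \<in> {0<..<R}" for t
  proof -
    have "DERIV u t :> 0"
      by (rule has_field_derivative_transform_within_open[of "\<lambda>_. 0" _ _ "{0<..<R}"]) (use t u in auto)
    moreover have "DERIV u t :> u' t" using du t by auto
    ultimately show ?thesis by (rule DERIV_unique[symmetric])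
  qed
  have rhs: "rhs t = h t 0 0" if "t \<in> {0<..<R}" for t
    using u[of t] u'0[OF that] that spec[OF odd\<phi>, of 0] by (simp add: rhs_def)
  have loc: "AE t in lebesgue. t \<in> {s<..<r} \<longrightarrow> h t 0 0 = 0" if sr: "0 < s" "r < R" for s r
    using w unfolding admissible_solution_def
  proof (elim conjE disjE)
    assume nd: "solves_nondiv R p a h \<phi> w"
    have "ac_deriv s r (\<lambda>_. 0) (\<lambda>t. t ^ (DIM('a) - 1) * (rhs t / a t))"
      by (rule ac_deriv_cong[OF nondivergence_profile[OF nd a_int a_pos sr]]) (use u'0 sr in \<open>auto simp: Phi_def\<close>)
    from ac_deriv_zero_imp_AE_zero[OF this] a_pos show ?thesis
      by eventually_elim (use sr rhs in auto)
  next
    assume dv: "solves_div R p a h \<phi> w"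
    have zero: "a t * Phi p (u' t) = 0" if "t \<in> {s..r}" for t
      using u'0[of t] that sr by (simp add: Phi_def)
    then have "continuous_on {s..r} (\<lambda>t. a t * Phi p (u' t))"
      by (intro continuous_on_eq[OF continuous_on_const[of _ 0]]) simp
    then have "ac_deriv s r (\<lambda>t. t ^ (DIM('a) - 1) * (a t * Phi p (u' t))) (\<lambda>t. t ^ (DIM('a) - 1) * rhs t)"
      by (intro divergence_profile[OF dv _ sr]) auto
    then have "ac_deriv s r (\<lambda>_. 0) (\<lambda>t. t ^ (DIM('a) - 1) * rhs t)"
      by (rule ac_deriv_cong) (use zero in auto)
    from ac_deriv_zero_imp_AE_zero[OF this] show ?thesis
      by eventually_elim (use sr rhs in auto)
  qed
  \<comment> \<open>Countably many compact subintervals exhaust \<open>(0,R)\<close>.\<close>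
  have "AE t in lebesgue. \<forall>n::nat. t \<in> {R / real (n + 1)<..<R - R / real (n + 1)} \<longrightarrow> h t 0 0 = 0"
    unfolding AE_all_countable using R by (intro allI loc) auto
  then show ?thesis
  proof eventually_elim
    case (elim t)
    show ?case
    proof
      assume t: "t \<in> {0<..<R}"
      obtain n where n: "R / min t (R - t) < real n" using reals_Archimedean2 by blast
      have mp: "0 < min t (R - t)" using t by auto
      have "R < real n * min t (R - t)" using n mp by (simp add: divide_less_eq)
      also have "\<dots> \<le> real (n + 1) * min t (R - t)" using mp by (intro mult_right_mono) auto
      finally have "R < min t (R - t) * real (n + 1)" by (simp only: mult.commute)
      then have "R / real (n + 1) < min t (R - t)" by (subst pos_divide_less_eq) auto
      then show "h t 0 0 = 0" using elim[rule_format, of n] by auto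
    qed
  qed
qed

end

theorem theorem5:
  fixes R p l \<theta> :: real
    and \<phi> a a' q v :: "real \<Rightarrow> real"
    and h :: "real \<Rightarrow> real \<Rightarrow> real \<Rightarrow> real"
  assumes "CARD('n::finite) \<ge> 2"
    and "0 < R" and "1 < p" and "0 < l" and "l < p" and "0 < \<theta>" and "\<theta> \<le> 1"
    and "continuous_on UNIV \<phi>" and "\<forall>t. \<phi> (- t) = - \<phi> t"
    and "AE t in lebesgue. t * \<phi> t > 0"
    and "W11_loc R a a'"
    and "AE \<tau> in lebesgue. \<tau> \<in> {0<..<R} \<longrightarrow> a \<tau> > 0"
    and "caratheodory R h"
    and "\<forall>\<tau>\<in>{0<..<R}. q \<tau> \<ge> 0" and "L1_loc R q"
    and "AE \<tau> in lebesgue. \<tau> \<in> {0<..<R} \<longrightarrow> v \<tau> > 0"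
    and "L1_loc R v" and "L1_loc R (\<lambda>\<tau>. v \<tau> powr (- (1 / (p - 1))))"
    and "AE \<tau> in lebesgue. \<tau> \<in> {0<..<R} \<longrightarrow> (\<forall>y z.
           h \<tau> y z * z \<le> \<theta> * q \<tau> * \<bar>y\<bar> powr l * \<bar>z\<bar> powr (p - l) + (1 - \<theta>) * v \<tau> * \<bar>z\<bar> powr p)"
    and "\<forall>r. 0 < r \<and> r < R \<longrightarrow> K_const p l 0 r q v < \<infinity>"
  shows "(\<forall>w :: real ^ 'n \<Rightarrow> real. admissible_solution R p a a' v h \<phi> w \<longrightarrow>
            (\<forall>x\<in>ball 0 R. w x = 0)) \<and>
         (emeasure lebesgue {\<tau> \<in> {0<..<R}. h \<tau> 0 0 \<noteq> 0} > 0 \<longrightarrow>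
            \<not> (\<exists>w :: real ^ 'n \<Rightarrow> real. admissible_solution R p a a' v h \<phi> w))"
proof -
  interpret uniqueness_data R p l \<theta> \<phi> a a' q v h
    by unfold_locales (fact assms)+
  show ?thesis
  proof (intro conjI allI impI ballI notI)
    fix w :: "real ^ 'n \<Rightarrow> real" and x :: "real ^ 'n"
    assume "admissible_solution R p a a' v h \<phi> w" "x \<in> ball 0 R"
    then show "w x = 0" by (rule admissible_imp_zero)
  next
    assume pos: "emeasure lebesgue {\<tau> \<in> {0<..<R}. h \<tau> 0 0 \<noteq> 0} > 0"
    assume "\<exists>w :: real ^ 'n \<Rightarrow> real. admissible_solution R p a a' v h \<phi> w"
    then have "AE \<tau> in lebesgue. \<tau> \<in> {0<..<R} \<longrightarrow> h \<tau> 0 0 = 0"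
      using admissible_imp_source_zero by blast
    then have "{\<tau>. \<not> (\<tau> \<in> {0<..<R} \<longrightarrow> h \<tau> 0 0 = 0)} \<in> null_sets lebesgue"
      by (simp only: completion.AE_iff_null_sets space_completion space_lborel space_borel UNIV_I simp_thms)
    moreover have "{\<tau>. \<not> (\<tau> \<in> {0<..<R} \<longrightarrow> h \<tau> 0 0 = 0)} = {\<tau> \<in> {0<..<R}. h \<tau> 0 0 \<noteq> 0}" by auto
    ultimately show False using pos by auto
  qed
qed

end
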